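(* Let $G$ be a path graph on $n\ge 2$ vertices, and let $\mathbf{k}$ be the degree-vector of $G$. Then $$\operatorname{reg}(S/\mathrm{NI}_{\mathbf{k}}(G))=\left\lfloor\frac{n-2}{4}\right\rfloor.$$ In particular, $\operatorname{reg}(S/\mathrm{NI}_{\mathbf{k}}(G))\le\tau(G)-1$.
   Context: Let $K$ be a field. For a finite simple graph $G$ on $[n]$ without isolated vertices, $S=K[x_1,\ldots,x_n]$; $N_G[i]$ is the closed neighborhood of $i$; $\mathbf{x}_W=\prod_{j\in W}x_j$. For $\mathbf{k}=(k_1,\ldots,k_n)$ with $1\le k_i\le\deg_G(i)+1$, the $\mathbf{k}$-neighborhood ideal is $\mathrm{NI}_{\mathbf{k}}(G)=\sum_{i=1}^n(\mathbf{x}_W: W\subseteq N_G[i],\ |W|=k_i)\subseteq S$. The degree-vector of $G$ is $\mathbf{k}$ with $k_i=\deg_G(i)$ for all $i$. $\tau(G)$ is the vertex cover number of $G$. $\operatorname{reg}$ is Castelnuovo-Mumford regularity. *)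

theory Defs
  imports
    "HOL-Library.Cardinality"
    "HOL-Library.Poly_Mapping"
    "HOL-Library.Set_Algebras"
    "Jordan_Normal_Form.Matrix_Kernel"
begin

section \<open>Graphs\<close>

text \<open>A simple graph on the finite vertex type \<open>'v\<close> is given by its set of edges, which are
  two-element sets of vertices. The set \<open>[n]\<close> is replaced by \<open>'v\<close>, with \<open>n = CARD('v)\<close>.\<close>

type_synonym 'v graph = "'v set set"

definition closed_nbhd :: "'v graph \<Rightarrow> 'v \<Rightarrow> 'v set" where
  "closed_nbhd E i = insert i {j. {i, j} \<in> E}"

definition degree_vector :: "'v graph \<Rightarrow> 'v \<Rightarrow> nat" where
  "degree_vector E i = card {e \<in> E. i \<in> e}"

definition vertex_cover :: "'v graph \<Rightarrow> 'v set \<Rightarrow> bool" where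
  "vertex_cover E C \<longleftrightarrow> (\<forall>e\<in>E. e \<inter> C \<noteq> {})"

definition vertex_cover_number :: "'v::finite graph \<Rightarrow> nat" where
  "vertex_cover_number E = Min (card ` {C. vertex_cover E C})"

text \<open>The vertices may be traversed in any order \<open>f 1, \<dots>, f n\<close>.\<close>

definition path_graph :: "'v::finite graph \<Rightarrow> bool" where
  "path_graph E \<longleftrightarrow>
     (\<exists>f :: nat \<Rightarrow> 'v. bij_betw f {1..CARD('v)} UNIV \<and>
        E = {{f i, f (i + 1)} |i. 1 \<le> i \<and> i < CARD('v)})"


section \<open>Polynomials and the neighborhood ideal\<close>

text \<open>\<open>('v, 'k) mpoly\<close> is the polynomial ring \<open>S\<close> over \<open>'k\<close> with one variable for each element
  of \<open>'v\<close>.\<close>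

type_synonym ('v, 'k) mpoly = "('v \<Rightarrow>\<^sub>0 nat) \<Rightarrow>\<^sub>0 'k"

definition var :: "'v \<Rightarrow> ('v, 'k::comm_ring_1) mpoly" where
  "var v = Poly_Mapping.single (Poly_Mapping.single v 1) 1"

text \<open>Ideals of a commutative ring are the submodules of the ring regarded as a module over itself;
  \<open>ideal.span A\<close> is the ideal generated by \<open>A\<close>.\<close>

global_interpretation ideal: module "(*) :: 'a \<Rightarrow> 'a \<Rightarrow> 'a::comm_ring_1"
  by standard (simp_all add: algebra_simps)

text \<open>The outer sum is the sum of ideals, i.e. the elementwise sum of sets.\<close>

definition nbhd_ideal :: "('v \<Rightarrow> nat) \<Rightarrow> 'v::finite graph \<Rightarrow> ('v, 'k::field) mpoly set" where
  "nbhd_ideal k E =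
     (\<Sum>i\<in>UNIV. ideal.span {\<Prod>j\<in>W. var j |W. W \<subseteq> closed_nbhd E i \<and> card W = k i})"


section \<open>Castelnuovo-Mumford regularity\<close>

definition mon_deg :: "('v \<Rightarrow>\<^sub>0 nat) \<Rightarrow> nat" where
  "mon_deg m = (\<Sum>v\<in>Poly_Mapping.keys m. Poly_Mapping.lookup m v)"

text \<open>Degrees are integers since shifts may be negative; the zero polynomial is homogeneous of
  every degree.\<close>

definition homogeneous :: "int \<Rightarrow> ('v, 'k::field) mpoly \<Rightarrow> bool" where
  "homogeneous d p \<longleftrightarrow> (\<forall>m\<in>Poly_Mapping.keys p. int (mon_deg m) = d)"

definition irrelevant_ideal :: "('v, 'k::field) mpoly set" where
  "irrelevant_ideal = ideal.span (range var)"

text \<open>A graded free resolution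
    \<open>\<dots> \<longrightarrow> F\<^sub>2 \<longrightarrow> F\<^sub>1 \<longrightarrow> F\<^sub>0 \<longrightarrow> S/I \<longrightarrow> 0\<close>
  by finitely generated free modules. Here \<open>F\<^sub>i\<close> is the direct sum of the \<open>S(-c)\<close> for \<open>c\<close> in the
  list \<open>sh i\<close>, so its basis elements have the degrees listed in \<open>sh i\<close> (with repetitions). The
  matrix \<open>D (i + 1)\<close> is the differential from \<open>F\<^bsub>i+1\<^esub>\<close> to \<open>F\<^sub>i\<close>, and the one-row matrix \<open>D 0\<close>
  lifts the augmentation from \<open>F\<^sub>0\<close> to \<open>S/I\<close> to a map from \<open>F\<^sub>0\<close> to \<open>S\<close>; hence surjectivity and
  exactness at \<open>F\<^sub>0\<close> are stated modulo \<open>I\<close>.\<close>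

definition graded_free_resolution ::
    "('v::finite, 'k::field) mpoly set \<Rightarrow> (nat \<Rightarrow> int list) \<Rightarrow> (nat \<Rightarrow> ('v, 'k) mpoly mat) \<Rightarrow> bool" where
  "graded_free_resolution I sh D \<longleftrightarrow>
     D 0 \<in> carrier_mat 1 (length (sh 0)) \<and>
     (\<forall>b < length (sh 0). homogeneous (sh 0 ! b) (D 0 $$ (0, b))) \<and>
     (\<forall>i. D (Suc i) \<in> carrier_mat (length (sh i)) (length (sh (Suc i))) \<and>
        (\<forall>a < length (sh i). \<forall>b < length (sh (Suc i)).
           homogeneous (sh (Suc i) ! b - sh i ! a) (D (Suc i) $$ (a, b)))) \<and>
     (\<forall>p. \<exists>v \<in> carrier_vec (length (sh 0)). p - (D 0 *\<^sub>v v) $ 0 \<in> I) \<and>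
     {v \<in> carrier_vec (length (sh 0)). (D 0 *\<^sub>v v) $ 0 \<in> I}
       = (\<lambda>w. D 1 *\<^sub>v w) ` carrier_vec (length (sh 1)) \<and>
     (\<forall>i. mat_kernel (D (Suc i))
       = (\<lambda>w. D (Suc (Suc i)) *\<^sub>v w) ` carrier_vec (length (sh (Suc (Suc i)))))"

text \<open>Minimality: the image of each differential lies in the irrelevant ideal times its target.\<close>

definition minimal_graded_free_resolution ::
    "('v::finite, 'k::field) mpoly set \<Rightarrow> (nat \<Rightarrow> int list) \<Rightarrow> (nat \<Rightarrow> ('v, 'k) mpoly mat) \<Rightarrow> bool" where
  "minimal_graded_free_resolution I sh D \<longleftrightarrow>
     graded_free_resolution I sh D \<and>
     (\<forall>i. \<forall>a < length (sh i). \<forall>b < length (sh (Suc i)). D (Suc i) $$ (a, b) \<in> irrelevant_ideal)"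

text \<open>The graded Betti numbers of \<open>S/I\<close> for a homogeneous ideal \<open>I\<close>. A minimal graded free
  resolution exists and is unique up to isomorphism, so the choice made here is immaterial.\<close>

definition graded_betti :: "('v::finite, 'k::field) mpoly set \<Rightarrow> nat \<Rightarrow> int \<Rightarrow> nat" where
  "graded_betti I i j =
     count_list ((SOME sh. \<exists>D. minimal_graded_free_resolution I sh D) i) j"

text \<open>\<open>regularity_quot I\<close> is the regularity of \<open>S/I\<close>, for a homogeneous ideal \<open>I \<noteq> S\<close>. The set
  is then nonempty, and it is finite by Hilbert's syzygy theorem.\<close>

definition regularity_quot :: "('v::finite, 'k::field) mpoly set \<Rightarrow> int" where
  "regularity_quot I = Max {j - int i |i j. graded_betti I i j \<noteq> 0}"

end

theory Submission
  imports Defs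
begin

text \<open>Number the vertices \<open>1, \<dots>, n\<close> along the path. The two end vertices have degree one and contribute the
  variables \<open>1\<close>, \<open>2\<close>, \<open>n - 1\<close>, \<open>n\<close> as generators; the other vertices contribute the products of two variables
  whose positions differ by at most two. Hence the ideal is generated by four variables and the edge ideal of the
  square of the path on the positions \<open>3, \<dots>, n - 2\<close>, and its regularity is \<open>\<nu> = (n - 2) div 4\<close>, the induced
  matching number of that graph.

  \<^emph>\<open>Upper bound\<close> (\<open>regularity_le_square_path\<close>). For a monomial \<open>x\<^sub>W\<close>, multiplication by \<open>x\<^sub>W\<close> embeds \<open>S/(J : x\<^sub>W)\<close>
  into \<open>S/J\<close> with cokernel \<open>S/(J + (x\<^sub>W))\<close>, so the mapping cone of a lift to resolutions is a resolution of the
  cokernel (\<open>regularity_le_insert\<close>). The edges are added one by one, ordered by their larger end \<open>m\<close>. The colon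
  ideals that arise are generated by variables and by the edges up to \<open>m - 4\<close> or \<open>m - 5\<close>, and each cone over such a
  colon ideal costs one. By induction the regularity for the edges up to \<open>m\<close> is at most \<open>m div 4\<close>.

  \<^emph>\<open>Lower bound\<close> (\<open>restriction_shifts\<close>, \<open>koszul_resolution\<close>). The edges \<open>{3, 4}, {7, 8}, \<dots>\<close> form an induced
  matching with \<open>\<nu>\<close> edges: putting all other variables to \<open>0\<close> leaves the ideal of \<open>\<nu>\<close> quadrics with disjoint supports.
  Its Koszul resolution is minimal and has a basis element of degree \<open>2\<nu>\<close> in homological degree \<open>\<nu>\<close>. This resolution
  is a retract of the restriction of any resolution of \<open>S/I\<close>, so that degree occurs there as well.

  The regularity is defined by the degrees of an arbitrarily chosen minimal resolution. Two facts connect it with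
  the resolutions above. A chain map of a minimal resolution over the identity is the identity modulo the
  irrelevant ideal; if it factors through another complex, all degrees of the minimal resolution occur in that complex
  (\<open>shifts_subset\<close>). And a minimal resolution exists: it is built by choosing shortest homogeneous generating systems of the
  cycles, which are finitely generated by comparison with the mapping cones (\<open>minimal_graded_resolution_exists\<close>).

  The bound by the vertex cover number follows since the path has \<open>n div 2\<close> disjoint edges.\<close>

section \<open>Polynomials and monomial ideals\<close>

lift_definition poly_filter :: "('a \<Rightarrow> bool) \<Rightarrow> ('a \<Rightarrow>\<^sub>0 'b::zero) \<Rightarrow> ('a \<Rightarrow>\<^sub>0 'b)"
  is "\<lambda>P f m. if P m then f m else 0"
  by (rule finite_subset) auto

lemma lookup_poly_filter [simp]: "Poly_Mapping.lookup (poly_filter P p) m = (if P m then Poly_Mapping.lookup p m else 0)"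
  by transfer simp

lemma keys_poly_filter [simp]: "Poly_Mapping.keys (poly_filter P p) = {m \<in> Poly_Mapping.keys p. P m}"
  by (auto simp: in_keys_iff split: if_splits)

lemma poly_filter_add: "poly_filter P (p + q) = poly_filter P p + poly_filter P (q :: 'a \<Rightarrow>\<^sub>0 'b::comm_monoid_add)"
  by (rule poly_mapping_eqI) (simp add: lookup_add)

lemma poly_filter_diff: "poly_filter P (p - q) = poly_filter P p - poly_filter P (q :: 'a \<Rightarrow>\<^sub>0 'b::ab_group_add)"
  by (rule poly_mapping_eqI) (simp add: lookup_minus)

lemma poly_filter_zero [simp]: "poly_filter P 0 = 0"
  by (rule poly_mapping_eqI) simp

lemma poly_filter_sum: "poly_filter P (sum f A) = (\<Sum>x\<in>A. poly_filter P (f x :: 'a \<Rightarrow>\<^sub>0 'b::comm_monoid_add))"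
  by (induction A rule: infinite_finite_induct) (simp_all add: poly_filter_add)

lemma poly_filter_id: "(\<And>m. m \<in> Poly_Mapping.keys p \<Longrightarrow> P m) \<Longrightarrow> poly_filter P p = p"
  by (rule poly_mapping_eqI) (auto simp: in_keys_iff)

lemma poly_mapping_sum_single: "p = (\<Sum>m\<in>Poly_Mapping.keys p. Poly_Mapping.single m (Poly_Mapping.lookup p m))"
  for p :: "'a \<Rightarrow>\<^sub>0 'b::comm_monoid_add"
  by (rule poly_mapping_eqI)
     (simp add: lookup_sum lookup_single when_def in_keys_iff sum.delta cong: if_cong)

lemma poly_filter_single: "poly_filter P (Poly_Mapping.single m c) = (if P m then Poly_Mapping.single m c else 0)"
  by (rule poly_mapping_eqI) (simp add: lookup_single when_def)

text \<open>If the test on a product of two monomials depends on the second factor alone, filtering commutes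
with multiplication by \<open>p\<close>. Both uses are of this kind: extracting a degree from a product with a
homogeneous factor, and deleting the monomials that leave a set of variables.\<close>

lemma poly_filter_mult:
  fixes p q :: "'a::comm_monoid_add \<Rightarrow>\<^sub>0 'b::comm_ring_1"
  assumes "\<And>a b. a \<in> Poly_Mapping.keys p \<Longrightarrow> P (a + b) = Q b"
  shows "poly_filter P (p * q) = p * poly_filter Q q"
proof -
  define s where "s = (\<lambda>(r :: 'a \<Rightarrow>\<^sub>0 'b) m. Poly_Mapping.single m (Poly_Mapping.lookup r m))"
  have p: "p = (\<Sum>a\<in>Poly_Mapping.keys p. s p a)" and q: "q = (\<Sum>b\<in>Poly_Mapping.keys q. s q b)"
    unfolding s_def by (rule poly_mapping_sum_single)+
  have "poly_filter P (p * q) = poly_filter P (\<Sum>a\<in>Poly_Mapping.keys p. \<Sum>b\<in>Poly_Mapping.keys q. s p a * s q b)"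
    by (subst p, subst q) (simp only: sum_product)
  also have "\<dots> = (\<Sum>a\<in>Poly_Mapping.keys p. \<Sum>b\<in>Poly_Mapping.keys q. s p a * poly_filter Q (s q b))"
    unfolding poly_filter_sum
    by (intro sum.cong refl) (simp add: s_def mult_single poly_filter_single assms)
  also have "\<dots> = (\<Sum>a\<in>Poly_Mapping.keys p. s p a) * poly_filter Q (\<Sum>b\<in>Poly_Mapping.keys q. s q b)"
    by (simp only: sum_product poly_filter_sum)
  finally show ?thesis using p q by simp
qed

definition supp_in :: "'v set \<Rightarrow> ('v \<Rightarrow>\<^sub>0 nat) \<Rightarrow> bool" where
  "supp_in U m \<longleftrightarrow> Poly_Mapping.keys m \<subseteq> U"

lemma keys_add_nat: "Poly_Mapping.keys (a + b :: 'v \<Rightarrow>\<^sub>0 nat) = Poly_Mapping.keys a \<union> Poly_Mapping.keys b"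
  by (auto simp: in_keys_iff lookup_add)

lemma supp_in_add [simp]: "supp_in U (a + b) \<longleftrightarrow> supp_in U a \<and> supp_in U b"
  by (auto simp: supp_in_def keys_add_nat)

lemma poly_filter_supp_mult:
  fixes p q :: "('v, 'k::field) mpoly"
  shows "poly_filter (supp_in U) (p * q) = poly_filter (supp_in U) p * poly_filter (supp_in U) q"
proof -
  define p' where "p' = poly_filter (\<lambda>m. \<not> supp_in U m) p"
  have p: "p = poly_filter (supp_in U) p + p'"
    unfolding p'_def by (rule poly_mapping_eqI) (simp add: lookup_add)
  have "poly_filter (supp_in U) (p * q) = poly_filter (supp_in U) (poly_filter (supp_in U) p * q) + poly_filter (supp_in U) (p' * q)"
    by (subst p) (simp add: distrib_right poly_filter_add)
  also have "poly_filter (supp_in U) (poly_filter (supp_in U) p * q) = poly_filter (supp_in U) p * poly_filter (supp_in U) q"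
    by (rule poly_filter_mult) auto
  also have "poly_filter (supp_in U) (p' * q) = p' * poly_filter (\<lambda>_. False) q"
    by (rule poly_filter_mult) (auto simp: p'_def)
  also have "poly_filter (\<lambda>_. False) q = 0"
    by (rule poly_mapping_eqI) simp
  finally show ?thesis by simp
qed

lemma poly_filter_supp_one [simp]: "poly_filter (supp_in U) (1 :: ('v, 'k::field) mpoly) = 1"
  by (rule poly_filter_id) (simp add: supp_in_def keys_one split: if_splits)

text \<open>Substituting \<open>0\<close> for the variables outside \<open>U\<close> is a ring endomorphism, so it maps complexes of
free modules to complexes of free modules.\<close>

interpretation restrict: comm_ring_hom "poly_filter (supp_in U) :: ('v, 'k::field) mpoly \<Rightarrow> _" for U
  by standard (simp_all add: poly_filter_add poly_filter_supp_mult)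

subsection \<open>Homogeneous components\<close>

abbreviation hcomp :: "int \<Rightarrow> ('v, 'k::field) mpoly \<Rightarrow> ('v, 'k) mpoly" where
  "hcomp d \<equiv> poly_filter (\<lambda>m. int (mon_deg m) = d)"

lemma mon_deg_UNIV: "mon_deg m = (\<Sum>v\<in>UNIV. Poly_Mapping.lookup m v)" for m :: "'v::finite \<Rightarrow>\<^sub>0 nat"
  unfolding mon_deg_def by (rule sum.mono_neutral_left) (auto simp: in_keys_iff)

lemma mon_deg_add: "mon_deg (a + b) = mon_deg a + mon_deg b" for a b :: "'v::finite \<Rightarrow>\<^sub>0 nat"
  by (simp add: mon_deg_UNIV lookup_add sum.distrib)

lemma homogeneous_hcomp [simp]: "homogeneous d (hcomp d p)"
  by (simp add: homogeneous_def)

lemma hcomp_homogeneous: "homogeneous d p \<Longrightarrow> hcomp d p = p"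
  by (rule poly_filter_id) (simp add: homogeneous_def)

lemma hcomp_mult:
  fixes p q :: "('v::finite, 'k::field) mpoly"
  assumes "homogeneous e p"
  shows "hcomp d (p * q) = p * hcomp (d - e) q"
  by (rule poly_filter_mult) (use assms in \<open>auto simp: homogeneous_def mon_deg_add\<close>)

lemma homogeneous_mult:
  fixes p q :: "('v::finite, 'k::field) mpoly"
  assumes "homogeneous d p" "homogeneous e q"
  shows "homogeneous (d + e) (p * q)"
  using hcomp_mult[OF assms(1), of "d + e" q] hcomp_homogeneous[OF assms(2)]
    homogeneous_hcomp[of "d + e" "p * q"] by simp

lemma homogeneous_0 [simp]: "homogeneous d 0"
  by (simp add: homogeneous_def)

lemma homogeneous_1 [simp]: "homogeneous 0 1"
  by (simp add: homogeneous_def mon_deg_def)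

lemma homogeneous_add: "homogeneous d p \<Longrightarrow> homogeneous d q \<Longrightarrow> homogeneous d (p + q)"
  unfolding homogeneous_def using Poly_Mapping.keys_add[of p q] by blast

lemma homogeneous_uminus: "homogeneous d p \<Longrightarrow> homogeneous d (- p)"
  by (auto simp: homogeneous_def in_keys_iff)

lemma homogeneous_sum: "(\<And>x. x \<in> A \<Longrightarrow> homogeneous d (f x)) \<Longrightarrow> homogeneous d (sum f A)"
  by (induction A rule: infinite_finite_induct) (auto intro: homogeneous_add)

subsection \<open>Squarefree monomial ideals\<close>

definition sqfree_monom :: "'v set \<Rightarrow> ('v, 'k::field) mpoly" where
  "sqfree_monom W = (\<Prod>j\<in>W. var j)"

text \<open>Membership in a monomial ideal is decided monomial by monomial, so the ideal is defined by this test.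
Closure under filtering and the computation of colon ideals can then be read off; that the ideal is
the one generated by the monomials is the content of \<open>sqfree_ideal_eq_span\<close> below.\<close>

definition sqfree_ideal :: "'v set set \<Rightarrow> ('v, 'k::field) mpoly set" where
  "sqfree_ideal \<A> = {p. \<forall>m\<in>Poly_Mapping.keys p. \<exists>W\<in>\<A>. W \<subseteq> Poly_Mapping.keys m}"

text \<open>The exponent vector of the squarefree monomial with support \<open>W\<close>.\<close>

definition ind_exp :: "'v::finite set \<Rightarrow> 'v \<Rightarrow>\<^sub>0 nat" where
  "ind_exp W = (\<Sum>v\<in>W. Poly_Mapping.single v 1)"

lemma lookup_ind_exp: "Poly_Mapping.lookup (ind_exp W) v = (if v \<in> W then 1 else 0)"
  by (simp add: ind_exp_def lookup_sum lookup_single when_def)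

lemma keys_ind_exp [simp]: "Poly_Mapping.keys (ind_exp W) = W"
  by (auto simp: in_keys_iff lookup_ind_exp split: if_splits)

lemma sqfree_monom_eq: "sqfree_monom W = Poly_Mapping.single (ind_exp W) (1 :: 'k::field)"
  for W :: "'v::finite set"
proof -
  have "finite W" by simp
  thus ?thesis unfolding sqfree_monom_def ind_exp_def
    by (induction W rule: finite_induct) (simp_all add: var_def mult_single)
qed

lemma sqfree_ideal_eq_span:
  fixes \<A> :: "'v::finite set set"
  shows "ideal.span (sqfree_monom ` \<A>) = (sqfree_ideal \<A> :: ('v, 'k::field) mpoly set)"
proof (intro equalityI subsetI)
  fix p :: "('v, 'k) mpoly"
  assume "p \<in> ideal.span (sqfree_monom ` \<A>)"
  thus "p \<in> sqfree_ideal \<A>"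
  proof (induction rule: ideal.span_induct_alt)
    case base thus ?case by (simp add: sqfree_ideal_def)
  next
    case (step c x y)
    then obtain W where W: "W \<in> \<A>" "x = sqfree_monom W" by blast
    have "\<exists>W\<in>\<A>. W \<subseteq> Poly_Mapping.keys m" if mk: "m \<in> Poly_Mapping.keys (c * x)" for m
    proof -
      obtain a b where "m = a + b" "b \<in> Poly_Mapping.keys x"
        using mk keys_mult[of c x] by blast
      hence "m = a + ind_exp W" using W(2) by (simp add: sqfree_monom_eq)
      thus ?thesis using W(1) by (auto simp: keys_add_nat)
    qed
    moreover have "\<exists>W\<in>\<A>. W \<subseteq> Poly_Mapping.keys m" if "m \<in> Poly_Mapping.keys y" for m
      using step that by (simp add: sqfree_ideal_def)
    ultimately show ?case
      using Poly_Mapping.keys_add[of "c * x" y] by (auto simp: sqfree_ideal_def)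
  qed
next
  fix p :: "('v, 'k) mpoly"
  assume p: "p \<in> sqfree_ideal \<A>"
  have "Poly_Mapping.single m c \<in> ideal.span (sqfree_monom ` \<A>)" if m: "m \<in> Poly_Mapping.keys p" for m and c :: 'k
  proof -
    obtain W where W: "W \<in> \<A>" "W \<subseteq> Poly_Mapping.keys m" using p m by (auto simp: sqfree_ideal_def)
    have "m = (m - ind_exp W) + ind_exp W"
      by (rule poly_mapping_eqI) (use W in \<open>auto simp: lookup_add lookup_minus lookup_ind_exp in_keys_iff subset_iff\<close>)
    hence "Poly_Mapping.single m c = Poly_Mapping.single (m - ind_exp W) c * sqfree_monom W"
      by (simp add: sqfree_monom_eq mult_single)
    moreover have "(sqfree_monom W :: ('v, 'k) mpoly) \<in> ideal.span (sqfree_monom ` \<A>)"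
      using W(1) by (blast intro: ideal.span_base)
    ultimately show ?thesis using ideal.span_scale by simp
  qed
  thus "p \<in> ideal.span (sqfree_monom ` \<A>)"
    by (subst poly_mapping_sum_single[of p]) (rule ideal.span_sum, simp)
qed

lemma sqfree_ideal_zero: "0 \<in> sqfree_ideal \<A>"
  and sqfree_ideal_add: "p \<in> sqfree_ideal \<A> \<Longrightarrow> q \<in> sqfree_ideal \<A> \<Longrightarrow> p + q \<in> sqfree_ideal \<A>"
  and sqfree_ideal_mult: "q \<in> sqfree_ideal \<A> \<Longrightarrow> p * q \<in> sqfree_ideal \<A>"
  for \<A> :: "'v::finite set set" and p q :: "('v, 'k::field) mpoly"
  unfolding sqfree_ideal_eq_span[symmetric]
  by (auto intro: ideal.span_zero ideal.span_add ideal.span_scale)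

lemma sqfree_ideal_poly_filter: "p \<in> sqfree_ideal \<A> \<Longrightarrow> poly_filter P p \<in> sqfree_ideal \<A>"
  by (auto simp: sqfree_ideal_def)

lemma sqfree_ideal_mono:
  "(\<And>W. W \<in> \<A> \<Longrightarrow> \<exists>W'\<in>\<B>. W' \<subseteq> W) \<Longrightarrow> sqfree_ideal \<A> \<subseteq> sqfree_ideal \<B>"
  unfolding sqfree_ideal_def by (auto, meson order_trans)

lemma sqfree_ideal_cong:
  assumes "\<And>W. W \<in> \<A> \<Longrightarrow> \<exists>W'\<in>\<B>. W' \<subseteq> W" "\<And>W. W \<in> \<B> \<Longrightarrow> \<exists>W'\<in>\<A>. W' \<subseteq> W"
  shows "sqfree_ideal \<A> = sqfree_ideal \<B>"
  by (intro subset_antisym sqfree_ideal_mono assms)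

text \<open>Multiplication by \<open>sqfree_monom W\<close> translates the exponents, which adds \<open>W\<close> to the support of every monomial, and
\<open>V \<subseteq> W \<union> A\<close> is the same as \<open>V - W \<subseteq> A\<close>.\<close>

lemma sqfree_ideal_colon:
  fixes p :: "('v::finite, 'k::field) mpoly"
  shows "sqfree_monom W * p \<in> sqfree_ideal \<A> \<longleftrightarrow> p \<in> sqfree_ideal ((\<lambda>V. V - W) ` \<A>)"
proof -
  have l: "Poly_Mapping.lookup (sqfree_monom W * p) (ind_exp W + m) = Poly_Mapping.lookup p m" for m
  proof -
    have "poly_filter (\<lambda>x. x = ind_exp W + m) (sqfree_monom W * p) = sqfree_monom W * poly_filter (\<lambda>x. x = m) p"
      by (rule poly_filter_mult) (auto simp: sqfree_monom_eq split: if_splits)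
    also have "poly_filter (\<lambda>x. x = m) p = Poly_Mapping.single m (Poly_Mapping.lookup p m)"
      by (rule poly_mapping_eqI) (simp add: lookup_single when_def)
    also have "sqfree_monom W * \<dots> = Poly_Mapping.single (ind_exp W + m) (Poly_Mapping.lookup p m)"
      by (simp add: sqfree_monom_eq mult_single)
    finally have "Poly_Mapping.lookup (poly_filter (\<lambda>x. x = ind_exp W + m) (sqfree_monom W * p)) (ind_exp W + m)
        = Poly_Mapping.lookup p m" by simp
    thus ?thesis by simp
  qed
  have "Poly_Mapping.keys (sqfree_monom W * p) \<subseteq> (+) (ind_exp W) ` Poly_Mapping.keys p"
    using keys_mult[of "sqfree_monom W" p] by (auto simp: sqfree_monom_eq split: if_splits)
  hence "Poly_Mapping.keys (sqfree_monom W * p) = (+) (ind_exp W) ` Poly_Mapping.keys p"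
    using l by (auto simp: in_keys_iff)
  thus ?thesis unfolding sqfree_ideal_def
    by (auto simp: keys_add_nat) (metis Diff_subset_conv)+
qed

lemma homogeneous_sqfree_monom: "homogeneous (int (card W)) (sqfree_monom W :: ('v::finite, 'k::field) mpoly)"
  by (auto simp: homogeneous_def sqfree_monom_eq mon_deg_def lookup_ind_exp)

text \<open>The irrelevant ideal is the squarefree monomial ideal whose generating sets are the singletons, and
the only monomial that contains no variable is \<open>1\<close>.\<close>

lemma irrelevant_ideal_iff:
  "p \<in> irrelevant_ideal \<longleftrightarrow> Poly_Mapping.lookup p 0 = 0" for p :: "('v::finite, 'k::field) mpoly"
proof -
  have "range (var :: 'v \<Rightarrow> ('v, 'k) mpoly) = sqfree_monom ` range (\<lambda>v. {v})"
    by (auto simp: sqfree_monom_def image_iff)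
  hence "irrelevant_ideal = (sqfree_ideal (range (\<lambda>v. {v})) :: ('v, 'k) mpoly set)"
    unfolding irrelevant_ideal_def by (simp add: sqfree_ideal_eq_span)
  also have "p \<in> \<dots> \<longleftrightarrow> (\<forall>m\<in>Poly_Mapping.keys p. Poly_Mapping.keys m \<noteq> {})"
  proof -
    have "(\<exists>W\<in>range (\<lambda>v. {v}). W \<subseteq> A) \<longleftrightarrow> A \<noteq> {}" for A :: "'v set"
      by auto
    thus ?thesis by (simp only: sqfree_ideal_def mem_Collect_eq)
  qed
  also have "\<dots> \<longleftrightarrow> 0 \<notin> Poly_Mapping.keys p"
  proof -
    have "Poly_Mapping.keys m \<noteq> {} \<longleftrightarrow> m \<noteq> 0" for m :: "'v \<Rightarrow>\<^sub>0 nat"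
      by (metis keys_zero lookup_zero not_in_keys_iff_lookup_eq_zero empty_iff poly_mapping_eqI)
    thus ?thesis by auto
  qed
  finally show ?thesis by (simp add: in_keys_iff)
qed

lemma irr_add: "p \<in> irrelevant_ideal \<Longrightarrow> q \<in> irrelevant_ideal \<Longrightarrow> p + q \<in> irrelevant_ideal"
  and irr_mult: "p \<in> irrelevant_ideal \<Longrightarrow> p * q \<in> irrelevant_ideal"
  and irr_mult': "q \<in> irrelevant_ideal \<Longrightarrow> p * q \<in> irrelevant_ideal"
  and irr_zero [simp]: "0 \<in> irrelevant_ideal"
  and irr_uminus: "p \<in> irrelevant_ideal \<Longrightarrow> - p \<in> irrelevant_ideal"
  and irr_sum: "(\<And>x. x \<in> X \<Longrightarrow> f x \<in> irrelevant_ideal) \<Longrightarrow> sum f X \<in> irrelevant_ideal"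
  for p q :: "('v, 'k::field) mpoly"
  unfolding irrelevant_ideal_def
  using ideal.span_scale[of p "range var" q] ideal.span_scale[of q "range var" p]
  by (auto intro: ideal.span_add ideal.span_zero ideal.span_neg ideal.span_sum simp: mult.commute)

lemma homogeneous_nonzero_degree_irr:
  "homogeneous d p \<Longrightarrow> d \<noteq> 0 \<Longrightarrow> p \<in> irrelevant_ideal" for p :: "('v::finite, 'k::field) mpoly"
  unfolding irrelevant_ideal_iff
  by (rule ccontr) (auto simp: homogeneous_def in_keys_iff mon_deg_def dest!: bspec[of _ _ 0])

text \<open>A homogeneous polynomial with a constant term has degree \<open>0\<close>, so it is a nonzero constant and
hence a unit.\<close>

lemma homogeneous_not_irr:
  fixes p :: "('v::finite, 'k::field) mpoly"
  assumes "homogeneous d p" "p \<notin> irrelevant_ideal"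
  obtains q where "q * p = 1" "homogeneous 0 q" "d = 0"
proof -
  define c where "c = Poly_Mapping.lookup p 0"
  have d: "d = 0" using assms homogeneous_nonzero_degree_irr by blast
  have c: "c \<noteq> 0" using assms(2) by (simp add: irrelevant_ideal_iff c_def)
  have "m = 0" if "m \<in> Poly_Mapping.keys p" for m
  proof (rule poly_mapping_eqI)
    fix v
    have "mon_deg m = 0" using assms(1) that d by (simp add: homogeneous_def)
    thus "Poly_Mapping.lookup m v = Poly_Mapping.lookup 0 v" by (simp add: mon_deg_UNIV)
  qed
  hence "p = Poly_Mapping.single 0 c"
    by (intro poly_mapping_eqI) (auto simp: c_def lookup_single when_def in_keys_iff)
  hence "Poly_Mapping.single 0 (inverse c) * p = 1" using c by (simp add: mult_single)
  moreover have "homogeneous 0 (Poly_Mapping.single (0 :: 'v \<Rightarrow>\<^sub>0 nat) (inverse c))"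
    using c by (simp add: homogeneous_def mon_deg_def)
  ultimately show thesis using that d by blast
qed

section \<open>Graded matrices\<close>

text \<open>\<open>graded_mat R C A\<close> says that \<open>A\<close> is a homogeneous map of degree \<open>0\<close> between the free modules whose
basis elements have the degrees \<open>C\<close> (source) and \<open>R\<close> (target).\<close>

definition graded_mat :: "int list \<Rightarrow> int list \<Rightarrow> ('v, 'k::field) mpoly mat \<Rightarrow> bool" where
  "graded_mat R C A \<longleftrightarrow> A \<in> carrier_mat (length R) (length C) \<and>
     (\<forall>a<length R. \<forall>b<length C. homogeneous (C ! b - R ! a) (A $$ (a, b)))"

definition mat_image :: "('v, 'k::field) mpoly mat \<Rightarrow> ('v, 'k) mpoly vec set" where
  "mat_image A = (\<lambda>w. A *\<^sub>v w) ` carrier_vec (dim_col A)"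

definition irr_mat :: "('v, 'k::field) mpoly mat \<Rightarrow> bool" where
  "irr_mat A \<longleftrightarrow> (\<forall>a<dim_row A. \<forall>b<dim_col A. A $$ (a, b) \<in> irrelevant_ideal)"

lemma graded_matD: "graded_mat R C A \<Longrightarrow> A \<in> carrier_mat (length R) (length C)"
  by (simp add: graded_mat_def)

lemma graded_mat_entry:
  "graded_mat R C A \<Longrightarrow> a < length R \<Longrightarrow> b < length C \<Longrightarrow> homogeneous (C ! b - R ! a) (A $$ (a, b))"
  by (simp add: graded_mat_def)

lemma graded_mat_mult:
  fixes A :: "('v::finite, 'k::field) mpoly mat"
  assumes "graded_mat R M A" "graded_mat M C B"
  shows "graded_mat R C (A * B)"
proof -
  have "homogeneous (C ! b - R ! a) ((A * B) $$ (a, b))" if "a < length R" "b < length C" for a b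
  proof -
    have "homogeneous (C ! b - R ! a) (A $$ (a, k) * B $$ (k, b))" if "k < length M" for k
      using homogeneous_mult[OF graded_mat_entry[OF assms(1) \<open>a < _\<close> that]
          graded_mat_entry[OF assms(2) that \<open>b < _\<close>]] by simp
    thus ?thesis using that graded_matD[OF assms(1)] graded_matD[OF assms(2)]
      by (auto simp: scalar_prod_def intro!: homogeneous_sum)
  qed
  thus ?thesis using graded_matD[OF assms(1)] graded_matD[OF assms(2)] by (simp add: graded_mat_def)
qed

lemma graded_mat_uminus: "graded_mat R C A \<Longrightarrow> graded_mat R C (- A)"
  by (auto simp: graded_mat_def homogeneous_uminus)

lemma graded_mat_diff:
  "graded_mat R C A \<Longrightarrow> graded_mat R C B \<Longrightarrow> graded_mat R C (A - B)"
  unfolding graded_mat_def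
  by (auto simp: diff_conv_add_uminus simp del: add_uminus_conv_diff
      intro!: homogeneous_add homogeneous_uminus)

lemma graded_mat_one [simp]: "graded_mat R R (1\<^sub>m (length R))"
  by (auto simp: graded_mat_def)

lemma graded_mat_zero: "length R = r \<Longrightarrow> length C = c \<Longrightarrow> graded_mat R C (0\<^sub>m r c)"
  by (auto simp: graded_mat_def)

lemma graded_mat_shift:
  "graded_mat (map ((+) d) R) (map ((+) d) C) A \<longleftrightarrow> graded_mat R C A"
  by (simp add: graded_mat_def)

lemma graded_mat_four_block:
  assumes "graded_mat R1 C1 A" "graded_mat R1 C2 B" "graded_mat R2 C1 C" "graded_mat R2 C2 D"
  shows "graded_mat (R1 @ R2) (C1 @ C2) (four_block_mat A B C D)"
  using assms unfolding graded_mat_def by (auto simp: nth_append)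

lemma mat_image_iff: "A \<in> carrier_mat r c \<Longrightarrow> v \<in> mat_image A \<longleftrightarrow> (\<exists>w\<in>carrier_vec c. v = A *\<^sub>v w)"
  by (auto simp: mat_image_def)

lemma mat_image_carrier: "A \<in> carrier_mat r c \<Longrightarrow> mat_image A \<subseteq> carrier_vec r"
  by (auto simp: mat_image_def)

lemma mat_kernel_iff: "A \<in> carrier_mat r c \<Longrightarrow> v \<in> mat_kernel A \<longleftrightarrow> v \<in> carrier_vec c \<and> A *\<^sub>v v = 0\<^sub>v r"
  by (auto simp: mat_kernel_def)

lemma mult_mat_unit_vec:
  "A \<in> carrier_mat r c \<Longrightarrow> j < c \<Longrightarrow> A *\<^sub>v unit_vec c j = col A j" for A :: "'a::comm_ring_1 mat"
  by (rule eq_vecI) (auto simp: scalar_prod_right_unit)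

lemma mult_mat_vec_zero: "A \<in> carrier_mat r c \<Longrightarrow> A *\<^sub>v 0\<^sub>v c = 0\<^sub>v r" for A :: "'a::comm_ring_1 mat"
  by (rule eq_vecI) auto

lemma zero_mat_mult_vec: "v \<in> carrier_vec c \<Longrightarrow> 0\<^sub>m r c *\<^sub>v v = 0\<^sub>v r" for v :: "'a::comm_ring_1 vec"
  by (rule eq_vecI) auto

lemma mult_mat_vec_uminus:
  "A \<in> carrier_mat r c \<Longrightarrow> v \<in> carrier_vec c \<Longrightarrow> A *\<^sub>v (- v) = - (A *\<^sub>v v)"
  for A :: "'a::comm_ring_1 mat"
  by (rule eq_vecI) (auto simp: scalar_prod_uminus_right)

lemma mult_mat_vec_smult:
  "A \<in> carrier_mat r c \<Longrightarrow> v \<in> carrier_vec c \<Longrightarrow> A *\<^sub>v (s \<cdot>\<^sub>v v) = s \<cdot>\<^sub>v (A *\<^sub>v v)"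
  for A :: "'a::comm_ring_1 mat"
  by (rule eq_vecI) auto

lemma mat_eq_iff_vec:
  fixes A B :: "'a::comm_ring_1 mat"
  assumes "A \<in> carrier_mat r c" "B \<in> carrier_mat r c" "\<And>v. v \<in> carrier_vec c \<Longrightarrow> A *\<^sub>v v = B *\<^sub>v v"
  shows "A = B"
proof (rule mat_col_eqI)
  fix i assume i: "i < dim_col B"
  have "col A i = A *\<^sub>v unit_vec c i" "col B i = B *\<^sub>v unit_vec c i"
    using mult_mat_unit_vec[OF assms(1)] mult_mat_unit_vec[OF assms(2)] i assms by auto
  thus "col A i = col B i" using assms(3)[of "unit_vec c i"] by simp
qed (use assms in auto)

text \<open>A graded matrix commutes with taking the component of degree \<open>c\<close>, where the component of a vector
takes the degrees of the basis elements into account.\<close>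

lemma graded_lift_vec:
  fixes A :: "('v::finite, 'k::field) mpoly mat"
  assumes A: "graded_mat R C A" and w: "w \<in> carrier_vec (length C)"
  shows "A *\<^sub>v vec (length C) (\<lambda>b. hcomp (c - C ! b) (w $ b))
       = vec (length R) (\<lambda>a. hcomp (c - R ! a) ((A *\<^sub>v w) $ a))"
proof (rule eq_vecI)
  fix a assume "a < dim_vec (vec (length R) (\<lambda>a. hcomp (c - R ! a) ((A *\<^sub>v w) $ a)))"
  hence a: "a < length R" by simp
  have "A $$ (a, b) * hcomp (c - C ! b) (w $ b) = hcomp (c - R ! a) (A $$ (a, b) * w $ b)"
    if "b < length C" for b
    using hcomp_mult[OF graded_mat_entry[OF A a that], of "c - R ! a" "w $ b"] by simp
  thus "(A *\<^sub>v vec (length C) (\<lambda>b. hcomp (c - C ! b) (w $ b))) $ a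
       = vec (length R) (\<lambda>a. hcomp (c - R ! a) ((A *\<^sub>v w) $ a)) $ a"
    using a w graded_matD[OF A] by (simp add: scalar_prod_def poly_filter_sum)
qed (use graded_matD[OF A] in simp)

text \<open>Free modules are projective, also in the graded sense: preimages of the columns of \<open>Y\<close> can be replaced
by their homogeneous components of the degrees of those columns.\<close>

lemma graded_lift:
  fixes A :: "('v::finite, 'k::field) mpoly mat"
  assumes A: "graded_mat R C A" and Y: "graded_mat R X Y"
    and im: "\<And>v. v \<in> carrier_vec (length X) \<Longrightarrow> Y *\<^sub>v v \<in> mat_image A"
  obtains W where "graded_mat C X W" "A * W = Y"
proof -
  note cA = graded_matD[OF A] and cY = graded_matD[OF Y]
  have "\<exists>w. w \<in> carrier_vec (length C) \<and> A *\<^sub>v w = col Y j" if "j < length X" for j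
    using im[of "unit_vec (length X) j"] mult_mat_unit_vec[OF cY that] cA by (auto simp: mat_image_def)
  then obtain w where w: "\<And>j. j < length X \<Longrightarrow> w j \<in> carrier_vec (length C) \<and> A *\<^sub>v w j = col Y j"
    by metis
  define W where "W = mat (length C) (length X) (\<lambda>(b, j). hcomp (X ! j - C ! b) (w j $ b))"
  have cW: "W \<in> carrier_mat (length C) (length X)" by (simp add: W_def)
  have "graded_mat C X W" by (auto simp: graded_mat_def W_def)
  moreover have "A * W = Y"
  proof (rule mat_col_eqI)
    fix j assume "j < dim_col Y"
    hence j: "j < length X" using cY by simp
    have "col (A * W) j = A *\<^sub>v col W j" by (rule col_mult2[OF cA cW j])
    also have "col W j = vec (length C) (\<lambda>b. hcomp (X ! j - C ! b) (w j $ b))"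
      using j by (auto simp: W_def)
    also have "A *\<^sub>v \<dots> = vec (length R) (\<lambda>a. hcomp (X ! j - R ! a) ((A *\<^sub>v w j) $ a))"
      using graded_lift_vec[OF A] w[OF j] by simp
    also have "\<dots> = col Y j"
    proof (rule eq_vecI)
      fix a assume "a < dim_vec (col Y j)"
      hence a: "a < length R" using cY by simp
      hence "(A *\<^sub>v w j) $ a = Y $$ (a, j)" using w[OF j] cY j by simp
      thus "vec (length R) (\<lambda>a. hcomp (X ! j - R ! a) ((A *\<^sub>v w j) $ a)) $ a = col Y j $ a"
        using hcomp_homogeneous[OF graded_mat_entry[OF Y a j]] a j cY by simp
    qed (use cY in simp)
    finally show "col (A * W) j = col Y j" .
  qed (use cA cW cY in auto)
  ultimately show thesis by (rule that)
qed

lemma irr_mat_mult_left: "irr_mat A \<Longrightarrow> dim_row B = dim_col A \<Longrightarrow> irr_mat (A * B)"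
  by (auto simp: irr_mat_def scalar_prod_def intro!: irr_sum irr_mult)

lemma irr_mat_mult_right: "irr_mat B \<Longrightarrow> dim_row B = dim_col A \<Longrightarrow> irr_mat (A * B)"
  by (auto simp: irr_mat_def scalar_prod_def intro!: irr_sum irr_mult')

lemma irr_mat_add: "irr_mat A \<Longrightarrow> irr_mat B \<Longrightarrow> dim_row A = dim_row B \<Longrightarrow> dim_col A = dim_col B \<Longrightarrow> irr_mat (A + B)"
  by (auto simp: irr_mat_def intro!: irr_add)

section \<open>Graded complexes and resolutions\<close>

text \<open>A sequence of matrices \<open>D i\<close> from \<open>F\<^bsub>i+1\<^esub>\<close> to \<open>F\<^sub>i\<close> is regarded as a complex over the quotient \<open>F\<^sub>0 / Z\<close>.
A cycle of \<open>F\<^sub>0\<close> is an element of \<open>Z\<close>, and a cycle of \<open>F\<^bsub>i+1\<^esub>\<close> is an element of the kernel of \<open>D i\<close>; with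
this convention exactness has the same form in all degrees. Leaving \<open>F\<^sub>0\<close> and \<open>Z\<close> arbitrary covers two
situations: \<open>F\<^sub>0 = S\<close> with \<open>Z\<close> an ideal, and a resolution whose augmentation \<open>F\<^sub>0 \<longrightarrow> S/I\<close> is any
surjection with kernel \<open>Z\<close>.\<close>

fun cycles :: "('v, 'k::field) mpoly vec set \<Rightarrow> (nat \<Rightarrow> ('v, 'k) mpoly mat) \<Rightarrow> nat \<Rightarrow> ('v, 'k) mpoly vec set" where
  "cycles Z D 0 = Z"
| "cycles Z D (Suc i) = mat_kernel (D i)"

definition graded_complex ::
    "('v, 'k::field) mpoly vec set \<Rightarrow> (nat \<Rightarrow> int list) \<Rightarrow> (nat \<Rightarrow> ('v, 'k) mpoly mat) \<Rightarrow> bool" where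
  "graded_complex Z L D \<longleftrightarrow> (\<forall>i. graded_mat (L i) (L (Suc i)) (D i) \<and> mat_image (D i) \<subseteq> cycles Z D i)"

definition graded_resolution ::
    "('v, 'k::field) mpoly vec set \<Rightarrow> (nat \<Rightarrow> int list) \<Rightarrow> (nat \<Rightarrow> ('v, 'k) mpoly mat) \<Rightarrow> bool" where
  "graded_resolution Z L D \<longleftrightarrow> (\<forall>i. graded_mat (L i) (L (Suc i)) (D i) \<and> mat_image (D i) = cycles Z D i)"

lemma graded_resolution_imp_graded_complex: "graded_resolution Z L D \<Longrightarrow> graded_complex Z L D"
  by (simp add: graded_resolution_def graded_complex_def)

lemma graded_complex_graded: "graded_complex Z L D \<Longrightarrow> graded_mat (L i) (L (Suc i)) (D i)"
  by (simp add: graded_complex_def)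

lemma graded_complex_comp:
  assumes "graded_complex Z L D"
  shows "D i * D (Suc i) = 0\<^sub>m (length (L i)) (length (L (Suc (Suc i))))"
proof (rule mat_eq_iff_vec)
  note c1 = graded_matD[OF graded_complex_graded[OF assms, of i]]
   and c2 = graded_matD[OF graded_complex_graded[OF assms, of "Suc i"]]
  show "D i * D (Suc i) \<in> carrier_mat (length (L i)) (length (L (Suc (Suc i))))"
    using c1 c2 by simp
  fix v :: "('a, 'b) mpoly vec" assume v: "v \<in> carrier_vec (length (L (Suc (Suc i))))"
  have "D (Suc i) *\<^sub>v v \<in> mat_kernel (D i)"
    using assms v c2 unfolding graded_complex_def mat_image_def by (metis (no_types, lifting) carrier_matD(2) cycles.simps(2) image_subset_iff)
  thus "D i * D (Suc i) *\<^sub>v v = 0\<^sub>m (length (L i)) (length (L (Suc (Suc i)))) *\<^sub>v v"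
    using c1 c2 v by (simp add: mat_kernel_iff[OF c1] zero_mat_mult_vec)
qed simp

lemma graded_complex_mat_image: "graded_complex Z L D \<Longrightarrow> v \<in> carrier_vec (length (L (Suc i))) \<Longrightarrow> D i *\<^sub>v v \<in> cycles Z D i"
  using graded_matD[OF graded_complex_graded[of Z L D i]] unfolding graded_complex_def mat_image_def
  by (metis (no_types, lifting) carrier_matD(2) image_subset_iff)

lemma graded_resolution_lift:
  fixes D :: "nat \<Rightarrow> ('v::finite, 'k::field) mpoly mat"
  assumes "graded_resolution Z L D" "graded_mat (L i) X Y"
    and "\<And>v. v \<in> carrier_vec (length X) \<Longrightarrow> Y *\<^sub>v v \<in> cycles Z D i"
  obtains W where "graded_mat (L (Suc i)) X W" "D i * W = Y"
  using graded_lift[of "L i" "L (Suc i)" "D i" X Y] assms unfolding graded_resolution_def by metis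

definition chain_map where
  "chain_map L D L' D' \<Phi> \<longleftrightarrow>
     (\<forall>i. graded_mat (L' i) (L i) (\<Phi> i) \<and> \<Phi> i * D i = D' i * \<Phi> (Suc i))"

text \<open>The comparison theorem: a map of the modules in degree \<open>0\<close> that respects the submodules \<open>Z\<close> extends to
a chain map, one degree at a time, because \<open>\<phi> \<circ> D i\<close> takes its values in cycles of the exact target.\<close>

lemma chain_map_exists:
  fixes D D' :: "nat \<Rightarrow> ('v::finite, 'k::field) mpoly mat"
  assumes F: "graded_complex Z L D" and G: "graded_resolution Z' L' D'"
    and \<Phi>0: "graded_mat (L' 0) (L 0) \<Phi>0" and Z: "\<forall>z\<in>Z. \<Phi>0 *\<^sub>v z \<in> Z'"
  obtains \<Phi> where "\<Phi> 0 = \<Phi>0" "chain_map L D L' D' \<Phi>"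
proof -
  define P where "P = (\<lambda>i \<phi>. graded_mat (L' i) (L i) \<phi> \<and> (\<forall>z\<in>cycles Z D i. \<phi> *\<^sub>v z \<in> cycles Z' D' i)
     \<and> (i = 0 \<longrightarrow> \<phi> = \<Phi>0))"
  have "\<exists>\<Phi>. \<forall>i. P i (\<Phi> i) \<and> \<Phi> i * D i = D' i * \<Phi> (Suc i)"
  proof (rule dependent_nat_choice)
    show "\<exists>\<phi>. P 0 \<phi>" using \<Phi>0 Z by (auto simp: P_def)
  next
    fix \<phi> i assume P: "P i \<phi>"
    have g: "graded_mat (L' i) (L i) \<phi>" using P by (simp add: P_def)
    note gD = graded_complex_graded[OF F, of i]
    note gD' = graded_complex_graded[OF graded_resolution_imp_graded_complex[OF G], of i]
    have "(\<phi> * D i) *\<^sub>v v \<in> cycles Z' D' i" if "v \<in> carrier_vec (length (L (Suc i)))" for v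
      using graded_complex_mat_image[OF F that] P that graded_matD[OF g] graded_matD[OF gD] by (simp add: P_def)
    then obtain \<psi> where \<psi>: "graded_mat (L' (Suc i)) (L (Suc i)) \<psi>" "D' i * \<psi> = \<phi> * D i"
      using graded_resolution_lift[OF G graded_mat_mult[OF g gD]] by metis
    have "\<psi> *\<^sub>v z \<in> cycles Z' D' (Suc i)" if "z \<in> cycles Z D (Suc i)" for z
    proof -
      have z: "z \<in> carrier_vec (length (L (Suc i)))" "D i *\<^sub>v z = 0\<^sub>v (length (L i))"
        using that by (auto simp: mat_kernel_iff[OF graded_matD[OF gD]])
      have "D' i *\<^sub>v (\<psi> *\<^sub>v z) = (D' i * \<psi>) *\<^sub>v z"
        using z graded_matD[OF gD'] graded_matD[OF \<psi>(1)] by simp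
      also have "\<dots> = \<phi> *\<^sub>v (D i *\<^sub>v z)"
        using z graded_matD[OF g] graded_matD[OF gD] by (simp add: \<psi>(2))
      also have "\<dots> = 0\<^sub>v (length (L' i))" using z graded_matD[OF g] by (simp add: mult_mat_vec_zero)
      finally show ?thesis using z graded_matD[OF \<psi>(1)] 
        by (simp add: mat_kernel_iff[OF graded_matD[OF gD']])
    qed
    hence "P (Suc i) \<psi>" using \<psi> by (simp add: P_def)
    thus "\<exists>\<psi>. P (Suc i) \<psi> \<and> \<phi> * D i = D' i * \<psi>" using \<psi>(2) by metis
  qed
  thus thesis using that unfolding P_def chain_map_def by metis
qed

lemma chain_map_comp:
  fixes D :: "nat \<Rightarrow> ('v::finite, 'k::field) mpoly mat"
  assumes D: "\<And>i. graded_mat (L i) (L (Suc i)) (D i)" and D': "\<And>i. graded_mat (L' i) (L' (Suc i)) (D' i)"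
    and D'': "\<And>i. graded_mat (L'' i) (L'' (Suc i)) (D'' i)"
    and \<Phi>: "chain_map L D L' D' \<Phi>" and \<Psi>: "chain_map L' D' L'' D'' \<Psi>"
  shows "chain_map L D L'' D'' (\<lambda>i. \<Psi> i * \<Phi> i)"
proof -
  have "\<Psi> i * \<Phi> i * D i = D'' i * (\<Psi> (Suc i) * \<Phi> (Suc i))" for i
  proof -
    note c = graded_matD[OF D[of i]] graded_matD[OF D'[of i]] graded_matD[OF D''[of i]]
    have g: "\<Phi> j \<in> carrier_mat (length (L' j)) (length (L j))"
         "\<Psi> j \<in> carrier_mat (length (L'' j)) (length (L' j))" for j
      using \<Phi> \<Psi> by (auto simp: chain_map_def intro: graded_matD)
    have "\<Psi> i * \<Phi> i * D i = \<Psi> i * (\<Phi> i * D i)" by (rule assoc_mult_mat[OF g(2) g(1) c(1)])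
    also have "\<dots> = \<Psi> i * (D' i * \<Phi> (Suc i))" using \<Phi> by (simp add: chain_map_def)
    also have "\<dots> = \<Psi> i * D' i * \<Phi> (Suc i)" by (rule assoc_mult_mat[OF g(2) c(2) g(1), symmetric])
    also have "\<dots> = D'' i * \<Psi> (Suc i) * \<Phi> (Suc i)" using \<Psi> by (simp add: chain_map_def)
    also have "\<dots> = D'' i * (\<Psi> (Suc i) * \<Phi> (Suc i))" by (rule assoc_mult_mat[OF c(3) g(2) g(1)])
    finally show ?thesis .
  qed
  thus ?thesis using \<Phi> \<Psi> by (auto simp: chain_map_def intro: graded_mat_mult)
qed

section \<open>Homotopies and degrees in minimal resolutions\<close>

text \<open>A chain map from an exact complex to itself that induces the identity on \<open>F\<^sub>0 / Z\<close> is homotopic to the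
identity. The next homotopy is found by lifting \<open>1 - \<Theta> - H \<circ> D\<close>, whose values are cycles because the
previous homotopy satisfies \<open>D \<circ> H \<circ> D = D - \<Theta> \<circ> D\<close>.\<close>

lemma homotopy_to_identity:
  fixes D :: "nat \<Rightarrow> ('v::finite, 'k::field) mpoly mat"
  assumes R: "graded_resolution Z L D" and T: "chain_map L D L D \<Theta>"
    and Z: "\<And>v. v \<in> carrier_vec (length (L 0)) \<Longrightarrow> (1\<^sub>m (length (L 0)) - \<Theta> 0) *\<^sub>v v \<in> Z"
  obtains H where "\<And>i. graded_mat (L (Suc i)) (L i) (H i)" "D 0 * H 0 = 1\<^sub>m (length (L 0)) - \<Theta> 0"
    "\<And>i. D (Suc i) * H (Suc i) = 1\<^sub>m (length (L (Suc i))) - \<Theta> (Suc i) - H i * D i"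
proof -
  define P where "P = (\<lambda>i h. graded_mat (L (Suc i)) (L i) h \<and> D i * (h * D i) = D i - \<Theta> i * D i
     \<and> (i = 0 \<longrightarrow> D 0 * h = 1\<^sub>m (length (L 0)) - \<Theta> 0))"
  have gD: "graded_mat (L i) (L (Suc i)) (D i)" for i using R by (simp add: graded_resolution_def)
  have gT: "graded_mat (L i) (L i) (\<Theta> i)" for i using T by (simp add: chain_map_def)
  have com: "\<Theta> i * D i = D i * \<Theta> (Suc i)" for i using T by (simp add: chain_map_def)
  note cD = graded_matD[OF gD] and cT = graded_matD[OF gT]
  have "\<exists>H. \<forall>i. P i (H i) \<and> D (Suc i) * H (Suc i) = 1\<^sub>m (length (L (Suc i))) - \<Theta> (Suc i) - H i * D i"
  proof (rule dependent_nat_choice)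
    obtain h where h: "graded_mat (L (Suc 0)) (L 0) h" "D 0 * h = 1\<^sub>m (length (L 0)) - \<Theta> 0"
      using graded_resolution_lift[OF R, of 0 "L 0" "1\<^sub>m (length (L 0)) - \<Theta> 0"] Z
        graded_mat_diff[OF graded_mat_one gT] by auto
    have "D 0 * (h * D 0) = (D 0 * h) * D 0"
      by (rule assoc_mult_mat[OF cD graded_matD[OF h(1)] cD, symmetric])
    also have "\<dots> = D 0 - \<Theta> 0 * D 0"
      unfolding h(2) using minus_mult_distrib_mat[OF one_carrier_mat cT cD[of 0]] cD[of 0] by simp
    finally show "\<exists>h. P 0 h" using h by (auto simp: P_def)
  next
    fix h i assume P: "P i h"
    let ?n = "length (L (Suc i))"
    have gh: "graded_mat (L (Suc i)) (L i) h" using P by (simp add: P_def)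
    have ghD: "graded_mat (L (Suc i)) (L (Suc i)) (h * D i)" by (rule graded_mat_mult[OF gh gD])
    define Y where "Y = 1\<^sub>m ?n - \<Theta> (Suc i) - h * D i"
    have gY: "graded_mat (L (Suc i)) (L (Suc i)) Y"
      unfolding Y_def by (intro graded_mat_diff graded_mat_one gT ghD)
    have c1: "1\<^sub>m ?n - \<Theta> (Suc i) \<in> carrier_mat ?n ?n" by (rule minus_carrier_mat[OF cT])
    have "D i * Y = D i * (1\<^sub>m ?n - \<Theta> (Suc i)) - D i * (h * D i)"
      unfolding Y_def by (rule mult_minus_distrib_mat[OF cD c1 graded_matD[OF ghD]])
    also have "D i * (1\<^sub>m ?n - \<Theta> (Suc i)) = D i - \<Theta> i * D i"
      using mult_minus_distrib_mat[OF cD[of i] one_carrier_mat cT[of "Suc i"]] cD[of i] com by simp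
    finally have DY: "D i * Y = 0\<^sub>m (length (L i)) ?n" using P cD[of i] cT[of i] by (auto simp: P_def)
    have "Y *\<^sub>v v \<in> cycles Z D (Suc i)" if v: "v \<in> carrier_vec ?n" for v
    proof -
      have "D i *\<^sub>v (Y *\<^sub>v v) = (D i * Y) *\<^sub>v v"
        by (rule assoc_mult_mat_vec[OF cD graded_matD[OF gY] v, symmetric])
      thus ?thesis using DY v graded_matD[OF gY] by (simp add: mat_kernel_iff[OF cD] zero_mat_mult_vec)
    qed
    then obtain h' where h': "graded_mat (L (Suc (Suc i))) (L (Suc i)) h'" "D (Suc i) * h' = Y"
      using graded_resolution_lift[OF R gY] by metis
    have "D (Suc i) * (h' * D (Suc i)) = Y * D (Suc i)"
      unfolding h'(2)[symmetric] by (rule assoc_mult_mat[OF cD graded_matD[OF h'(1)] cD, symmetric])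
    also have "\<dots> = (1\<^sub>m ?n - \<Theta> (Suc i)) * D (Suc i) - h * D i * D (Suc i)"
      unfolding Y_def by (rule minus_mult_distrib_mat[OF c1 graded_matD[OF ghD] cD])
    also have "h * D i * D (Suc i) = h * (D i * D (Suc i))"
      by (rule assoc_mult_mat[OF graded_matD[OF gh] cD cD])
    also have "\<dots> = 0\<^sub>m ?n (length (L (Suc (Suc i))))"
      using graded_complex_comp[OF graded_resolution_imp_graded_complex[OF R]] graded_matD[OF gh] by simp
    also have "(1\<^sub>m ?n - \<Theta> (Suc i)) * D (Suc i) - \<dots> = D (Suc i) - \<Theta> (Suc i) * D (Suc i)"
      using minus_mult_distrib_mat[OF one_carrier_mat cT cD[of "Suc i"]] cD[of "Suc i"] cT[of "Suc i"]
      by auto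
    finally have "P (Suc i) h'" using h' by (simp add: P_def)
    thus "\<exists>h'. P (Suc i) h' \<and> D (Suc i) * h' = 1\<^sub>m ?n - \<Theta> (Suc i) - h * D i"
      using h'(2) Y_def by metis
  qed
  thus thesis using that unfolding P_def by metis
qed

text \<open>In a minimal complex the homotopy terms have entries in the irrelevant ideal, so every diagonal entry of
\<open>\<Theta> i\<close> is \<open>1\<close> modulo this ideal. If \<open>\<Theta> i\<close> factors through a free module \<open>M\<close> without basis elements
of degree \<open>c\<close>, then a diagonal entry at a basis element of degree \<open>c\<close> is a sum of products of forms of
nonzero degree, which lies in the irrelevant ideal. Hence all degrees of a minimal complex occur in \<open>M\<close>.
All comparisons of the degrees in different resolutions below are instances of this lemma.\<close>

lemma shifts_subset:
  fixes D :: "nat \<Rightarrow> ('v::finite, 'k::field) mpoly mat"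
  assumes R: "graded_resolution Z L D" and min: "\<And>i. irr_mat (D i)" and T: "chain_map L D L D \<Theta>"
    and Z: "\<And>v. v \<in> carrier_vec (length (L 0)) \<Longrightarrow> (1\<^sub>m (length (L 0)) - \<Theta> 0) *\<^sub>v v \<in> Z"
    and fac: "\<Theta> i = B * A" and B: "graded_mat (L i) M B" and A: "graded_mat M (L i) A"
  shows "set (L i) \<subseteq> set M"
proof
  let ?n = "length (L i)"
  obtain H where H: "\<And>i. graded_mat (L (Suc i)) (L i) (H i)" "D 0 * H 0 = 1\<^sub>m (length (L 0)) - \<Theta> 0"
    "\<And>i. D (Suc i) * H (Suc i) = 1\<^sub>m (length (L (Suc i))) - \<Theta> (Suc i) - H i * D i"
    using homotopy_to_identity[OF R T Z] by blast
  have gD: "graded_mat (L i) (L (Suc i)) (D i)" for i using R by (simp add: graded_resolution_def)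
  have gT: "graded_mat (L i) (L i) (\<Theta> i)" for i using T by (simp add: chain_map_def)
  note cD = graded_matD[OF gD] and cT = graded_matD[OF gT] and cH = graded_matD[OF H(1)]
  have irr: "irr_mat (1\<^sub>m ?n - \<Theta> i)"
  proof (cases i)
    case 0
    thus ?thesis using irr_mat_mult_left[OF min, of "H 0" 0] H(2) cD[of 0] cH[of 0] by simp
  next
    case (Suc j)
    have "1\<^sub>m ?n - \<Theta> i = D i * H i + H j * D j"
      unfolding Suc H(3) using cT[of "Suc j"] cH[of j] cD[of j] by (intro eq_matI) auto
    moreover have "irr_mat (D i * H i)" by (rule irr_mat_mult_left[OF min]) (use cD[of i] cH[of i] in simp)
    moreover have "irr_mat (H j * D j)" by (rule irr_mat_mult_right[OF min]) (use cD[of j] cH[of j] in simp)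
    ultimately show ?thesis using cD[of i] cH[of i] cD[of j] cH[of j] Suc by (simp add: irr_mat_add)
  qed
  fix c assume "c \<in> set (L i)"
  then obtain b where b: "b < ?n" "L i ! b = c" by (auto simp: in_set_conv_nth)
  show "c \<in> set M"
  proof (rule ccontr)
    assume c: "c \<notin> set M"
    have "B $$ (b, k) * A $$ (k, b) \<in> irrelevant_ideal" if k: "k < length M" for k
    proof -
      have "M ! k \<noteq> c" using c k by auto
      thus ?thesis
        using homogeneous_nonzero_degree_irr[OF graded_mat_entry[OF B b(1) k]] b(2) irr_mult by simp
    qed
    hence "\<Theta> i $$ (b, b) \<in> irrelevant_ideal"
      unfolding fac using graded_matD[OF A] graded_matD[OF B] b
      by (auto simp: scalar_prod_def intro!: irr_sum)
    moreover have "1 - \<Theta> i $$ (b, b) \<in> irrelevant_ideal"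
      using irr[unfolded irr_mat_def, rule_format, of b b] cT[of i] b(1) by simp
    ultimately have "1 - \<Theta> i $$ (b, b) + \<Theta> i $$ (b, b) \<in> irrelevant_ideal" by (rule irr_add[rotated])
    thus False by (simp add: irrelevant_ideal_iff)
  qed
qed

section \<open>Mapping cones\<close>

text \<open>If a chain map from a resolution of \<open>N\<close> to a resolution of \<open>M\<close> induces an injective map \<open>N \<longrightarrow> M\<close>, its
mapping cone is a resolution of the cokernel. The modules \<open>M\<close> and \<open>N\<close> are the quotients by \<open>ZA\<close> and \<open>ZB\<close>,
and injectivity is the assumption \<open>inj\<close>.\<close>

locale mapping_cone =
  fixes ZA LA and DA :: "nat \<Rightarrow> ('v::finite, 'k::field) mpoly mat" and ZB LB DB \<phi>
  assumes A: "graded_resolution ZA LA DA" and B: "graded_resolution ZB LB DB"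
    and \<phi>: "chain_map LB DB LA DA \<phi>"
    and inj: "\<And>b. b \<in> carrier_vec (length (LB 0)) \<Longrightarrow> \<phi> 0 *\<^sub>v b \<in> ZA \<Longrightarrow> b \<in> ZB"
begin

text \<open>The summand of the cone that comes from the source is shifted by one position. In position \<open>0\<close> it
  is zero, which is represented by the empty list of degrees and by a matrix without rows; the
  formulas for the cone are then uniform.\<close>

fun QB :: "nat \<Rightarrow> int list" where
  "QB 0 = []"
| "QB (Suc i) = LB i"

fun NB :: "nat \<Rightarrow> ('v, 'k) mpoly mat" where
  "NB 0 = 0\<^sub>m 0 (length (LB 0))"
| "NB (Suc i) = - DB i"

definition LC where "LC i = LA i @ QB i"

definition DC where
  "DC i = four_block_mat (DA i) (\<phi> i) (0\<^sub>m (length (QB i)) (length (LA (Suc i)))) (NB i)"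

lemma gA: "graded_mat (LA i) (LA (Suc i)) (DA i)" and gB: "graded_mat (LB i) (LB (Suc i)) (DB i)"
  and gphi: "graded_mat (LA i) (LB i) (\<phi> i)" and com: "\<phi> i * DB i = DA i * \<phi> (Suc i)"
  using A B \<phi> by (auto simp: graded_resolution_def chain_map_def)

lemma gN: "graded_mat (QB i) (LB i) (NB i)"
  by (cases i) (auto intro: graded_mat_zero graded_mat_uminus gB)

lemmas cA = graded_matD[OF gA] and cB = graded_matD[OF gB] and cphi = graded_matD[OF gphi]
  and cN = graded_matD[OF gN]

lemma gC: "graded_mat (LC i) (LC (Suc i)) (DC i)"
  unfolding LC_def DC_def by (auto intro!: graded_mat_four_block gA gphi gN graded_mat_zero)

lemmas cC = graded_matD[OF gC]

lemma DC_mult: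
  assumes a: "a \<in> carrier_vec (length (LA (Suc i)))" and b: "b \<in> carrier_vec (length (LB i))"
  shows "DC i *\<^sub>v (a @\<^sub>v b) = (DA i *\<^sub>v a + \<phi> i *\<^sub>v b) @\<^sub>v (NB i *\<^sub>v b)"
proof -
  have "DC i *\<^sub>v (a @\<^sub>v b) = (DA i *\<^sub>v a + \<phi> i *\<^sub>v b) @\<^sub>v
      (0\<^sub>m (length (QB i)) (length (LA (Suc i))) *\<^sub>v a + NB i *\<^sub>v b)"
    unfolding DC_def by (rule four_block_mat_mult_vec[OF cA cphi zero_carrier_mat cN a b])
  also have "0\<^sub>m (length (QB i)) (length (LA (Suc i))) *\<^sub>v a + NB i *\<^sub>v b = NB i *\<^sub>v b"
    using a b cN[of i] by (simp add: zero_mat_mult_vec)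
  finally show ?thesis .
qed

lemma split_vec:
  assumes "v \<in> carrier_vec (length (LC (Suc i)))"
  obtains a b where "a \<in> carrier_vec (length (LA (Suc i)))" "b \<in> carrier_vec (length (LB i))" "v = a @\<^sub>v b"
  using assms vec_first_last_append[of v "length (LA (Suc i))" "length (LB i)"] that
  by (metis LC_def QB.simps(2) length_append vec_first_carrier vec_last_carrier)

lemma cone_mat_image_0: "mat_image (DC 0) = {x + \<phi> 0 *\<^sub>v b | x b. x \<in> ZA \<and> b \<in> carrier_vec (length (LB 0))}"
proof -
  have Z: "ZA = mat_image (DA 0)" using A by (metis cycles.simps(1) graded_resolution_def)
  have e: "DC 0 *\<^sub>v (a @\<^sub>v b) = DA 0 *\<^sub>v a + \<phi> 0 *\<^sub>v b"
    if "a \<in> carrier_vec (length (LA (Suc 0)))" "b \<in> carrier_vec (length (LB 0))" for a b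
    unfolding DC_mult[OF that] using cA[of 0] cphi[of 0] that by (intro eq_vecI) auto
  show ?thesis
  proof (intro equalityI subsetI)
    fix v assume "v \<in> mat_image (DC 0)"
    then obtain w where w: "w \<in> carrier_vec (length (LC (Suc 0)))" "v = DC 0 *\<^sub>v w"
      using mat_image_iff[OF cC] by blast
    show "v \<in> {x + \<phi> 0 *\<^sub>v b | x b. x \<in> ZA \<and> b \<in> carrier_vec (length (LB 0))}"
      using split_vec[OF w(1)] e w(2) mat_image_iff[OF cA[of 0]] unfolding Z by (smt (verit) mem_Collect_eq)
  next
    fix v assume "v \<in> {x + \<phi> 0 *\<^sub>v b | x b. x \<in> ZA \<and> b \<in> carrier_vec (length (LB 0))}"
    then obtain x b where x: "x \<in> mat_image (DA 0)" and b: "b \<in> carrier_vec (length (LB 0))" "v = x + \<phi> 0 *\<^sub>v b"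
      unfolding Z by blast
    obtain a where "a \<in> carrier_vec (length (LA (Suc 0)))" "x = DA 0 *\<^sub>v a"
      using x mat_image_iff[OF cA[of 0]] by auto
    with b have ab: "a \<in> carrier_vec (length (LA (Suc 0)))" "b \<in> carrier_vec (length (LB 0))"
      "v = DA 0 *\<^sub>v a + \<phi> 0 *\<^sub>v b" by auto
    have "a @\<^sub>v b \<in> carrier_vec (length (LC (Suc 0)))" using ab by (simp add: LC_def)
    thus "v \<in> mat_image (DC 0)" using e[OF ab(1,2)] ab(3) mat_image_iff[OF cC] by metis
  qed
qed

text \<open>If \<open>(a, b)\<close> is in the kernel, then \<open>b\<close> is a cycle of the source, in position \<open>0\<close> because of injectivity. Writing
\<open>b = DB i b'\<close> makes \<open>a + \<phi> (i + 1) b'\<close> a cycle and hence a boundary of the target.\<close>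

lemma cone_exact: "mat_image (DC (Suc i)) = mat_kernel (DC i)"
proof (intro equalityI subsetI)
  fix v assume "v \<in> mat_image (DC (Suc i))"
  then obtain w where w: "w \<in> carrier_vec (length (LC (Suc (Suc i))))" "v = DC (Suc i) *\<^sub>v w"
    using mat_image_iff[OF cC] by blast
  obtain a b where ab: "a \<in> carrier_vec (length (LA (Suc (Suc i))))" "b \<in> carrier_vec (length (LB (Suc i)))"
    and "w = a @\<^sub>v b" using split_vec[OF w(1)] .
  define a' where "a' = DA (Suc i) *\<^sub>v a + \<phi> (Suc i) *\<^sub>v b"
  define b' where "b' = - (DB i *\<^sub>v b)"
  have c': "a' \<in> carrier_vec (length (LA (Suc i)))" "b' \<in> carrier_vec (length (LB i))"
    using ab cA[of "Suc i"] cphi[of "Suc i"] cB[of i] by (auto simp: a'_def b'_def)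
  have v: "v = a' @\<^sub>v b'"
    unfolding w(2) \<open>w = _\<close> DC_mult[OF ab] a'_def b'_def using cB[of i] ab by simp
  have DD: "DA i *\<^sub>v (DA (Suc i) *\<^sub>v a) = 0\<^sub>v (length (LA i))"
    using graded_complex_mat_image[OF graded_resolution_imp_graded_complex[OF A] ab(1)] by (simp add: mat_kernel_iff[OF cA])
  have "DA i *\<^sub>v a' = DA i *\<^sub>v (DA (Suc i) *\<^sub>v a) + DA i *\<^sub>v (\<phi> (Suc i) *\<^sub>v b)"
    unfolding a'_def by (rule mult_add_distrib_mat_vec[OF cA]) (use ab cA[of "Suc i"] cphi[of "Suc i"] in auto)
  also have "DA i *\<^sub>v (\<phi> (Suc i) *\<^sub>v b) = (\<phi> i * DB i) *\<^sub>v b"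
    unfolding com by (rule assoc_mult_mat_vec[OF cA cphi ab(2), symmetric])
  also have "\<dots> = \<phi> i *\<^sub>v (DB i *\<^sub>v b)" by (rule assoc_mult_mat_vec[OF cphi cB ab(2)])
  also have "DA i *\<^sub>v (DA (Suc i) *\<^sub>v a) + \<dots> = \<phi> i *\<^sub>v (DB i *\<^sub>v b)"
    unfolding DD using cphi[of i] cB[of i] ab by simp
  finally have "DA i *\<^sub>v a' + \<phi> i *\<^sub>v b' = \<phi> i *\<^sub>v (DB i *\<^sub>v b) + \<phi> i *\<^sub>v (- (DB i *\<^sub>v b))"
    by (simp add: b'_def)
  also have "\<dots> = 0\<^sub>v (length (LA i))"
  proof -
    have c: "DB i *\<^sub>v b \<in> carrier_vec (length (LB i))" using cB[of i] ab by simp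
    have "\<phi> i *\<^sub>v (DB i *\<^sub>v b) + \<phi> i *\<^sub>v (- (DB i *\<^sub>v b)) = \<phi> i *\<^sub>v (DB i *\<^sub>v b + - (DB i *\<^sub>v b))"
      by (rule mult_add_distrib_mat_vec[OF cphi c, symmetric]) (use c in simp)
    also have "DB i *\<^sub>v b + - (DB i *\<^sub>v b) = 0\<^sub>v (length (LB i))" using c by (rule uminus_r_inv_vec)
    finally show ?thesis using mult_mat_vec_zero[OF cphi[of i]] by simp
  qed
  finally have 1: "DA i *\<^sub>v a' + \<phi> i *\<^sub>v b' = 0\<^sub>v (length (LA i))" .
  have 2: "NB i *\<^sub>v b' = 0\<^sub>v (length (QB i))"
  proof (cases i)
    case 0 thus ?thesis by auto
  next
    case (Suc j)
    have "DB j *\<^sub>v (DB i *\<^sub>v b) = 0\<^sub>v (length (LB j))"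
      using graded_complex_mat_image[OF graded_resolution_imp_graded_complex[OF B] ab(2)] Suc by (simp add: mat_kernel_iff[OF cB])
    moreover have w: "DB i *\<^sub>v b \<in> carrier_vec (length (LB (Suc j)))" using cB[of i] ab Suc by simp
    moreover have "- DB j *\<^sub>v (- (DB i *\<^sub>v b)) = - (DB j *\<^sub>v (- (DB i *\<^sub>v b)))"
      by (rule uminus_mult_mat_vec) (use w cB[of i] Suc cB[of j] in simp)
    ultimately show ?thesis unfolding b'_def using Suc mult_mat_vec_uminus[OF cB[of j] w] by simp
  qed
  show "v \<in> mat_kernel (DC i)"
    unfolding mat_kernel_iff[OF cC] v DC_mult[OF c'] 1 2 using c' by (auto simp: LC_def)
next
  fix v assume "v \<in> mat_kernel (DC i)"
  hence v: "v \<in> carrier_vec (length (LC (Suc i)))" "DC i *\<^sub>v v = 0\<^sub>v (length (LC i))"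
    by (auto simp: mat_kernel_iff[OF cC])
  obtain a b where ab: "a \<in> carrier_vec (length (LA (Suc i)))" "b \<in> carrier_vec (length (LB i))"
    and vab: "v = a @\<^sub>v b" using split_vec[OF v(1)] .
  have z: "0\<^sub>v (length (LC i)) = 0\<^sub>v (length (LA i)) @\<^sub>v 0\<^sub>v (length (QB i))"
    by (auto simp: LC_def)
  have "DA i *\<^sub>v a + \<phi> i *\<^sub>v b = 0\<^sub>v (length (LA i)) \<and> NB i *\<^sub>v b = 0\<^sub>v (length (QB i))"
    using v(2) unfolding vab DC_mult[OF ab] z
    by (subst (asm) append_vec_eq[where n = "length (LA i)"]) (use ab cA[of i] cphi[of i] in auto)
  hence 1: "DA i *\<^sub>v a + \<phi> i *\<^sub>v b = 0\<^sub>v (length (LA i))" and 2: "NB i *\<^sub>v b = 0\<^sub>v (length (QB i))"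
    by auto
  have "b \<in> cycles ZB DB i"
  proof (cases i)
    case 0
    have "\<phi> 0 *\<^sub>v b = DA 0 *\<^sub>v (- a)"
    proof (rule eq_vecI)
      fix k assume k: "k < dim_vec (DA 0 *\<^sub>v - a)"
      have "(DA 0 *\<^sub>v a + \<phi> 0 *\<^sub>v b) $ k = 0" using 1 0 k cA[of 0] by simp
      hence "(DA 0 *\<^sub>v a) $ k + (\<phi> 0 *\<^sub>v b) $ k = 0" using k cA[of 0] cphi[of 0] by simp
      moreover have "(DA 0 *\<^sub>v - a) $ k = - (DA 0 *\<^sub>v a) $ k"
        using k cA[of 0] ab 0 by (simp add: scalar_prod_uminus_right)
      ultimately show "(\<phi> 0 *\<^sub>v b) $ k = (DA 0 *\<^sub>v - a) $ k" by (simp add: add_eq_0_iff)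
    qed (use cA[of 0] cphi[of 0] in auto)
    hence "\<phi> 0 *\<^sub>v b \<in> mat_image (DA 0)" using ab 0 mat_image_iff[OF cA[of 0]] by auto
    thus ?thesis using A inj ab 0 by (metis cycles.simps(1) graded_resolution_def)
  next
    case (Suc j)
    hence "- (DB j *\<^sub>v b) = 0\<^sub>v (length (LB j))" using 2 ab cB[of j] by simp
    hence "DB j *\<^sub>v b = 0\<^sub>v (length (LB j))" using uminus_zero_vec_eq[of "DB j *\<^sub>v b" "length (LB j)"] cB[of j] ab Suc by auto
    thus ?thesis using ab Suc by (simp add: mat_kernel_iff[OF cB])
  qed
  then obtain b' where b': "b' \<in> carrier_vec (length (LB (Suc i)))" "b = DB i *\<^sub>v b'"
    using B mat_image_iff[OF cB[of i]] unfolding graded_resolution_def by blast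
  have "DA i *\<^sub>v (a + \<phi> (Suc i) *\<^sub>v b') = DA i *\<^sub>v a + DA i *\<^sub>v (\<phi> (Suc i) *\<^sub>v b')"
    by (rule mult_add_distrib_mat_vec[OF cA]) (use ab b' cphi[of "Suc i"] in auto)
  also have "DA i *\<^sub>v (\<phi> (Suc i) *\<^sub>v b') = (\<phi> i * DB i) *\<^sub>v b'"
    unfolding com by (rule assoc_mult_mat_vec[OF cA cphi b'(1), symmetric])
  also have "\<dots> = \<phi> i *\<^sub>v b" unfolding b'(2) by (rule assoc_mult_mat_vec[OF cphi cB b'(1)])
  finally have "a + \<phi> (Suc i) *\<^sub>v b' \<in> mat_kernel (DA i)"
    using 1 ab b' cphi[of "Suc i"] by (simp add: mat_kernel_iff[OF cA])
  then obtain a' where a': "a' \<in> carrier_vec (length (LA (Suc (Suc i))))"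
     "a + \<phi> (Suc i) *\<^sub>v b' = DA (Suc i) *\<^sub>v a'"
    using A mat_image_iff[OF cA[of "Suc i"]] unfolding graded_resolution_def by (metis cycles.simps(2))
  have "DC (Suc i) *\<^sub>v (a' @\<^sub>v (- b')) = (DA (Suc i) *\<^sub>v a' + \<phi> (Suc i) *\<^sub>v (- b')) @\<^sub>v (NB (Suc i) *\<^sub>v (- b'))"
    by (rule DC_mult) (use a' b' in auto)
  also have "\<dots> = v" unfolding vab a'(2)[symmetric]
  proof (rule arg_cong2[where f = append_vec])
    show "a + \<phi> (Suc i) *\<^sub>v b' + \<phi> (Suc i) *\<^sub>v - b' = a"
      by (rule eq_vecI) (use ab b' cphi[of "Suc i"] in \<open>auto simp: scalar_prod_uminus_right\<close>)
    show "NB (Suc i) *\<^sub>v - b' = b"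
      unfolding b'(2) by (rule eq_vecI) (use b' cB[of i] in \<open>auto simp: scalar_prod_uminus_right\<close>)
  qed
  finally have "v = DC (Suc i) *\<^sub>v (a' @\<^sub>v (- b'))" by simp
  moreover have "a' @\<^sub>v (- b') \<in> carrier_vec (length (LC (Suc (Suc i))))" using a' b' by (simp add: LC_def)
  ultimately show "v \<in> mat_image (DC (Suc i))" using mat_image_iff[OF cC] by metis
qed

theorem cone_graded_resolution: "graded_resolution {x + \<phi> 0 *\<^sub>v b | x b. x \<in> ZA \<and> b \<in> carrier_vec (length (LB 0))} LC DC"
  unfolding graded_resolution_def
proof (intro allI conjI)
  fix i show "mat_image (DC i) = cycles {x + \<phi> 0 *\<^sub>v b | x b. x \<in> ZA \<and> b \<in> carrier_vec (length (LB 0))} DC i"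
    by (cases i) (simp_all add: cone_mat_image_0 cone_exact)
qed (rule gC)

lemma cone_irr:
  assumes "\<And>i. irr_mat (DA i)" "\<And>i. irr_mat (DB i)" "\<And>i. irr_mat (\<phi> i)"
  shows "irr_mat (DC i)"
proof -
  have "irr_mat (NB i)" by (cases i) (use assms(2) in \<open>auto simp: irr_mat_def intro: irr_uminus\<close>)
  thus ?thesis using assms(1)[of i] assms(3)[of i] cA[of i] cphi[of i] cN[of i]
    unfolding irr_mat_def DC_def by auto
qed

end

section \<open>Existence of minimal resolutions\<close>

lemma sum_skip:
  fixes f :: "nat \<Rightarrow> 'a::comm_monoid_add"
  assumes "b < n"
  shows "(\<Sum>k\<in>{0..<n}. f k) = f b + (\<Sum>k\<in>{0..<n - 1}. f (if k < b then k else Suc k))"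
proof -
  have "bij_betw (\<lambda>k. if k < b then k else Suc k) {0..<n - 1} ({0..<n} - {b})"
    by (rule bij_betw_byWitness[where f' = "\<lambda>k. if k < b then k else k - 1"]) (use assms in \<open>auto split: if_splits\<close>)
  hence "(\<Sum>k\<in>{0..<n} - {b}. f k) = (\<Sum>k\<in>{0..<n - 1}. f (if k < b then k else Suc k))"
    by (rule sum.reindex_bij_betw[symmetric])
  thus ?thesis using assms by (subst sum.remove[of _ b]) auto
qed

text \<open>In a homogeneous generating system with the least number of elements no relation has a unit coefficient,
since a generator that occurs with a unit coefficient is a combination of the others. For homogeneous
relations this says that all coefficients are in the irrelevant ideal.\<close>

lemma minimal_generators_syzygies:
  fixes A :: "('v::finite, 'k::field) mpoly mat"
  assumes A: "graded_mat R C A" and S: "graded_mat C X S" and ker: "mat_image S \<subseteq> mat_kernel A"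
    and least: "\<And>C' A'. graded_mat R C' A' \<Longrightarrow> mat_image A' = mat_image A \<Longrightarrow> length C \<le> length C'"
  shows "irr_mat S"
proof (rule ccontr)
  note cA = graded_matD[OF A] and cS = graded_matD[OF S]
  assume "\<not> irr_mat S"
  then obtain b j where bj: "b < length C" "j < length X" "S $$ (b, j) \<notin> irrelevant_ideal"
    using cS by (auto simp: irr_mat_def)
  obtain q where q: "q * S $$ (b, j) = 1"
    using homogeneous_not_irr[OF graded_mat_entry[OF S bj(1,2)] bj(3)] by blast
  define r where "r = S *\<^sub>v unit_vec (length X) j"
  have "r \<in> mat_kernel A" using ker cS unfolding r_def mat_image_def by auto
  hence r: "r \<in> carrier_vec (length C)" "A *\<^sub>v r = 0\<^sub>v (length R)" by (auto simp: mat_kernel_iff[OF cA])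
  have rb: "q * r $ b = 1" unfolding r_def mult_mat_unit_vec[OF cS bj(2)] using bj cS q by simp
  \<comment> \<open>\<open>\<sigma>\<close> enumerates the indices other than \<open>b\<close>, so \<open>A'\<close> is \<open>A\<close> without the column \<open>b\<close>\<close>
  define \<sigma> where "\<sigma> = (\<lambda>k. if k < b then k else Suc k)"
  define C' where "C' = map (\<lambda>k. C ! \<sigma> k) [0..<length C - 1]"
  define A' where "A' = mat (length R) (length C - 1) (\<lambda>(a, k). A $$ (a, \<sigma> k))"
  have \<sigma>: "\<sigma> k < length C" if "k < length C - 1" for k using that bj(1) by (auto simp: \<sigma>_def)
  have lC': "length C' = length C - 1" by (simp add: C'_def)
  have gA': "graded_mat R C' A'"
    unfolding graded_mat_def using graded_mat_entry[OF A] \<sigma> by (auto simp: C'_def A'_def)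
  note cA' = graded_matD[OF gA']
  have eq: "A *\<^sub>v v = A' *\<^sub>v vec (length C - 1) (\<lambda>k. v $ \<sigma> k)" 
    if v: "v \<in> carrier_vec (length C)" "v $ b = 0" for v
  proof (rule eq_vecI)
    fix a assume "a < dim_vec (A' *\<^sub>v vec (length C - 1) (\<lambda>k. v $ \<sigma> k))"
    hence a: "a < length R" using cA' by simp
    have "(A *\<^sub>v v) $ a = (\<Sum>k\<in>{0..<length C}. A $$ (a, k) * v $ k)"
      using a cA v by (simp add: scalar_prod_def)
    also have "\<dots> = (\<Sum>k\<in>{0..<length C - 1}. A $$ (a, \<sigma> k) * v $ \<sigma> k)"
      using sum_skip[OF bj(1), of "\<lambda>k. A $$ (a, k) * v $ k"] v(2) by (simp add: \<sigma>_def)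
    also have "\<dots> = (A' *\<^sub>v vec (length C - 1) (\<lambda>k. v $ \<sigma> k)) $ a"
      using a by (simp add: scalar_prod_def A'_def)
    finally show "(A *\<^sub>v v) $ a = (A' *\<^sub>v vec (length C - 1) (\<lambda>k. v $ \<sigma> k)) $ a" .
  qed (use cA cA' in auto)
  have "mat_image A' = mat_image A"
  proof (intro equalityI subsetI)
    fix x assume "x \<in> mat_image A'"
    then obtain w where w: "w \<in> carrier_vec (length C - 1)" "x = A' *\<^sub>v w"
      using mat_image_iff[OF cA'] lC' by auto
    define v where "v = vec (length C) (\<lambda>k. if k = b then 0 else if k < b then w $ k else w $ (k - 1))"
    have "vec (length C - 1) (\<lambda>k. v $ \<sigma> k) = w"
      by (rule eq_vecI) (use w \<sigma> in \<open>auto simp: v_def \<sigma>_def\<close>)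
    hence "x = A *\<^sub>v v" using eq[of v] w bj by (simp add: v_def)
    thus "x \<in> mat_image A" using mat_image_iff[OF cA] by (auto simp: v_def)
  next
    fix x assume "x \<in> mat_image A"
    then obtain v where v: "v \<in> carrier_vec (length C)" "x = A *\<^sub>v v" using mat_image_iff[OF cA] by auto
    define s where "s = v $ b * q"
    have "A *\<^sub>v (v - s \<cdot>\<^sub>v r) = A *\<^sub>v v - A *\<^sub>v (s \<cdot>\<^sub>v r)"
      by (rule mult_minus_distrib_mat_vec[OF cA v(1)]) (use r in simp)
    also have "A *\<^sub>v (s \<cdot>\<^sub>v r) = 0\<^sub>v (length R)" using mult_mat_vec_smult[OF cA r(1)] r(2) by auto
    finally have "x = A *\<^sub>v (v - s \<cdot>\<^sub>v r)" using v cA by auto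
    moreover have "(v - s \<cdot>\<^sub>v r) $ b = 0" using bj r(1) v rb by (simp add: s_def mult.assoc)
    ultimately have "x = A' *\<^sub>v vec (length C - 1) (\<lambda>k. (v - s \<cdot>\<^sub>v r) $ \<sigma> k)"
      using eq[of "v - s \<cdot>\<^sub>v r"] v r by simp
    thus "x \<in> mat_image A'" using mat_image_iff[OF cA'] lC' by auto
  qed
  from least[OF gA' this] lC' bj(1) show False by simp
qed

lemma exists_hcat:
  fixes A :: "('v::finite, 'k::field) mpoly mat"
  assumes A: "graded_mat R C1 A" and B: "graded_mat R C2 B"
  obtains M where "graded_mat R (C1 @ C2) M"
    "mat_image M = {A *\<^sub>v a + B *\<^sub>v b | a b. a \<in> carrier_vec (length C1) \<and> b \<in> carrier_vec (length C2)}"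
proof -
  note cA = graded_matD[OF A] and cB = graded_matD[OF B]
  define M where "M = four_block_mat A B (0\<^sub>m 0 (length C1)) (0\<^sub>m 0 (length C2))"
  have g: "graded_mat R (C1 @ C2) M"
    using graded_mat_four_block[OF A B, of "[]"] unfolding M_def by (auto simp: graded_mat_zero)
  have e: "M *\<^sub>v (a @\<^sub>v b) = A *\<^sub>v a + B *\<^sub>v b"
    if "a \<in> carrier_vec (length C1)" "b \<in> carrier_vec (length C2)" for a b
    unfolding M_def four_block_mat_mult_vec[OF cA cB zero_carrier_mat zero_carrier_mat that]
    using cA cB that by (intro eq_vecI) auto
  have "mat_image M = {A *\<^sub>v a + B *\<^sub>v b | a b. a \<in> carrier_vec (length C1) \<and> b \<in> carrier_vec (length C2)}"
  proof (intro equalityI subsetI)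
    fix x assume "x \<in> mat_image M"
    then obtain v where v: "v \<in> carrier_vec (length C1 + length C2)" "x = M *\<^sub>v v"
      using mat_image_iff[OF graded_matD[OF g]] by auto
    have "v = vec_first v (length C1) @\<^sub>v vec_last v (length C2)" using v(1) by simp
    hence "x = A *\<^sub>v vec_first v (length C1) + B *\<^sub>v vec_last v (length C2)"
      using e[OF vec_first_carrier vec_last_carrier] v(2) by metis
    thus "x \<in> {A *\<^sub>v a + B *\<^sub>v b | a b. a \<in> carrier_vec (length C1) \<and> b \<in> carrier_vec (length C2)}"
      using vec_first_carrier vec_last_carrier by blast
  next
    fix x assume "x \<in> {A *\<^sub>v a + B *\<^sub>v b | a b. a \<in> carrier_vec (length C1) \<and> b \<in> carrier_vec (length C2)}"
    then obtain a b where ab: "a \<in> carrier_vec (length C1)" "b \<in> carrier_vec (length C2)" "x = A *\<^sub>v a + B *\<^sub>v b"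
      by blast
    hence "x = M *\<^sub>v (a @\<^sub>v b)" "a @\<^sub>v b \<in> carrier_vec (length (C1 @ C2))" using e by auto
    thus "x \<in> mat_image M" using mat_image_iff[OF graded_matD[OF g]] by blast
  qed
  thus thesis using that g by blast
qed

text \<open>A minimal resolution is constructed step by step beside a given resolution \<open>L'\<close>, \<open>D'\<close> of the same module.
The point is that the cycles \<open>Z\<close> of the complex constructed so far are finitely generated. For this the
construction carries along comparison maps \<open>\<Phi>\<close> and \<open>\<Psi>\<close> between the current module and the \<open>i\<close>-th module of
the given resolution, and the remainder \<open>X\<close> of the homotopy between \<open>\<Psi> \<circ> \<Phi>\<close> and the identity, which maps
everything into cycles and agrees with \<open>1 - \<Psi> \<circ> \<Phi>\<close> on cycles.\<close>

definition stage where
  "stage L' Z' D' i L Z \<Phi> \<Psi> X \<longleftrightarrow>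
     graded_mat (L' i) L \<Phi> \<and> graded_mat L (L' i) \<Psi> \<and> graded_mat L L X \<and>
     Z \<subseteq> carrier_vec (length L) \<and> (\<forall>x\<in>Z. \<forall>y\<in>Z. x + y \<in> Z) \<and>
     (\<forall>z\<in>Z. \<Phi> *\<^sub>v z \<in> cycles Z' D' i) \<and> (\<forall>g\<in>cycles Z' D' i. \<Psi> *\<^sub>v g \<in> Z) \<and>
     (\<forall>v\<in>carrier_vec (length L). X *\<^sub>v v \<in> Z) \<and> (\<forall>z\<in>Z. X *\<^sub>v z + \<Psi> *\<^sub>v (\<Phi> *\<^sub>v z) = z)"

text \<open>A cycle \<open>z\<close> equals \<open>X z + \<Psi> (\<Phi> z)\<close>, and \<open>\<Phi> z\<close> is a boundary of the given resolution. So the cycles are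
generated by the columns of \<open>X\<close> and of \<open>\<Psi> \<circ> D' i\<close>, which are finite in number and homogeneous.\<close>

lemma stage_generators:
  fixes D' :: "nat \<Rightarrow> ('v::finite, 'k::field) mpoly mat"
  assumes G: "graded_resolution Z' L' D'" and st: "stage L' Z' D' i L Z \<Phi> \<Psi> X"
  shows "\<exists>C A. graded_mat L C A \<and> mat_image A = Z \<and>
    (\<forall>C' A'. graded_mat L C' A' \<longrightarrow> mat_image A' = Z \<longrightarrow> length C \<le> length C')"
proof -
  have gD': "graded_mat (L' i) (L' (Suc i)) (D' i)" and im: "mat_image (D' i) = cycles Z' D' i" using G by (auto simp: graded_resolution_def)
  note cD' = graded_matD[OF gD']
  from st have g: "graded_mat (L' i) L \<Phi>" "graded_mat L (L' i) \<Psi>" "graded_mat L L X"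
    and Zc: "Z \<subseteq> carrier_vec (length L)" and add: "\<And>x y. x \<in> Z \<Longrightarrow> y \<in> Z \<Longrightarrow> x + y \<in> Z"
    and \<Phi>: "\<And>z. z \<in> Z \<Longrightarrow> \<Phi> *\<^sub>v z \<in> cycles Z' D' i" and \<Psi>: "\<And>g. g \<in> cycles Z' D' i \<Longrightarrow> \<Psi> *\<^sub>v g \<in> Z"
    and X: "\<And>v. v \<in> carrier_vec (length L) \<Longrightarrow> X *\<^sub>v v \<in> Z"
    and Xz: "\<And>z. z \<in> Z \<Longrightarrow> X *\<^sub>v z + \<Psi> *\<^sub>v (\<Phi> *\<^sub>v z) = z" unfolding stage_def by auto
  obtain M where M: "graded_mat L (L @ L' (Suc i)) M"
    "mat_image M = {X *\<^sub>v a + (\<Psi> * D' i) *\<^sub>v b | a b. a \<in> carrier_vec (length L) \<and> b \<in> carrier_vec (length (L' (Suc i)))}"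
    using exists_hcat[OF g(3) graded_mat_mult[OF g(2) gD']] .
  have pd: "(\<Psi> * D' i) *\<^sub>v b = \<Psi> *\<^sub>v (D' i *\<^sub>v b)" if "b \<in> carrier_vec (length (L' (Suc i)))" for b
    by (rule assoc_mult_mat_vec[OF graded_matD[OF g(2)] cD' that])
  have "mat_image M = Z"
  proof (intro equalityI subsetI)
    fix z assume "z \<in> mat_image M"
    then obtain a b where ab: "a \<in> carrier_vec (length L)" "b \<in> carrier_vec (length (L' (Suc i)))"
      "z = X *\<^sub>v a + \<Psi> *\<^sub>v (D' i *\<^sub>v b)" using M(2) pd by auto
    have "D' i *\<^sub>v b \<in> cycles Z' D' i" using ab(2) im mat_image_iff[OF cD'] by blast
    thus "z \<in> Z" using ab add X \<Psi> by simp
  next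
    fix z assume z: "z \<in> Z"
    obtain b where b: "b \<in> carrier_vec (length (L' (Suc i)))" "\<Phi> *\<^sub>v z = D' i *\<^sub>v b"
      using \<Phi>[OF z] im mat_image_iff[OF cD'] by blast
    have "z = X *\<^sub>v z + (\<Psi> * D' i) *\<^sub>v b" using Xz[OF z] b pd by simp
    thus "z \<in> mat_image M" using z Zc b(1) M(2) by blast
  qed
  with M(1) have "\<exists>C. (\<exists>A. graded_mat L C A \<and> mat_image A = Z)" by blast
  then obtain C where C: "\<exists>A. graded_mat L C A \<and> mat_image A = Z"
    and least: "\<And>C'. (\<exists>A. graded_mat L C' A \<and> mat_image A = Z) \<Longrightarrow> length C \<le> length C'"
    using ex_has_least_nat[of "\<lambda>C. \<exists>A. graded_mat L C A \<and> mat_image A = Z" _ length] by blast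
  thus ?thesis by blast
qed

text \<open>Lifting \<open>\<Phi> \<circ> A\<close>, \<open>\<Psi> \<circ> D' i\<close> and \<open>X\<close> gives \<open>\<Phi>'\<close>, \<open>\<Psi>'\<close> and a homotopy \<open>H\<close>, and the new remainder is
\<open>1 - \<Psi>' \<circ> \<Phi>' - H \<circ> A\<close>; on the kernel of \<open>A\<close> the homotopy term vanishes.\<close>

lemma stage_next:
  fixes D' :: "nat \<Rightarrow> ('v::finite, 'k::field) mpoly mat"
  assumes G: "graded_resolution Z' L' D'" and st: "stage L' Z' D' i L Z \<Phi> \<Psi> X"
    and A: "graded_mat L C A" "mat_image A = Z"
  shows "\<exists>\<Phi>' \<Psi>' X'. stage L' Z' D' (Suc i) C (mat_kernel A) \<Phi>' \<Psi>' X'"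
proof -
  have gD': "graded_mat (L' i) (L' (Suc i)) (D' i)" and im: "mat_image (D' i) = cycles Z' D' i" using G by (auto simp: graded_resolution_def)
  note cD' = graded_matD[OF gD']
  from st have g: "graded_mat (L' i) L \<Phi>" "graded_mat L (L' i) \<Psi>" "graded_mat L L X"
    and \<Phi>: "\<And>z. z \<in> Z \<Longrightarrow> \<Phi> *\<^sub>v z \<in> cycles Z' D' i" and \<Psi>: "\<And>g. g \<in> cycles Z' D' i \<Longrightarrow> \<Psi> *\<^sub>v g \<in> Z"
    and X: "\<And>v. v \<in> carrier_vec (length L) \<Longrightarrow> X *\<^sub>v v \<in> Z"
    and Xz: "\<And>z. z \<in> Z \<Longrightarrow> X *\<^sub>v z + \<Psi> *\<^sub>v (\<Phi> *\<^sub>v z) = z" unfolding stage_def by auto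
  note cA = graded_matD[OF A(1)] and c\<Phi> = graded_matD[OF g(1)] and c\<Psi> = graded_matD[OF g(2)]
    and cX = graded_matD[OF g(3)]
  have AZ: "A *\<^sub>v v \<in> Z" if "v \<in> carrier_vec (length C)" for v using that A(2) mat_image_iff[OF cA] by blast
  have D'Z: "D' i *\<^sub>v v \<in> cycles Z' D' i" if "v \<in> carrier_vec (length (L' (Suc i)))" for v
    using that im mat_image_iff[OF cD'] by blast
  have "(\<Phi> * A) *\<^sub>v v \<in> mat_image (D' i)" if "v \<in> carrier_vec (length C)" for v
    unfolding im assoc_mult_mat_vec[OF c\<Phi> cA that] using \<Phi> AZ that by blast
  then obtain \<Phi>' where \<Phi>': "graded_mat (L' (Suc i)) C \<Phi>'" "D' i * \<Phi>' = \<Phi> * A"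
    using graded_lift[OF gD' graded_mat_mult[OF g(1) A(1)]] by metis
  have "(\<Psi> * D' i) *\<^sub>v v \<in> mat_image A" if "v \<in> carrier_vec (length (L' (Suc i)))" for v
    unfolding A(2) assoc_mult_mat_vec[OF c\<Psi> cD' that] using \<Psi> D'Z that by blast
  then obtain \<Psi>' where \<Psi>': "graded_mat C (L' (Suc i)) \<Psi>'" "A * \<Psi>' = \<Psi> * D' i"
    using graded_lift[OF A(1) graded_mat_mult[OF g(2) gD']] by metis
  obtain H where H: "graded_mat C L H" "A * H = X"
    using graded_lift[OF A(1) g(3)] X A(2) by metis
  note c\<Phi>' = graded_matD[OF \<Phi>'(1)] and c\<Psi>' = graded_matD[OF \<Psi>'(1)] and cH = graded_matD[OF H(1)]
  define X' where "X' = 1\<^sub>m (length C) - \<Psi>' * \<Phi>' - H * A"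
  have gX': "graded_mat C C X'"
    unfolding X'_def by (intro graded_mat_diff graded_mat_one graded_mat_mult[OF \<Psi>'(1) \<Phi>'(1)] graded_mat_mult[OF H(1) A(1)])
  have c1: "1\<^sub>m (length C) - \<Psi>' * \<Phi>' \<in> carrier_mat (length C) (length C)"
    by (rule minus_carrier_mat) (use c\<Psi>' c\<Phi>' in simp)
  have X'v: "X' *\<^sub>v v = v - \<Psi>' *\<^sub>v (\<Phi>' *\<^sub>v v) - H *\<^sub>v (A *\<^sub>v v)" if v: "v \<in> carrier_vec (length C)" for v
  proof -
    have "X' *\<^sub>v v = (1\<^sub>m (length C) - \<Psi>' * \<Phi>') *\<^sub>v v - (H * A) *\<^sub>v v"
      unfolding X'_def by (rule minus_mult_distrib_mat_vec[OF c1 _ v]) (use cH cA in simp)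
    also have "(1\<^sub>m (length C) - \<Psi>' * \<Phi>') *\<^sub>v v = 1\<^sub>m (length C) *\<^sub>v v - (\<Psi>' * \<Phi>') *\<^sub>v v"
      by (rule minus_mult_distrib_mat_vec[OF one_carrier_mat _ v]) (use c\<Psi>' c\<Phi>' in simp)
    finally show ?thesis using v c\<Psi>' c\<Phi>' cH cA by simp
  qed
  have "X' *\<^sub>v v \<in> mat_kernel A" if v: "v \<in> carrier_vec (length C)" for v
  proof -
    have c: "\<Psi>' *\<^sub>v (\<Phi>' *\<^sub>v v) \<in> carrier_vec (length C)" "H *\<^sub>v (A *\<^sub>v v) \<in> carrier_vec (length C)"
      using mult_mat_vec_carrier[OF c\<Psi>' mult_mat_vec_carrier[OF c\<Phi>' v]]
        mult_mat_vec_carrier[OF cH mult_mat_vec_carrier[OF cA v]] by auto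
    have "A *\<^sub>v (X' *\<^sub>v v) = A *\<^sub>v (v - \<Psi>' *\<^sub>v (\<Phi>' *\<^sub>v v)) - A *\<^sub>v (H *\<^sub>v (A *\<^sub>v v))"
      unfolding X'v[OF v] by (rule mult_minus_distrib_mat_vec[OF cA _ c(2)]) (use c v in simp)
    also have "A *\<^sub>v (v - \<Psi>' *\<^sub>v (\<Phi>' *\<^sub>v v)) = A *\<^sub>v v - A *\<^sub>v (\<Psi>' *\<^sub>v (\<Phi>' *\<^sub>v v))"
      by (rule mult_minus_distrib_mat_vec[OF cA v c(1)])
    also have "A *\<^sub>v (\<Psi>' *\<^sub>v (\<Phi>' *\<^sub>v v)) = (A * \<Psi>') *\<^sub>v (\<Phi>' *\<^sub>v v)"
      by (rule assoc_mult_mat_vec[OF cA c\<Psi>', symmetric]) (use v c\<Phi>' in simp)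
    also have "\<dots> = \<Psi> *\<^sub>v (D' i *\<^sub>v (\<Phi>' *\<^sub>v v))"
      unfolding \<Psi>'(2) by (rule assoc_mult_mat_vec[OF c\<Psi> cD']) (use v c\<Phi>' in simp)
    also have "D' i *\<^sub>v (\<Phi>' *\<^sub>v v) = (\<Phi> * A) *\<^sub>v v"
      unfolding \<Phi>'(2)[symmetric] by (rule assoc_mult_mat_vec[OF cD' c\<Phi>' v, symmetric])
    also have "\<dots> = \<Phi> *\<^sub>v (A *\<^sub>v v)" by (rule assoc_mult_mat_vec[OF c\<Phi> cA v])
    also have "A *\<^sub>v (H *\<^sub>v (A *\<^sub>v v)) = (A * H) *\<^sub>v (A *\<^sub>v v)"
      by (rule assoc_mult_mat_vec[OF cA cH, symmetric]) (use v cA in simp)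
    also have "\<dots> = X *\<^sub>v (A *\<^sub>v v)" by (simp add: H(2))
    also have "A *\<^sub>v v - \<Psi> *\<^sub>v (\<Phi> *\<^sub>v (A *\<^sub>v v)) - X *\<^sub>v (A *\<^sub>v v) = 0\<^sub>v (length L)"
    proof -
      define y where "y = A *\<^sub>v v"
      have y: "X *\<^sub>v y + \<Psi> *\<^sub>v (\<Phi> *\<^sub>v y) = y" using Xz AZ[OF v] by (simp add: y_def)
      have yc: "y \<in> carrier_vec (length L)" using mult_mat_vec_carrier[OF cA v] by (simp add: y_def)
      have "y $ k = (X *\<^sub>v y) $ k + (\<Psi> *\<^sub>v (\<Phi> *\<^sub>v y)) $ k" if "k < length L" for k
        using arg_cong[OF y, of "\<lambda>u. u $ k"] that cX c\<Psi> by simp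
      thus ?thesis unfolding y_def[symmetric] using yc cX c\<Psi> by (intro eq_vecI) auto
    qed
    finally show ?thesis using v gX' graded_matD[OF gX'] by (simp add: mat_kernel_iff[OF cA])
  qed
  moreover have "X' *\<^sub>v z + \<Psi>' *\<^sub>v (\<Phi>' *\<^sub>v z) = z" if "z \<in> mat_kernel A" for z
  proof -
    have z: "z \<in> carrier_vec (length C)" "A *\<^sub>v z = 0\<^sub>v (length L)" using that by (auto simp: mat_kernel_iff[OF cA])
    show ?thesis unfolding X'v[OF z(1)] z(2) mult_mat_vec_zero[OF cH]
      by (rule eq_vecI) (use z(1) c\<Psi>' c\<Phi>' in auto)
  qed
  moreover have "\<Phi>' *\<^sub>v z \<in> cycles Z' D' (Suc i)" if "z \<in> mat_kernel A" for z
  proof -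
    have z: "z \<in> carrier_vec (length C)" "A *\<^sub>v z = 0\<^sub>v (length L)" using that by (auto simp: mat_kernel_iff[OF cA])
    have "D' i *\<^sub>v (\<Phi>' *\<^sub>v z) = (\<Phi> * A) *\<^sub>v z"
      unfolding \<Phi>'(2)[symmetric] by (rule assoc_mult_mat_vec[OF cD' c\<Phi>' z(1), symmetric])
    also have "\<dots> = \<Phi> *\<^sub>v (A *\<^sub>v z)" by (rule assoc_mult_mat_vec[OF c\<Phi> cA z(1)])
    finally show ?thesis using z mult_mat_vec_zero[OF c\<Phi>] c\<Phi>' by (simp add: mat_kernel_iff[OF cD'])
  qed
  moreover have "\<Psi>' *\<^sub>v z \<in> mat_kernel A" if "z \<in> cycles Z' D' (Suc i)" for z
  proof -
    have z: "z \<in> carrier_vec (length (L' (Suc i)))" "D' i *\<^sub>v z = 0\<^sub>v (length (L' i))"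
      using that by (auto simp: mat_kernel_iff[OF cD'])
    have "A *\<^sub>v (\<Psi>' *\<^sub>v z) = (\<Psi> * D' i) *\<^sub>v z"
      unfolding \<Psi>'(2)[symmetric] by (rule assoc_mult_mat_vec[OF cA c\<Psi>' z(1), symmetric])
    also have "\<dots> = \<Psi> *\<^sub>v (D' i *\<^sub>v z)" by (rule assoc_mult_mat_vec[OF c\<Psi> cD' z(1)])
    finally show ?thesis using z mult_mat_vec_zero[OF c\<Psi>] c\<Psi>' by (simp add: mat_kernel_iff[OF cA])
  qed
  moreover have "x + y \<in> mat_kernel A" if "x \<in> mat_kernel A" "y \<in> mat_kernel A" for x y
    using that mult_add_distrib_mat_vec[OF cA, of x y] by (simp add: mat_kernel_iff[OF cA])
  moreover have "mat_kernel A \<subseteq> carrier_vec (length C)" by (auto simp: mat_kernel_iff[OF cA])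
  ultimately have "stage L' Z' D' (Suc i) C (mat_kernel A) \<Phi>' \<Psi>' X'"
    unfolding stage_def using \<Phi>'(1) \<Psi>'(1) gX' by blast
  thus ?thesis by blast
qed

text \<open>In each step a homogeneous generating system of least length is chosen. The construction starts with
\<open>\<Phi> = \<Psi> = 1\<close> and \<open>X = 0\<close>.\<close>

theorem minimal_graded_resolution_exists:
  fixes D' :: "nat \<Rightarrow> ('v::finite, 'k::field) mpoly mat"
  assumes G: "graded_resolution Z L' D'" and irr: "\<And>z k. z \<in> Z \<Longrightarrow> k < dim_vec z \<Longrightarrow> z $ k \<in> irrelevant_ideal"
  obtains L D where "graded_resolution Z L D" "L 0 = L' 0" "\<And>i. irr_mat (D i)"
proof -
  define P where "P = (\<lambda>i (L, Y). (\<exists>\<Phi> \<Psi> X. stage L' Z D' i L Y \<Phi> \<Psi> X) \<and> (i = 0 \<longrightarrow> L = L' 0 \<and> Y = Z))"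
  define Q where "Q = (\<lambda>s t (A :: ('v, 'k) mpoly mat). graded_mat (fst s) (fst t) A \<and> mat_image A = snd s \<and> snd t = mat_kernel A \<and>
    (\<forall>C' A'. graded_mat (fst s) C' A' \<longrightarrow> mat_image A' = snd s \<longrightarrow> length (fst t) \<le> length C'))"
  have "\<exists>s. \<forall>i. P i (s i) \<and> (\<exists>A. Q (s i) (s (Suc i)) A)"
  proof (rule dependent_nat_choice)
    have gD': "graded_mat (L' 0) (L' 1) (D' 0)" and im: "mat_image (D' 0) = Z" using G
      by (simp_all add: graded_resolution_def)
    note cD' = graded_matD[OF gD']
    have c: "Z \<subseteq> carrier_vec (length (L' 0))" using im mat_image_carrier[OF cD'] by simp
    have zZ: "0\<^sub>v (length (L' 0)) \<in> Z"
      unfolding im[symmetric] mat_image_iff[OF cD'] using mult_mat_vec_zero[OF cD'] by (metis zero_carrier_vec)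
    have add: "x + y \<in> Z" if xy: "x \<in> Z" "y \<in> Z" for x y
    proof -
      obtain v w where "v \<in> carrier_vec (length (L' 1))" "x = D' 0 *\<^sub>v v" "w \<in> carrier_vec (length (L' 1))" "y = D' 0 *\<^sub>v w"
        using xy unfolding im[symmetric] mat_image_iff[OF cD'] by blast
      thus ?thesis unfolding im[symmetric] mat_image_iff[OF cD']
        using mult_add_distrib_mat_vec[OF cD'] by (metis add_carrier_vec)
    qed
    have "stage L' Z D' 0 (L' 0) Z (1\<^sub>m (length (L' 0))) (1\<^sub>m (length (L' 0))) (0\<^sub>m (length (L' 0)) (length (L' 0)))"
      unfolding stage_def using c zZ add by (auto simp: graded_mat_zero zero_mat_mult_vec subset_iff)
    thus "\<exists>s. P 0 s" by (auto simp: P_def)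
  next
    fix s i assume "P i s"
    then obtain L Y \<Phi> \<Psi> X where s: "s = (L, Y)" and st: "stage L' Z D' i L Y \<Phi> \<Psi> X" by (auto simp: P_def)
    obtain C A where A: "graded_mat L C A" "mat_image A = Y"
      and least: "\<forall>C' A'. graded_mat L C' A' \<longrightarrow> mat_image A' = Y \<longrightarrow> length C \<le> length C'"
      using stage_generators[OF G st] by (elim exE conjE)
    have "P (Suc i) (C, mat_kernel A)" using stage_next[OF G st A(1,2)] by (simp add: P_def)
    moreover have "Q s (C, mat_kernel A) A" using A least by (simp add: Q_def s)
    ultimately show "\<exists>t. P (Suc i) t \<and> (\<exists>A. Q s t A)" by blast
  qed
  then obtain s where s: "\<And>i. P i (s i)" "\<And>i. \<exists>A. Q (s i) (s (Suc i)) A" by blast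
  then obtain A where A: "\<And>i. Q (s i) (s (Suc i)) (A i)" by metis
  define L where "L = (\<lambda>i. fst (s i))"
  have s0: "s 0 = (L' 0, Z)" using s(1)[of 0] by (cases "s 0") (auto simp: P_def)
  have gA: "graded_mat (L i) (L (Suc i)) (A i)" for i using A[of i] by (simp add: Q_def L_def)
  have im: "mat_image (A i) = cycles Z A i" for i
    using A[of i] A[of "i - 1"] by (cases i) (simp_all add: Q_def s0)
  have "graded_resolution Z L A" using gA im by (simp add: graded_resolution_def)
  moreover have "irr_mat (A i)" for i
  proof (cases i)
    case 0
    have "A 0 $$ (a, b) \<in> irrelevant_ideal" if ab: "a < length (L 0)" "b < length (L 1)" for a b
    proof -
      note cA = graded_matD[OF gA[of 0]]
      have "A 0 *\<^sub>v unit_vec (length (L 1)) b \<in> Z" using im[of 0] mat_image_iff[OF cA] by fastforce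
      hence "col (A 0) b \<in> Z" using mult_mat_unit_vec[OF cA] ab by simp
      from irr[OF this, of a] show ?thesis using ab cA by simp
    qed
    thus ?thesis using graded_matD[OF gA[of 0]] 0 by (auto simp: irr_mat_def)
  next
    case (Suc j)
    show ?thesis unfolding Suc
    proof (rule minimal_generators_syzygies[OF gA[of j] gA[of "Suc j"]])
      show "mat_image (A (Suc j)) \<subseteq> mat_kernel (A j)" using im[of "Suc j"] by simp
      show "length (L (Suc j)) \<le> length C'" if "graded_mat (L j) C' A'" "mat_image A' = mat_image (A j)" for C' A'
        using A[of j] that by (simp add: Q_def L_def)
    qed
  qed
  ultimately show thesis using that[of L A] s0 by (simp add: L_def)
qed

section \<open>Degrees in resolutions of monomial quotients\<close>

text \<open>An ideal as a set of vectors of length one, in the role of the submodule of \<open>F\<^sub>0 = S\<close> that is factored out.\<close>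

definition ideal_vec :: "('v, 'k::field) mpoly set \<Rightarrow> ('v, 'k) mpoly vec set" where
  "ideal_vec I = {v \<in> carrier_vec 1. v $ 0 \<in> I}"

lemma mult_mat_1_1: "M \<in> carrier_mat 1 1 \<Longrightarrow> v \<in> carrier_vec 1 \<Longrightarrow> (M *\<^sub>v v) $ 0 = M $$ (0, 0) * v $ 0"
  for M :: "'a::comm_ring_1 mat"
  by (auto simp: scalar_prod_def)

lemma graded_free_resolutionD:
  assumes "graded_free_resolution I sh D"
  shows "D 0 \<in> carrier_mat 1 (length (sh 0))"
    and "\<forall>b<length (sh 0). homogeneous (sh 0 ! b) (D 0 $$ (0, b))"
    and "graded_mat (sh i) (sh (Suc i)) (D (Suc i))"
    and "\<forall>p. \<exists>v\<in>carrier_vec (length (sh 0)). p - (D 0 *\<^sub>v v) $ 0 \<in> I"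
    and "{v \<in> carrier_vec (length (sh 0)). (D 0 *\<^sub>v v) $ 0 \<in> I}
       = (\<lambda>w. D 1 *\<^sub>v w) ` carrier_vec (length (sh 1))"
    and "mat_kernel (D (Suc i))
       = (\<lambda>w. D (Suc (Suc i)) *\<^sub>v w) ` carrier_vec (length (sh (Suc (Suc i))))"
proof -
  note 1 = assms[unfolded graded_free_resolution_def]
  note 2 = conjunct2[OF 1] note 3 = conjunct2[OF 2] note 4 = conjunct2[OF 3] note 5 = conjunct2[OF 4]
  show "D 0 \<in> carrier_mat 1 (length (sh 0))" by (rule conjunct1[OF 1])
  show "\<forall>b<length (sh 0). homogeneous (sh 0 ! b) (D 0 $$ (0, b))" by (rule conjunct1[OF 2])
  show "graded_mat (sh i) (sh (Suc i)) (D (Suc i))"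
    unfolding graded_mat_def using conjunct1[OF 3] by (rule spec)
  show "\<forall>p. \<exists>v\<in>carrier_vec (length (sh 0)). p - (D 0 *\<^sub>v v) $ 0 \<in> I" by (rule conjunct1[OF 4])
  show "{v \<in> carrier_vec (length (sh 0)). (D 0 *\<^sub>v v) $ 0 \<in> I}
       = (\<lambda>w. D 1 *\<^sub>v w) ` carrier_vec (length (sh 1))" by (rule conjunct1[OF 5])
  show "mat_kernel (D (Suc i))
       = (\<lambda>w. D (Suc (Suc i)) *\<^sub>v w) ` carrier_vec (length (sh (Suc (Suc i))))"
    using conjunct2[OF 5] by (rule spec)
qed

lemma resolution_imp_graded_resolution:
  assumes "graded_free_resolution I sh D"
  shows "graded_resolution {v \<in> carrier_vec (length (sh 0)). (D 0 *\<^sub>v v) $ 0 \<in> I} sh (\<lambda>i. D (Suc i))"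
proof -
  note R = graded_free_resolutionD[OF assms]
  have "mat_image (D (Suc i)) = cycles {v \<in> carrier_vec (length (sh 0)). (D 0 *\<^sub>v v) $ 0 \<in> I} (\<lambda>i. D (Suc i)) i" for i
  proof -
    have d: "dim_col (D (Suc i)) = length (sh (Suc i))" using graded_matD[OF R(3)[of i]] by simp
    show ?thesis
    proof (cases i)
      case 0 thus ?thesis unfolding mat_image_def d using R(5) by simp
    next
      case (Suc j) thus ?thesis unfolding mat_image_def d using R(6)[of j] by simp
    qed
  qed
  with R(3) show ?thesis by (simp add: graded_resolution_def)
qed

lemma graded_resolution_imp_minimal_resolution:
  fixes D :: "nat \<Rightarrow> ('v::finite, 'k::field) mpoly mat"
  assumes R: "graded_resolution (ideal_vec I) L D" and L0: "L 0 = [0]" and z: "0 \<in> I" and irr: "\<And>i. irr_mat (D i)"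
  shows "minimal_graded_free_resolution I L (case_nat (1\<^sub>m 1) D)"
proof -
  have g: "graded_mat (L i) (L (Suc i)) (D i)" and im: "mat_image (D i) = cycles (ideal_vec I) D i" for i
    using R by (auto simp: graded_resolution_def)
  note c = graded_matD[OF g]
  have 0: "mat_image (D 0) = ideal_vec I" using im[of 0] by simp
  have "\<exists>v\<in>carrier_vec 1. p - (1\<^sub>m 1 *\<^sub>v v) $ 0 \<in> I" for p
    by (rule bexI[of _ "vec 1 (\<lambda>_. p)"]) (use z in auto)
  moreover have "{v \<in> carrier_vec 1. (1\<^sub>m 1 *\<^sub>v v) $ 0 \<in> I} = (\<lambda>w. D 0 *\<^sub>v w) ` carrier_vec (length (L 1))"
    using 0 c[of 0] by (auto simp: ideal_vec_def mat_image_def)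
  moreover have "mat_kernel (D i) = (\<lambda>w. D (Suc i) *\<^sub>v w) ` carrier_vec (length (L (Suc (Suc i))))" for i
    using im[of "Suc i"] c[of "Suc i"] by (simp add: mat_image_def)
  ultimately have "graded_free_resolution I L (case_nat (1\<^sub>m 1) D)"
    using g L0 unfolding graded_free_resolution_def by (auto simp: graded_mat_def)
  moreover have "case_nat (1\<^sub>m 1) D (Suc i) $$ (a, b) \<in> irrelevant_ideal"
    if "a < length (L i)" "b < length (L (Suc i))" for i a b
    using irr[of i] c[of i] that by (simp add: irr_mat_def)
  ultimately show ?thesis unfolding minimal_graded_free_resolution_def by blast
qed

text \<open>The augmentation \<open>D 0\<close> and a homogeneous preimage of \<open>1\<close> under it extend to chain maps between an arbitrary
minimal resolution and one that starts with \<open>F\<^sub>0 = S\<close>. Both composites induce the identity on the resolved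
module, so \<open>shifts_subset\<close> applies in both directions.\<close>

theorem minimal_shifts:
  fixes \<A> :: "'v::finite set set" and D d :: "nat \<Rightarrow> ('v, 'k::field) mpoly mat"
  assumes F: "minimal_graded_free_resolution (sqfree_ideal \<A>) sh D"
    and G: "graded_resolution (ideal_vec (sqfree_ideal \<A>)) L d" and L0: "L 0 = [0]"
  shows "set (sh i) \<subseteq> set (L i)"
    and "(\<And>i. irr_mat (d i)) \<Longrightarrow> set (L i) \<subseteq> set (sh i)"
proof -
  let ?I = "sqfree_ideal \<A> :: ('v, 'k) mpoly set"
  define Z where "Z = {v \<in> carrier_vec (length (sh 0)). (D 0 *\<^sub>v v) $ 0 \<in> ?I}"
  have Fr: "graded_free_resolution ?I sh D" using F by (simp add: minimal_graded_free_resolution_def)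
  have RF: "graded_resolution Z sh (\<lambda>i. D (Suc i))" unfolding Z_def by (rule resolution_imp_graded_resolution[OF Fr])
  have gF: "graded_mat (sh i) (sh (Suc i)) (D (Suc i))" for i using RF by (simp add: graded_resolution_def)
  have gG: "graded_mat (L i) (L (Suc i)) (d i)" for i using G by (simp add: graded_resolution_def)
  have minF: "irr_mat (D (Suc i))" for i
  proof -
    have "\<forall>i. \<forall>a<length (sh i). \<forall>b<length (sh (Suc i)). D (Suc i) $$ (a, b) \<in> irrelevant_ideal"
      using F unfolding minimal_graded_free_resolution_def by (rule conjunct2)
    thus ?thesis using graded_matD[OF gF[of i]] by (simp add: irr_mat_def)
  qed
  have "D 0 \<in> carrier_mat 1 (length (sh 0))" "\<forall>b<length (sh 0). homogeneous (sh 0 ! b) (D 0 $$ (0, b))"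
    using graded_free_resolutionD(1,2)[OF Fr] by blast+
  hence c0: "D 0 \<in> carrier_mat 1 (length (sh 0))" and g0: "graded_mat [0] (sh 0) (D 0)" by (simp_all add: graded_mat_def)
  \<comment> \<open>\<open>\<psi>\<close> sends \<open>1\<close> to a homogeneous preimage \<open>u\<close> of \<open>1\<close> under the augmentation\<close>
  obtain w where w: "w \<in> carrier_vec (length (sh 0))" "1 - (D 0 *\<^sub>v w) $ 0 \<in> ?I"
    using graded_free_resolutionD(4)[OF Fr] by blast
  define u where "u = vec (length (sh 0)) (\<lambda>b. hcomp (0 - sh 0 ! b) (w $ b))"
  define \<psi> where "\<psi> = mat (length (sh 0)) 1 (\<lambda>(b, j). u $ b)"
  have g\<psi>: "graded_mat (sh 0) [0] \<psi>" by (auto simp: graded_mat_def \<psi>_def u_def)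
  have c\<psi>: "\<psi> \<in> carrier_mat (length (sh 0)) 1" by (simp add: \<psi>_def)
  define q where "q = (D 0 * \<psi>) $$ (0, 0)"
  have "col \<psi> 0 = u" by (auto simp: \<psi>_def u_def)
  hence "q = (D 0 *\<^sub>v u) $ 0" using c0 c\<psi> by (simp add: q_def)
  also have "\<dots> = hcomp 0 ((D 0 *\<^sub>v w) $ 0)"
    unfolding u_def graded_lift_vec[OF g0 w(1), of 0] by simp
  finally have "1 - q = hcomp 0 (1 - (D 0 *\<^sub>v w) $ 0)"
    by (simp only: poly_filter_diff hcomp_homogeneous[OF homogeneous_1])
  hence q: "1 - q \<in> ?I" using sqfree_ideal_poly_filter[OF w(2), of "\<lambda>m. int (mon_deg m) = 0"] by (simp only:)
  have cq: "D 0 * \<psi> \<in> carrier_mat 1 1" using c0 c\<psi> by simp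
  have q1: "((1\<^sub>m 1 - D 0 * \<psi>) *\<^sub>v v) $ 0 = v $ 0 * (1 - q)" if "v \<in> carrier_vec 1" for v
  proof -
    have "((1\<^sub>m 1 - D 0 * \<psi>) *\<^sub>v v) $ 0 = (1\<^sub>m 1 - D 0 * \<psi>) $$ (0, 0) * v $ 0"
      by (rule mult_mat_1_1[OF minus_carrier_mat[OF cq] that])
    also have "(1\<^sub>m 1 - D 0 * \<psi>) $$ (0, 0) = 1 - q" unfolding q_def using c0 c\<psi> by simp
    finally show ?thesis by (simp add: mult.commute)
  qed
  obtain \<Phi> where \<Phi>: "\<Phi> 0 = D 0" "chain_map sh (\<lambda>i. D (Suc i)) L d \<Phi>"
    by (rule chain_map_exists[OF graded_resolution_imp_graded_complex[OF RF] G, of "D 0"])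
       (use g0 c0 in \<open>auto simp: L0 Z_def ideal_vec_def\<close>)
  have p0: "\<psi> *\<^sub>v z \<in> Z" if z: "z \<in> ideal_vec ?I" for z
  proof -
    have zc: "z \<in> carrier_vec 1" "z $ 0 \<in> ?I" using z by (auto simp: ideal_vec_def)
    have "D 0 *\<^sub>v (\<psi> *\<^sub>v z) = (D 0 * \<psi>) *\<^sub>v z"
      by (rule assoc_mult_mat_vec[OF c0 c\<psi>, symmetric]) (use zc in simp)
    hence "(D 0 *\<^sub>v (\<psi> *\<^sub>v z)) $ 0 = q * z $ 0" using mult_mat_1_1[OF cq zc(1)] by (simp add: q_def)
    thus ?thesis using zc c\<psi> by (simp add: Z_def sqfree_ideal_mult)
  qed
  obtain \<Psi> where \<Psi>: "\<Psi> 0 = \<psi>" "chain_map L d sh (\<lambda>i. D (Suc i)) \<Psi>"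
    by (rule chain_map_exists[OF graded_resolution_imp_graded_complex[OF G] RF, of \<psi>]) (use g\<psi> p0 in \<open>auto simp: L0\<close>)
  have g\<Phi>: "graded_mat (L i) (sh i) (\<Phi> i)" and g\<Psi>: "graded_mat (sh i) (L i) (\<Psi> i)" for i
    using \<Phi> \<Psi> by (auto simp: chain_map_def)
  show "set (sh i) \<subseteq> set (L i)"
  proof (rule shifts_subset[OF RF minF chain_map_comp[OF gF gG gF \<Phi>(2) \<Psi>(2)] _ refl g\<Psi> g\<Phi>])
    fix v :: "('v, 'k) mpoly vec" assume v: "v \<in> carrier_vec (length (sh 0))"
    let ?n = "length (sh 0)"
    have cP: "\<psi> * D 0 \<in> carrier_mat ?n ?n" using c0 c\<psi> by simp
    have cDv: "D 0 *\<^sub>v v \<in> carrier_vec 1" using c0 v by simp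
    have "D 0 *\<^sub>v ((1\<^sub>m ?n - \<psi> * D 0) *\<^sub>v v) = D 0 *\<^sub>v (v - (\<psi> * D 0) *\<^sub>v v)"
      using minus_mult_distrib_mat_vec[OF one_carrier_mat cP v] v by simp
    also have "\<dots> = D 0 *\<^sub>v v - D 0 *\<^sub>v ((\<psi> * D 0) *\<^sub>v v)"
      by (rule mult_minus_distrib_mat_vec[OF c0 v]) (use cP v in simp)
    also have "(\<psi> * D 0) *\<^sub>v v = \<psi> *\<^sub>v (D 0 *\<^sub>v v)" by (rule assoc_mult_mat_vec[OF c\<psi> c0 v])
    also have "D 0 *\<^sub>v \<dots> = (D 0 * \<psi>) *\<^sub>v (D 0 *\<^sub>v v)"
      by (rule assoc_mult_mat_vec[OF c0 c\<psi>, symmetric]) (use cDv in simp)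
    also have "D 0 *\<^sub>v v - \<dots> = (1\<^sub>m 1 - D 0 * \<psi>) *\<^sub>v (D 0 *\<^sub>v v)"
      using minus_mult_distrib_mat_vec[OF one_carrier_mat cq cDv] cDv by simp
    finally have "(D 0 *\<^sub>v ((1\<^sub>m ?n - \<psi> * D 0) *\<^sub>v v)) $ 0 \<in> ?I"
      using q1[OF cDv] q by (simp add: sqfree_ideal_mult)
    moreover have "(1\<^sub>m ?n - \<psi> * D 0) *\<^sub>v v \<in> carrier_vec ?n"
      by (rule mult_mat_vec_carrier[OF minus_carrier_mat[OF cP] v])
    ultimately show "(1\<^sub>m ?n - \<Psi> 0 * \<Phi> 0) *\<^sub>v v \<in> Z" by (simp add: Z_def \<Phi>(1) \<Psi>(1))
  qed
  show "set (L i) \<subseteq> set (sh i)" if min: "\<And>i. irr_mat (d i)"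
  proof (rule shifts_subset[OF G min chain_map_comp[OF gG gF gG \<Psi>(2) \<Phi>(2)] _ refl g\<Phi> g\<Psi>])
    fix v :: "('v, 'k) mpoly vec" assume "v \<in> carrier_vec (length (L 0))"
    hence v: "v \<in> carrier_vec 1" by (simp add: L0)
    have "(1\<^sub>m 1 - D 0 * \<psi>) *\<^sub>v v \<in> carrier_vec 1"
      by (rule mult_mat_vec_carrier[OF minus_carrier_mat[OF cq] v])
    hence "(1\<^sub>m 1 - D 0 * \<psi>) *\<^sub>v v \<in> ideal_vec ?I"
      using q1[OF v] q by (simp add: ideal_vec_def sqfree_ideal_mult)
    thus "(1\<^sub>m (length (L 0)) - \<Phi> 0 * \<Psi> 0) *\<^sub>v v \<in> ideal_vec ?I" by (simp add: L0 \<Phi>(1) \<Psi>(1))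
  qed
qed

subsection \<open>Adding one generator\<close>

lemma sqfree_ideal_insert:
  "sqfree_ideal (insert W \<A>) = {p + q * sqfree_monom W | p q. p \<in> (sqfree_ideal \<A> :: ('v::finite, 'k::field) mpoly set)}"
proof -
  have "ideal.span (insert (sqfree_monom W) (sqfree_monom ` \<A>)) =
      {x. \<exists>k. x - k * sqfree_monom W \<in> ideal.span (sqfree_monom ` \<A> :: ('v, 'k) mpoly set)}"
    by (rule ideal.span_insert)
  also have "\<dots> = {p + q * sqfree_monom W | p q. p \<in> ideal.span (sqfree_monom ` \<A>)}"
  proof (intro equalityI subsetI)
    fix x :: "('v, 'k) mpoly" assume "x \<in> {x. \<exists>k. x - k * sqfree_monom W \<in> ideal.span (sqfree_monom ` \<A>)}"
    then obtain k where "x - k * sqfree_monom W \<in> ideal.span (sqfree_monom ` \<A>)" by blast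
    moreover have "x = (x - k * sqfree_monom W) + k * sqfree_monom W" by simp
    ultimately show "x \<in> {p + q * sqfree_monom W | p q. p \<in> ideal.span (sqfree_monom ` \<A>)}" by blast
  next
    fix x :: "('v, 'k) mpoly" assume "x \<in> {p + q * sqfree_monom W | p q. p \<in> ideal.span (sqfree_monom ` \<A>)}"
    then obtain p q where "x = p + q * sqfree_monom W" "p \<in> ideal.span (sqfree_monom ` \<A>)" by blast
    hence "x - q * sqfree_monom W \<in> ideal.span (sqfree_monom ` \<A>)" by simp
    thus "x \<in> {x. \<exists>k. x - k * sqfree_monom W \<in> ideal.span (sqfree_monom ` \<A>)}" by blast
  qed
  finally show ?thesis by (simp add: sqfree_ideal_eq_span[symmetric])
qed

lemma graded_resolution_shift: "graded_resolution Z L D \<Longrightarrow> graded_resolution Z (\<lambda>i. map ((+) d) (L i)) D"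
  by (simp add: graded_resolution_def graded_mat_shift)

definition monom_mat :: "'v set \<Rightarrow> ('v, 'k::field) mpoly mat" where
  "monom_mat W = mat 1 1 (\<lambda>_. sqfree_monom W)"

lemma monom_mat_carrier: "monom_mat W \<in> carrier_mat 1 1"
  by (simp add: monom_mat_def)

lemma monom_mat_mult: "v \<in> carrier_vec 1 \<Longrightarrow> (monom_mat W *\<^sub>v v) $ 0 = sqfree_monom W * v $ 0"
  by (subst mult_mat_1_1[OF monom_mat_carrier]) (simp_all add: monom_mat_def)

lemma monom_mat_ideal_vec:
  fixes b :: "('v::finite, 'k::field) mpoly vec"
  assumes b: "b \<in> carrier_vec 1"
  shows "monom_mat W *\<^sub>v b \<in> ideal_vec (sqfree_ideal \<A>) \<longleftrightarrow> b \<in> ideal_vec (sqfree_ideal ((\<lambda>V. V - W) ` \<A>))"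
  unfolding ideal_vec_def mem_Collect_eq monom_mat_mult[OF b] sqfree_ideal_colon
  using b mult_mat_vec_carrier[OF monom_mat_carrier b] by blast

text \<open>Multiplication by \<open>sqfree_monom W\<close> induces an injective map from the quotient by the colon ideal to the
quotient by the ideal of \<open>\<A>\<close>. Its cokernel is the quotient by the ideal of \<open>insert W \<A>\<close>.\<close>

lemma cone_monom:
  fixes DA DB :: "nat \<Rightarrow> ('v::finite, 'k::field) mpoly mat"
  assumes A: "graded_resolution (ideal_vec (sqfree_ideal \<A>)) LA DA"
    and B: "graded_resolution (ideal_vec (sqfree_ideal ((\<lambda>V. V - W) ` \<A>))) LB DB" and LB0: "length (LB 0) = 1"
    and ch: "chain_map LB DB LA DA \<phi>" and ph0: "\<phi> 0 = monom_mat W"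
  shows "graded_resolution (ideal_vec (sqfree_ideal (insert W \<A>))) (mapping_cone.LC LA LB) (mapping_cone.DC LA DA LB DB \<phi>)"
    and "mapping_cone (ideal_vec (sqfree_ideal \<A>)) LA DA (ideal_vec (sqfree_ideal ((\<lambda>V. V - W) ` \<A>))) LB DB \<phi>"
proof -
  show mc: "mapping_cone (ideal_vec (sqfree_ideal \<A>)) LA DA (ideal_vec (sqfree_ideal ((\<lambda>V. V - W) ` \<A>))) LB DB \<phi>"
    by unfold_locales (use A B ch ph0 LB0 monom_mat_ideal_vec in auto)
  interpret mapping_cone "ideal_vec (sqfree_ideal \<A>)" LA DA "ideal_vec (sqfree_ideal ((\<lambda>V. V - W) ` \<A>))" LB DB \<phi>
    by (rule mc)
  have "{x + \<phi> 0 *\<^sub>v b | x b. x \<in> ideal_vec (sqfree_ideal \<A>) \<and> b \<in> carrier_vec (length (LB 0))}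
      = ideal_vec (sqfree_ideal (insert W \<A>))"
  proof (intro equalityI subsetI)
    fix v assume "v \<in> {x + \<phi> 0 *\<^sub>v b | x b. x \<in> ideal_vec (sqfree_ideal \<A>) \<and> b \<in> carrier_vec (length (LB 0))}"
    then obtain x b where xb: "x \<in> ideal_vec (sqfree_ideal \<A>)" "b \<in> carrier_vec 1" "v = x + \<phi> 0 *\<^sub>v b"
      using LB0 by auto
    have c: "x \<in> carrier_vec 1" "monom_mat W *\<^sub>v b \<in> carrier_vec 1"
      using xb(1) mult_mat_vec_carrier[OF monom_mat_carrier xb(2)] by (auto simp: ideal_vec_def)
    have "v $ 0 = x $ 0 + (monom_mat W *\<^sub>v b) $ 0"
      unfolding xb(3) ph0 by (rule index_add_vec) (simp only: carrier_vecD[OF c(2)] zero_less_one)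
    hence "v $ 0 = x $ 0 + b $ 0 * sqfree_monom W" by (simp only: monom_mat_mult[OF xb(2)] mult.commute)
    moreover have "v \<in> carrier_vec 1" unfolding xb(3) ph0 by (rule add_carrier_vec[OF c])
    moreover have "x $ 0 \<in> sqfree_ideal \<A>" using xb(1) by (simp add: ideal_vec_def)
    ultimately show "v \<in> ideal_vec (sqfree_ideal (insert W \<A>))"
      unfolding sqfree_ideal_insert ideal_vec_def by blast
  next
    fix v :: "('v, 'k) mpoly vec" assume "v \<in> ideal_vec (sqfree_ideal (insert W \<A>))"
    then obtain p q where pq: "v \<in> carrier_vec 1" "v $ 0 = p + q * sqfree_monom W" "p \<in> sqfree_ideal \<A>"
      unfolding sqfree_ideal_insert by (auto simp: ideal_vec_def)
    have "v = vec 1 (\<lambda>_. p) + \<phi> 0 *\<^sub>v vec 1 (\<lambda>_. q)"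
      unfolding ph0 by (rule eq_vecI) (use pq in \<open>auto simp: scalar_prod_def mult.commute monom_mat_def\<close>)
    moreover have "vec 1 (\<lambda>_. p) \<in> ideal_vec (sqfree_ideal \<A>)" using pq by (simp add: ideal_vec_def)
    moreover have "vec 1 (\<lambda>_. q) \<in> carrier_vec (length (LB 0))" using LB0 by simp
    ultimately show "v \<in> {x + \<phi> 0 *\<^sub>v b | x b. x \<in> ideal_vec (sqfree_ideal \<A>) \<and> b \<in> carrier_vec (length (LB 0))}"
      by blast
  qed
  with cone_graded_resolution show "graded_resolution (ideal_vec (sqfree_ideal (insert W \<A>))) LC DC" by simp
qed

text \<open>An upper bound for the regularity is witnessed by any resolution, minimal or not. The lower bound \<open>i \<le> j\<close>
serves to make the set of the differences \<open>j - i\<close> finite.\<close>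

definition regularity_le :: "('v, 'k::field) mpoly set \<Rightarrow> nat \<Rightarrow> bool" where
  "regularity_le I r \<longleftrightarrow> (\<exists>L D. graded_resolution (ideal_vec I) L D \<and> L 0 = [0] \<and> (\<forall>i. \<forall>j\<in>set (L i). int i \<le> j \<and> j \<le> int (i + r)))"

lemma regularity_le_mono: "regularity_le I r \<Longrightarrow> r \<le> s \<Longrightarrow> regularity_le I s"
  unfolding regularity_le_def by (meson add_left_mono of_nat_mono order_trans)

lemma graded_resolution_zero: "graded_resolution (ideal_vec (sqfree_ideal {} :: ('v::finite, 'k::field) mpoly set)) (case_nat [0] (\<lambda>_. [])) (\<lambda>i. 0\<^sub>m (if i = 0 then 1 else 0) 0)"
proof -
  have "sqfree_ideal {} = {0 :: ('v, 'k) mpoly}"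
    by (auto simp: sqfree_ideal_def)
  moreover have "v = 0\<^sub>v 1" if "v \<in> carrier_vec 1" "v $ 0 = 0" for v :: "('v, 'k) mpoly vec"
    by (rule eq_vecI) (use that in simp_all)
  ultimately have z: "ideal_vec (sqfree_ideal {} :: ('v, 'k) mpoly set) = {0\<^sub>v 1}"
    unfolding ideal_vec_def by fastforce
  have c0: "carrier_vec 0 = {0\<^sub>v 0 :: ('v, 'k) mpoly vec}"
    by (intro equalityI subsetI) (auto intro: eq_vecI)
  have m: "0\<^sub>m r 0 *\<^sub>v 0\<^sub>v 0 = (0\<^sub>v r :: ('v, 'k) mpoly vec)" for r
    by (rule zero_mat_mult_vec) simp
  have i: "mat_image (0\<^sub>m r 0 :: ('v, 'k) mpoly mat) = {0\<^sub>v r}" for r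
    by (simp only: mat_image_def index_zero_mat c0 image_insert image_empty m)
  have k: "mat_kernel (0\<^sub>m r 0 :: ('v, 'k) mpoly mat) = {0\<^sub>v 0}" for r
    unfolding mat_kernel_def index_zero_mat c0 using m by blast
  show ?thesis unfolding graded_resolution_def
  proof (intro allI conjI)
    fix i
    show "graded_mat (case i of 0 \<Rightarrow> [0] | Suc _ \<Rightarrow> []) (case Suc i of 0 \<Rightarrow> [0] | Suc _ \<Rightarrow> [])
       (0\<^sub>m (if i = 0 then 1 else 0) 0 :: ('v, 'k) mpoly mat)"
      by (cases i) (auto simp: graded_mat_zero)
    show "mat_image (0\<^sub>m (if i = 0 then 1 else 0) 0) = cycles (ideal_vec (sqfree_ideal {} :: ('v, 'k) mpoly set)) (\<lambda>i. 0\<^sub>m (if i = 0 then 1 else 0) 0) i"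
      by (cases i) (auto simp: z i k)
  qed
qed

lemma regularity_le_empty: "regularity_le (sqfree_ideal {} :: ('v::finite, 'k::field) mpoly set) 0"
  unfolding regularity_le_def
  by (rule exI[of _ "case_nat [0] (\<lambda>_. [])"], rule exI, rule conjI[OF graded_resolution_zero]) (auto split: nat.splits)

text \<open>In the mapping cone a degree \<open>j\<close> in position \<open>i\<close> of the resolution of the colon ideal reappears as
\<open>j + card W\<close> in position \<open>i + 1\<close>.\<close>

theorem regularity_le_insert:
  fixes \<A> :: "'v::finite set set"
  assumes J: "regularity_le (sqfree_ideal \<A> :: ('v, 'k::field) mpoly set) r"
    and C: "regularity_le (sqfree_ideal ((\<lambda>V. V - W) ` \<A>) :: ('v, 'k) mpoly set) s"
    and W: "W \<noteq> {}" and rs: "s + card W \<le> r + 1"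
  shows "regularity_le (sqfree_ideal (insert W \<A>) :: ('v, 'k) mpoly set) r"
proof -
  obtain LA and DA :: "nat \<Rightarrow> ('v, 'k) mpoly mat" where A: "graded_resolution (ideal_vec (sqfree_ideal \<A>)) LA DA" "LA 0 = [0]"
    and bA: "\<And>i j. j \<in> set (LA i) \<Longrightarrow> int i \<le> j \<and> j \<le> int (i + r)"
    using J unfolding regularity_le_def by blast
  obtain LB and DB :: "nat \<Rightarrow> ('v, 'k) mpoly mat"
    where B: "graded_resolution (ideal_vec (sqfree_ideal ((\<lambda>V. V - W) ` \<A>))) LB DB" "LB 0 = [0]"
    and bB: "\<And>i j. j \<in> set (LB i) \<Longrightarrow> int i \<le> j \<and> j \<le> int (i + s)"
    using C unfolding regularity_le_def by blast
  define d where "d = int (card W)"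
  have d1: "d \<ge> 1" using W by (simp add: d_def card_gt_0_iff Suc_le_eq)
  define LB' where "LB' = (\<lambda>i. map ((+) d) (LB i))"
  have B': "graded_resolution (ideal_vec (sqfree_ideal ((\<lambda>V. V - W) ` \<A>))) LB' DB"
    unfolding LB'_def by (rule graded_resolution_shift[OF B(1)])
  have l0: "length (LB' 0) = 1" by (simp add: LB'_def B)
  have "graded_mat (LA 0) (LB' 0) (monom_mat W :: ('v, 'k) mpoly mat)"
    using homogeneous_sqfree_monom[of W] by (simp add: graded_mat_def monom_mat_def LB'_def A B d_def)
  moreover have "\<forall>z\<in>ideal_vec (sqfree_ideal ((\<lambda>V. V - W) ` \<A>)).
      monom_mat W *\<^sub>v z \<in> ideal_vec (sqfree_ideal \<A> :: ('v, 'k) mpoly set)"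
    using monom_mat_ideal_vec by (auto simp: ideal_vec_def)
  ultimately obtain \<phi> where \<phi>: "\<phi> 0 = (monom_mat W :: ('v, 'k) mpoly mat)" "chain_map LB' DB LA DA \<phi>"
    by (rule chain_map_exists[OF graded_resolution_imp_graded_complex[OF B'] A(1)])
  note cm = cone_monom[OF A(1) B' l0 \<phi>(2,1)]
  interpret mapping_cone "ideal_vec (sqfree_ideal \<A>)" LA DA "ideal_vec (sqfree_ideal ((\<lambda>V. V - W) ` \<A>))" LB' DB \<phi>
    by (rule cm(2))
  have "LC 0 = [0]" using \<open>LA 0 = [0]\<close> by (simp add: LC_def)
  moreover have "int i \<le> j \<and> j \<le> int (i + r)" if j: "j \<in> set (LC i)" for i j
  proof (cases "j \<in> set (LA i)")
    case True thus ?thesis by (rule bA)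
  next
    case False
    then obtain k where k: "i = Suc k" "j \<in> set (LB' k)" using j by (cases i) (auto simp: LC_def)
    then obtain j' where "j = d + j'" "j' \<in> set (LB k)" by (auto simp: LB'_def)
    thus ?thesis using bB[of j' k] d1 rs k by (auto simp: d_def)
  qed
  ultimately show ?thesis using cm(1) unfolding regularity_le_def by blast
qed

section \<open>Restriction to a set of variables\<close>

lemma chain_map_restrict:
  fixes D :: "nat \<Rightarrow> ('v::finite, 'k::field) mpoly mat"
  assumes D: "\<And>i. graded_mat (L i) (L (Suc i)) (D i)" and D': "\<And>i. graded_mat (L' i) (L' (Suc i)) (D' i)"
    and \<Phi>: "chain_map L D L' D' \<Phi>"
  shows "chain_map L (\<lambda>i. map_mat (poly_filter (supp_in U)) (D i)) L' (\<lambda>i. map_mat (poly_filter (supp_in U)) (D' i))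
           (\<lambda>i. map_mat (poly_filter (supp_in U)) (\<Phi> i))"
proof -
  have g: "graded_mat (L' i) (L i) (\<Phi> i)" and com: "\<Phi> i * D i = D' i * \<Phi> (Suc i)" for i
    using \<Phi> by (auto simp: chain_map_def)
  have "map_mat (poly_filter (supp_in U)) (\<Phi> i) * map_mat (poly_filter (supp_in U)) (D i)
      = map_mat (poly_filter (supp_in U)) (D' i) * map_mat (poly_filter (supp_in U)) (\<Phi> (Suc i))" for i
    using restrict.mat_hom_mult[OF graded_matD[OF g] graded_matD[OF D], of U i]
      restrict.mat_hom_mult[OF graded_matD[OF D'] graded_matD[OF g], of U i] com by simp
  moreover have "graded_mat (L' i) (L i) (map_mat (poly_filter (supp_in U)) (\<Phi> i))" for i
    using g[of i] by (auto simp: graded_mat_def homogeneous_def)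
  ultimately show ?thesis by (simp add: chain_map_def)
qed

text \<open>Deleting the variables outside \<open>U\<close> destroys exactness in general, but the result is still a complex over the
quotient by the restricted ideal; that is all that a source of a chain map has to satisfy.\<close>

lemma graded_complex_restrict:
  fixes D :: "nat \<Rightarrow> ('v::finite, 'k::field) mpoly mat"
  assumes G: "graded_complex (ideal_vec (sqfree_ideal \<A>)) L D" and L0: "L 0 = [0]"
    and sub: "\<And>W. W \<in> \<A> \<Longrightarrow> W \<subseteq> U \<Longrightarrow> \<exists>V\<in>\<B>. V \<subseteq> W"
  shows "graded_complex (ideal_vec (sqfree_ideal \<B>)) L (\<lambda>i. map_mat (poly_filter (supp_in U)) (D i))"
proof -
  have g: "graded_mat (L i) (L (Suc i)) (D i)" for i using G by (rule graded_complex_graded)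
  note c = graded_matD[OF g]
  let ?D = "\<lambda>i. map_mat (poly_filter (supp_in U)) (D i)"
  have g': "graded_mat (L i) (L (Suc i)) (?D i)" for i
    using g[of i] by (auto simp: graded_mat_def homogeneous_def)
  note c' = graded_matD[OF g']
  have res: "poly_filter (supp_in U) p \<in> sqfree_ideal \<B>" if p: "p \<in> sqfree_ideal \<A>" for p :: "('v, 'k) mpoly"
    unfolding sqfree_ideal_def
  proof (intro CollectI ballI)
    fix m assume "m \<in> Poly_Mapping.keys (poly_filter (supp_in U) p)"
    hence m: "m \<in> Poly_Mapping.keys p" "Poly_Mapping.keys m \<subseteq> U" by (auto simp: supp_in_def)
    then obtain W where W: "W \<in> \<A>" "W \<subseteq> Poly_Mapping.keys m" using p by (auto simp: sqfree_ideal_def)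
    thus "\<exists>W\<in>\<B>. W \<subseteq> Poly_Mapping.keys m" using sub[of W] m(2) by (meson order_trans)
  qed
  have "?D i *\<^sub>v w \<in> cycles (ideal_vec (sqfree_ideal \<B>)) ?D i" if w: "w \<in> carrier_vec (length (L (Suc i)))" for i w
  proof (cases i)
    case 0
    have e: "D 0 $$ (0, k) \<in> sqfree_ideal \<A>" if k: "k < length (L 1)" for k
    proof -
      have "D 0 *\<^sub>v unit_vec (length (L 1)) k \<in> ideal_vec (sqfree_ideal \<A>)"
        using graded_complex_mat_image[OF G, of "unit_vec (length (L 1)) k" 0] by simp
      hence "col (D 0) k $ 0 \<in> sqfree_ideal \<A>"
        using mult_mat_unit_vec[OF c[of 0], of k] k by (simp add: ideal_vec_def)
      thus ?thesis using c[of 0] k L0 by simp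
    qed
    have "(?D 0 *\<^sub>v w) $ 0 = (\<Sum>k\<in>{0..<length (L 1)}. w $ k * poly_filter (supp_in U) (D 0 $$ (0, k)))"
      using c[of 0] w L0 0 by (simp add: scalar_prod_def mult.commute)
    also have "\<dots> \<in> sqfree_ideal \<B>"
    proof -
      have "(\<Sum>k\<in>K. w $ k * poly_filter (supp_in U) (D 0 $$ (0, k))) \<in> sqfree_ideal \<B>"
        if "finite K" "K \<subseteq> {0..<length (L 1)}" for K
        using that
        by (induction K rule: finite_induct)
           (auto intro!: sqfree_ideal_zero sqfree_ideal_add sqfree_ideal_mult res e)
      thus ?thesis by simp
    qed
    finally show ?thesis using 0 L0 mult_mat_vec_carrier[OF c'[of 0], of w] w by (simp add: ideal_vec_def)
  next
    case (Suc j)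
    have "?D j *\<^sub>v (?D i *\<^sub>v w) = (?D j * ?D i) *\<^sub>v w"
      using assoc_mult_mat_vec[OF c'[of j] c'[of "Suc j"]] w Suc by simp
    also have "?D j * ?D i = map_mat (poly_filter (supp_in U)) (D j * D i)"
      using restrict.mat_hom_mult[OF c[of j] c[of "Suc j"], of U] Suc by simp
    also have "D j * D i = 0\<^sub>m (length (L j)) (length (L (Suc i)))" using graded_complex_comp[OF G, of j] Suc by simp
    also have "map_mat (poly_filter (supp_in U)) \<dots> = 0\<^sub>m (length (L j)) (length (L (Suc i)))" by auto
    also have "\<dots> *\<^sub>v w = 0\<^sub>v (length (L j))" using w by (rule zero_mat_mult_vec)
    finally show ?thesis using Suc mult_mat_vec_carrier[OF c'[of i] w] by (simp add: mat_kernel_iff[OF c'[of j]])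
  qed
  note im = this
  have "mat_image (?D i) \<subseteq> cycles (ideal_vec (sqfree_ideal \<B>)) ?D i" for i
  proof
    fix x assume "x \<in> mat_image (?D i)"
    then obtain w where "w \<in> carrier_vec (length (L (Suc i)))" "x = ?D i *\<^sub>v w"
      using mat_image_iff[OF c'[of i]] by blast
    thus "x \<in> cycles (ideal_vec (sqfree_ideal \<B>)) ?D i" using im by simp
  qed
  thus ?thesis using g' unfolding graded_complex_def by blast
qed

text \<open>Let \<open>\<B>\<close> generate the restriction of the ideal of \<open>\<A>\<close> to the variables in \<open>U\<close>. The inclusion of the ideals
lifts to a chain map \<open>\<alpha>\<close> from \<open>M\<close> to \<open>L\<close>, and the identity of \<open>S\<close> lifts to a chain map \<open>\<beta>\<close> from the restriction of \<open>L\<close>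
to \<open>M\<close>. As \<open>M\<close> is invariant under restriction, the composite of \<open>\<beta>\<close> with the restriction of \<open>\<alpha>\<close> is a chain map of \<open>M\<close>
over the identity that factors through \<open>L\<close>.\<close>

theorem restriction_shifts:
  fixes D d :: "nat \<Rightarrow> ('v::finite, 'k::field) mpoly mat"
  assumes G: "graded_resolution (ideal_vec (sqfree_ideal \<A>)) L D" and L0: "L 0 = [0]"
    and K: "graded_resolution (ideal_vec (sqfree_ideal \<B>)) M d" and M0: "M 0 = [0]"
    and min: "\<And>i. irr_mat (d i)" and fix_d: "\<And>i. map_mat (poly_filter (supp_in U)) (d i) = d i"
    and BA: "\<B> \<subseteq> \<A>" and AB: "\<And>W. W \<in> \<A> \<Longrightarrow> W \<subseteq> U \<Longrightarrow> \<exists>V\<in>\<B>. V \<subseteq> W"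
  shows "set (M i) \<subseteq> set (L i)"
proof -
  let ?\<pi> = "map_mat (poly_filter (supp_in U)) :: ('v, 'k) mpoly mat \<Rightarrow> _"
  have gG: "graded_mat (L i) (L (Suc i)) (D i)" for i using G by (simp add: graded_resolution_def)
  have gK: "graded_mat (M i) (M (Suc i)) (d i)" for i using K by (simp add: graded_resolution_def)
  have one: "graded_mat [0] [0] (1\<^sub>m 1 :: ('v, 'k) mpoly mat)" using graded_mat_one[of "[0]"] by simp
  have "sqfree_ideal \<B> \<subseteq> (sqfree_ideal \<A> :: ('v, 'k) mpoly set)"
    by (rule sqfree_ideal_mono) (use BA in auto)
  hence z1: "\<forall>z\<in>ideal_vec (sqfree_ideal \<B>). 1\<^sub>m 1 *\<^sub>v z \<in> (ideal_vec (sqfree_ideal \<A>) :: ('v, 'k) mpoly vec set)"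
    by (auto simp: ideal_vec_def)
  obtain \<alpha> where \<alpha>: "\<alpha> 0 = (1\<^sub>m 1 :: ('v, 'k) mpoly mat)" "chain_map M d L D \<alpha>"
    by (rule chain_map_exists[OF graded_resolution_imp_graded_complex[OF K] G _ z1]) (use one in \<open>auto simp: L0 M0\<close>)
  have pG: "graded_complex (ideal_vec (sqfree_ideal \<B>)) L (\<lambda>i. ?\<pi> (D i))"
    by (rule graded_complex_restrict[OF graded_resolution_imp_graded_complex[OF G] L0 AB])
  have z2: "\<forall>z\<in>ideal_vec (sqfree_ideal \<B>). 1\<^sub>m 1 *\<^sub>v z \<in> (ideal_vec (sqfree_ideal \<B>) :: ('v, 'k) mpoly vec set)"
    by (auto simp: ideal_vec_def)
  obtain \<beta> where \<beta>: "\<beta> 0 = (1\<^sub>m 1 :: ('v, 'k) mpoly mat)" "chain_map L (\<lambda>i. ?\<pi> (D i)) M d \<beta>"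
    by (rule chain_map_exists[OF pG K _ z2]) (use one in \<open>auto simp: L0 M0\<close>)
  have p\<alpha>: "chain_map M d L (\<lambda>i. ?\<pi> (D i)) (\<lambda>i. ?\<pi> (\<alpha> i))"
    using chain_map_restrict[OF gK gG \<alpha>(2), of U] by (simp add: fix_d)
  note gpG = graded_complex_graded[OF pG]
  have g\<beta>: "graded_mat (M i) (L i) (\<beta> i)" and gp\<alpha>: "graded_mat (L i) (M i) (?\<pi> (\<alpha> i))" for i
    using \<beta>(2) p\<alpha> by (auto simp: chain_map_def)
  show ?thesis
  proof (rule shifts_subset[OF K min chain_map_comp[OF gK gpG gK p\<alpha> \<beta>(2)] _ refl g\<beta> gp\<alpha>])
    fix v :: "('v, 'k) mpoly vec" assume v: "v \<in> carrier_vec (length (M 0))"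
    have "?\<pi> (1\<^sub>m 1) = 1\<^sub>m 1" by (rule restrict.mat_hom_one)
    hence "\<beta> 0 * ?\<pi> (\<alpha> 0) = 1\<^sub>m 1" by (simp add: \<alpha>(1) \<beta>(1))
    moreover have "1\<^sub>m 1 - 1\<^sub>m 1 = (0\<^sub>m 1 1 :: ('v, 'k) mpoly mat)" by auto
    moreover have "length (M 0) = 1" by (simp add: M0)
    ultimately have "(1\<^sub>m (length (M 0)) - \<beta> 0 * ?\<pi> (\<alpha> 0)) *\<^sub>v v = 0\<^sub>v 1"
      using zero_mat_mult_vec[of v 1 1] v by (simp only:)
    thus "(1\<^sub>m (length (M 0)) - \<beta> 0 * ?\<pi> (\<alpha> 0)) *\<^sub>v v \<in> ideal_vec (sqfree_ideal \<B>)"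
      by (simp add: ideal_vec_def sqfree_ideal_zero)
  qed
qed

subsection \<open>The Koszul complex of monomials with disjoint supports\<close>

lemma sqfree_monom_irr: "W \<noteq> {} \<Longrightarrow> (sqfree_monom W :: ('v::finite, 'k::field) mpoly) \<in> irrelevant_ideal"
proof -
  assume "W \<noteq> {}"
  hence "ind_exp W \<noteq> 0" by (metis keys_ind_exp keys_zero)
  thus ?thesis by (simp add: irrelevant_ideal_iff sqfree_monom_eq lookup_single when_def)
qed

text \<open>Monomials with disjoint supports form a regular sequence: the colon ideal in each step is the ideal itself, and
multiplication by the new monomial on the resolution obtained so far is a chain map with entries in the irrelevant
ideal. The iterated cone is thus minimal, and its last module has a basis element whose degree is the sum of the
degrees of the monomials.\<close>

lemma koszul_resolution:
  fixes \<B> :: "'v::finite set set"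
  assumes "finite \<B>" and "pairwise disjnt \<B>" and "\<And>W. W \<in> \<B> \<Longrightarrow> W \<noteq> {} \<and> W \<subseteq> U"
  shows "\<exists>M (d :: nat \<Rightarrow> ('v, 'k::field) mpoly mat). graded_resolution (ideal_vec (sqfree_ideal \<B>)) M d \<and> M 0 = [0] \<and>
     (\<forall>i. irr_mat (d i)) \<and> (\<forall>i. map_mat (poly_filter (supp_in U)) (d i) = d i) \<and>
     (\<Sum>W\<in>\<B>. int (card W)) \<in> set (M (card \<B>))"
  using assms
proof (induction \<B> rule: finite_induct)
  case empty
  show ?case
    by (rule exI[of _ "case_nat [0] (\<lambda>_. [])"], rule exI, rule conjI[OF graded_resolution_zero]) (auto simp: irr_mat_def)
next
  case (insert W \<B>)
  then obtain M and d :: "nat \<Rightarrow> ('v, 'k) mpoly mat" where K: "graded_resolution (ideal_vec (sqfree_ideal \<B>)) M d" "M 0 = [0]"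
    and irr: "\<And>i. irr_mat (d i)" and fix_d: "\<And>i. map_mat (poly_filter (supp_in U)) (d i) = d i"
    and top: "(\<Sum>W\<in>\<B>. int (card W)) \<in> set (M (card \<B>))"
    by (auto simp: pairwise_insert)
  have W: "W \<noteq> {}" "W \<subseteq> U" using insert.prems by auto
  have "V - W = V" if "V \<in> \<B>" for V
    using insert.prems(1) insert.hyps(2) that by (auto simp: pairwise_insert disjnt_def)
  hence colon: "(\<lambda>V. V - W) ` \<B> = \<B>" by simp
  define e where "e = int (card W)"
  define M' where "M' = (\<lambda>i. map ((+) e) (M i))"
  have K': "graded_resolution (ideal_vec (sqfree_ideal ((\<lambda>V. V - W) ` \<B>))) M' d"
    unfolding M'_def colon by (rule graded_resolution_shift[OF K(1)])
  define \<phi> where "\<phi> = (\<lambda>i. (sqfree_monom W :: ('v, 'k) mpoly) \<cdot>\<^sub>m 1\<^sub>m (length (M i)))"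
  have gd: "graded_mat (M i) (M (Suc i)) (d i)" for i using K(1) by (simp add: graded_resolution_def)
  have ch: "chain_map M' d M d \<phi>"
    unfolding chain_map_def
  proof (intro allI conjI)
    fix i
    show "graded_mat (M i) (M' i) (\<phi> i)"
      using homogeneous_sqfree_monom[of W] by (auto simp: graded_mat_def \<phi>_def M'_def e_def)
    show "\<phi> i * d i = d i * \<phi> (Suc i)"
      unfolding \<phi>_def using graded_matD[OF gd[of i]]
      by (simp add: mult_smult_assoc_mat[OF one_carrier_mat] mult_smult_distrib[OF _ one_carrier_mat])
  qed
  have \<phi>0: "\<phi> 0 = monom_mat W" unfolding \<phi>_def monom_mat_def by (rule eq_matI) (auto simp: K)
  have l0: "length (M' 0) = 1" by (simp add: M'_def K)
  note cm = cone_monom[OF K(1) K' l0 ch \<phi>0]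
  interpret mapping_cone "ideal_vec (sqfree_ideal \<B>)" M d "ideal_vec (sqfree_ideal ((\<lambda>V. V - W) ` \<B>))" M' d \<phi>
    by (rule cm(2))
  have "irr_mat (DC i)" for i
    by (rule cone_irr) (use irr sqfree_monom_irr[OF W(1)] in \<open>auto simp: irr_mat_def \<phi>_def\<close>)
  moreover have "map_mat (poly_filter (supp_in U)) (DC i) = DC i" for i
  proof -
    have fW: "poly_filter (supp_in U) (sqfree_monom W) = (sqfree_monom W :: ('v, 'k) mpoly)"
      by (rule poly_filter_id) (use W(2) in \<open>auto simp: sqfree_monom_eq supp_in_def\<close>)
    have f1: "map_mat (poly_filter (supp_in U)) (\<phi> i) = \<phi> i"
      by (rule eq_matI) (auto simp: \<phi>_def fW)
    have f2: "map_mat (poly_filter (supp_in U)) (NB i) = NB i"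
    proof (cases i)
      case (Suc j)
      have "poly_filter (supp_in U) (- (d j $$ (a, b))) = - (d j $$ (a, b))" if "a < dim_row (d j)" "b < dim_col (d j)" for a b
        using arg_cong[OF fix_d[of j], of "\<lambda>A. A $$ (a, b)"] that by (simp add: restrict.hom_uminus)
      thus ?thesis unfolding Suc by (auto intro!: eq_matI)
    qed (auto intro!: eq_matI)
    have f: "poly_filter (supp_in U) (A $$ (a, b)) = A $$ (a, b)"
      if "map_mat (poly_filter (supp_in U)) A = A" "a < dim_row A" "b < dim_col A" for A :: "('v, 'k) mpoly mat" and a b
      using index_map_mat(1)[OF that(2,3), of "poly_filter (supp_in U)"] unfolding that(1) by simp
    show ?thesis unfolding DC_def
      by (rule eq_matI) (use cA[of i] cphi[of i] cN[of i] f[OF f1] f[OF f2] f[OF fix_d[of i]] in auto)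
  qed
  moreover have "(\<Sum>V\<in>insert W \<B>. int (card V)) \<in> set (LC (card (insert W \<B>)))"
  proof -
    have "card (insert W \<B>) = Suc (card \<B>)" using insert.hyps by simp
    hence "LC (card (insert W \<B>)) = M (card (insert W \<B>)) @ M' (card \<B>)"
      by (simp only: LC_def QB.simps)
    moreover have "e + (\<Sum>V\<in>\<B>. int (card V)) \<in> set (M' (card \<B>))"
      using top by (simp add: M'_def)
    moreover have "(\<Sum>V\<in>insert W \<B>. int (card V)) = e + (\<Sum>V\<in>\<B>. int (card V))"
      using insert.hyps by (simp add: e_def)
    ultimately show ?thesis by (simp only: set_append Un_iff simp_thms)
  qed
  moreover have "LC 0 = [0]" using \<open>M 0 = [0]\<close> by (simp add: LC_def)
  ultimately show ?case using cm(1) by blast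
qed

section \<open>Regularity from an upper bound and an induced matching\<close>

text \<open>The family \<open>\<M>\<close> generalizes an induced matching of a graph: it generates the restriction of the ideal to its own
variables. By \<open>restriction_shifts\<close> the top degree of its Koszul resolution occurs in position \<open>card \<M>\<close> of every
resolution, while all degrees of a minimal resolution occur in the one that witnesses the upper bound.\<close>

theorem regularity_eqI:
  fixes \<A> \<M> :: "'v::finite set set"
  assumes ub: "regularity_le (sqfree_ideal \<A> :: ('v, 'k::field) mpoly set) r" and ne: "{} \<notin> \<A>"
    and M: "\<M> \<subseteq> \<A>" "pairwise disjnt \<M>"
    and ind: "\<And>W. W \<in> \<A> \<Longrightarrow> W \<subseteq> \<Union>\<M> \<Longrightarrow> \<exists>V\<in>\<M>. V \<subseteq> W"
    and r: "(\<Sum>W\<in>\<M>. card W) = card \<M> + r"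
  shows "regularity_quot (sqfree_ideal \<A> :: ('v, 'k) mpoly set) = int r"
proof -
  let ?I = "sqfree_ideal \<A> :: ('v, 'k) mpoly set"
  obtain LG and DG :: "nat \<Rightarrow> ('v, 'k) mpoly mat" where G: "graded_resolution (ideal_vec ?I) LG DG" "LG 0 = [0]"
    and bG: "\<And>i j. j \<in> set (LG i) \<Longrightarrow> int i \<le> j \<and> j \<le> int (i + r)"
    using ub unfolding regularity_le_def by blast
  have "?I \<subseteq> irrelevant_ideal"
  proof
    fix p assume p: "p \<in> ?I"
    hence "0 \<notin> Poly_Mapping.keys p" using ne by (auto simp: sqfree_ideal_def)
    thus "p \<in> irrelevant_ideal" by (simp add: irrelevant_ideal_iff in_keys_iff)
  qed
  hence "z $ k \<in> irrelevant_ideal" if "z \<in> ideal_vec ?I" "k < dim_vec z" for z k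
    using that by (auto simp: ideal_vec_def)
  then obtain L D where R: "graded_resolution (ideal_vec ?I) L D" "L 0 = LG 0" and irr: "\<And>i. irr_mat (D i)"
    using minimal_graded_resolution_exists[OF G(1)] by blast
  have L0: "L 0 = [0]" using R(2) G(2) by simp
  define sh where "sh = (SOME sh. \<exists>D. minimal_graded_free_resolution ?I sh D)"
  have "\<exists>D. minimal_graded_free_resolution ?I L D"
    using graded_resolution_imp_minimal_resolution[OF R(1) L0 sqfree_ideal_zero irr] by blast
  hence "\<exists>D. minimal_graded_free_resolution ?I sh D" unfolding sh_def by (rule someI[of "\<lambda>sh. \<exists>D. minimal_graded_free_resolution ?I sh D"])
  then obtain D' where F: "minimal_graded_free_resolution ?I sh D'" by blast
  have up: "int i \<le> j \<and> j \<le> int (i + r)" if "j \<in> set (sh i)" for i j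
    using minimal_shifts(1)[OF F G, of i] bG that by blast
  have fin: "finite \<M>" by simp
  have "\<And>W. W \<in> \<M> \<Longrightarrow> W \<noteq> {} \<and> W \<subseteq> \<Union>\<M>" using M ne by auto
  from koszul_resolution[OF fin M(2) this]
  obtain N and d :: "nat \<Rightarrow> ('v, 'k) mpoly mat" where K: "graded_resolution (ideal_vec (sqfree_ideal \<M>)) N d" "N 0 = [0]"
    "\<forall>i. irr_mat (d i)" "\<forall>i. map_mat (poly_filter (supp_in (\<Union>\<M>))) (d i) = d i"
    "(\<Sum>W\<in>\<M>. int (card W)) \<in> set (N (card \<M>))" by blast
  have "set (N (card \<M>)) \<subseteq> set (L (card \<M>))"
    by (rule restriction_shifts[OF R(1) L0 K(1,2) _ _ M(1), of "\<Union>\<M>"]) (use K(3,4) ind in auto)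
  also have "\<dots> \<subseteq> set (sh (card \<M>))" by (rule minimal_shifts(2)[OF F R(1) L0 irr])
  finally have top: "int (card \<M> + r) \<in> set (sh (card \<M>))" using K(5) r by (metis of_nat_sum subsetD)
  have betti: "graded_betti ?I i j \<noteq> 0 \<longleftrightarrow> j \<in> set (sh i)" for i j
    unfolding graded_betti_def sh_def[symmetric] by (simp add: count_list_0_iff)
  show ?thesis unfolding regularity_quot_def betti
  proof (rule Max_eqI)
    show "finite {j - int i | i j. j \<in> set (sh i)}"
      by (rule finite_subset[of _ "{0..int r}"]) (use up in force)+
    show "y \<le> int r" if "y \<in> {j - int i | i j. j \<in> set (sh i)}" for y
      using that up by force
    show "int r \<in> {j - int i | i j. j \<in> set (sh i)}"
      using top by (intro CollectI exI[of _ "card \<M>"] exI[of _ "int (card \<M> + r)"]) simp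
  qed
qed

section \<open>The ideal of a path\<close>

text \<open>Vertices are addressed by their positions on the path. This turns the arithmetic of the path into arithmetic of
natural numbers.\<close>

definition pos_ideal :: "(nat \<Rightarrow> 'v) \<Rightarrow> nat set set \<Rightarrow> ('v, 'k::field) mpoly set" where
  "pos_ideal f \<P> = sqfree_ideal ((`) f ` \<P>)"

lemma pos_ideal_cong:
  assumes "\<And>P. P \<in> \<P> \<Longrightarrow> \<exists>Q\<in>\<Q>. Q \<subseteq> P" "\<And>Q. Q \<in> \<Q> \<Longrightarrow> \<exists>P\<in>\<P>. P \<subseteq> Q"
  shows "pos_ideal f \<P> = pos_ideal f \<Q>"
  unfolding pos_ideal_def
proof (rule sqfree_ideal_cong)
  show "\<exists>W'\<in>(`) f ` \<Q>. W' \<subseteq> W" if W: "W \<in> (`) f ` \<P>" for W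
  proof -
    obtain P where "P \<in> \<P>" "W = f ` P" using W by blast
    thus ?thesis using assms(1)[of P] by (meson image_eqI image_mono)
  qed
  show "\<exists>W'\<in>(`) f ` \<P>. W' \<subseteq> W" if W: "W \<in> (`) f ` \<Q>" for W
  proof -
    obtain Q where "Q \<in> \<Q>" "W = f ` Q" using W by blast
    thus ?thesis using assms(2)[of Q] by (meson image_eqI image_mono)
  qed
qed

lemma regularity_le_pos_insert:
  fixes f :: "nat \<Rightarrow> 'v::finite"
  assumes inj: "inj_on f (\<Union>\<P> \<union> W)"
    and "regularity_le (pos_ideal f \<P> :: ('v, 'k::field) mpoly set) r"
    and s: "regularity_le (pos_ideal f ((\<lambda>P. P - W) ` \<P>) :: ('v, 'k) mpoly set) s"
    and W: "W \<noteq> {}" "s + card W \<le> r + 1"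
  shows "regularity_le (pos_ideal f (insert W \<P>) :: ('v, 'k) mpoly set) r"
proof -
  have "f ` (P - W) = f ` P - f ` W" if "P \<in> \<P>" for P
    by (rule inj_on_image_set_diff[OF inj]) (use that in auto)
  hence "(`) f ` (\<lambda>P. P - W) ` \<P> = (\<lambda>V. V - f ` W) ` (`) f ` \<P>"
    by (auto simp: image_image intro!: image_cong)
  moreover have "card (f ` W) = card W" by (rule card_image[OF inj_on_subset[OF inj]]) auto
  ultimately show ?thesis
    using regularity_le_insert[of "(`) f ` \<P>" r "f ` W" s] assms by (simp add: pos_ideal_def)
qed

lemma regularity_le_pos_variables:
  fixes f :: "nat \<Rightarrow> 'v::finite"
  assumes "finite V" "V \<inter> \<Union>\<P> = {}" "inj_on f (\<Union>\<P> \<union> V)"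
    and "regularity_le (pos_ideal f \<P> :: ('v, 'k::field) mpoly set) r"
  shows "regularity_le (pos_ideal f (\<P> \<union> (\<lambda>v. {v}) ` V) :: ('v, 'k) mpoly set) r"
  using assms
proof (induction V rule: finite_induct)
  case (insert v V)
  let ?\<P> = "\<P> \<union> (\<lambda>v. {v}) ` V"
  have IH: "regularity_le (pos_ideal f ?\<P> :: ('v, 'k) mpoly set) r"
    by (rule insert.IH) (use insert.prems in \<open>auto intro: inj_on_subset\<close>)
  have "P - {v} = P" if "P \<in> ?\<P>" for P using insert that by auto
  hence "(\<lambda>P. P - {v}) ` ?\<P> = ?\<P>" by simp
  hence "regularity_le (pos_ideal f (insert {v} ?\<P>) :: ('v, 'k) mpoly set) r"
    using IH insert.prems(2) by (intro regularity_le_pos_insert[where s = r]) (auto intro: inj_on_subset)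
  thus ?case by simp
qed simp

text \<open>The edges of the square of the path on the positions \<open>3, \<dots>, m\<close>. Positions \<open>1\<close> and \<open>2\<close> are left out since these
variables are themselves generators of the neighborhood ideal.\<close>

definition square_path :: "nat \<Rightarrow> nat set set" where
  "square_path m = {{i, j} | i j. 3 \<le> i \<and> i < j \<and> j \<le> i + 2 \<and> j \<le> m}"

lemma square_path_Union: "\<Union>(square_path m) \<subseteq> {3..m}"
  by (auto simp: square_path_def)

lemma square_pathI: "3 \<le> i \<Longrightarrow> i < j \<Longrightarrow> j \<le> i + 2 \<Longrightarrow> j \<le> m \<Longrightarrow> {i, j} \<in> square_path m"
  by (auto simp: square_path_def)

lemma square_pathE:
  assumes "P \<in> square_path m"
  obtains i j where "P = {i, j}" "3 \<le> i" "i < j" "j \<le> i + 2" "j \<le> m"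
  using assms by (auto simp: square_path_def)

lemma square_path_mono: "m \<le> m' \<Longrightarrow> square_path m \<subseteq> square_path m'"
  unfolding square_path_def using order_trans by blast

text \<open>An edge that ends in \<open>k + 3\<close>, divided by that variable, is \<open>k + 1\<close> or \<open>k + 2\<close>, and these two variables absorb all
edges through them.\<close>

lemma colon_consecutive:
  "pos_ideal f ((\<lambda>P. P - {k + 3, k + 4}) ` square_path (k + 3))
       = pos_ideal f (square_path k \<union> (\<lambda>v. {v}) ` {v \<in> {k + 1, k + 2}. 3 \<le> v})"
proof (rule pos_ideal_cong)
  fix P assume "P \<in> (\<lambda>P. P - {k + 3, k + 4}) ` square_path (k + 3)"
  then obtain i j where P: "P = {i, j} - {k + 3, k + 4}" and ij: "3 \<le> i" "i < j" "j \<le> i + 2" "j \<le> k + 3"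
    by (auto elim: square_pathE)
  have "i = k + 1 \<or> i = k + 2 \<or> (j = k + 1 \<or> j = k + 2) \<or> j \<le> k" using ij by linarith
  thus "\<exists>Q\<in>square_path k \<union> (\<lambda>v. {v}) ` {v \<in> {k + 1, k + 2}. 3 \<le> v}. Q \<subseteq> P"
  proof (elim disjE)
    assume "j \<le> k"
    hence "{i, j} \<in> square_path k" "{i, j} \<subseteq> P" unfolding P using ij by (auto intro: square_pathI)
    thus ?thesis by blast
  next
    assume "i = k + 1"
    hence "i \<in> P" "i \<in> {v \<in> {k + 1, k + 2}. 3 \<le> v}" unfolding P using ij(1) by simp_all
    thus ?thesis by blast
  next
    assume "i = k + 2"
    hence "i \<in> P" "i \<in> {v \<in> {k + 1, k + 2}. 3 \<le> v}" unfolding P using ij(1) by simp_all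
    thus ?thesis by blast
  next
    assume "j = k + 1"
    hence "j \<in> P" "j \<in> {v \<in> {k + 1, k + 2}. 3 \<le> v}" unfolding P using ij by simp_all
    thus ?thesis by blast
  next
    assume "j = k + 2"
    hence "j \<in> P" "j \<in> {v \<in> {k + 1, k + 2}. 3 \<le> v}" unfolding P using ij by simp_all
    thus ?thesis by blast
  qed
next
  fix Q assume Q: "Q \<in> square_path k \<union> (\<lambda>v. {v}) ` {v \<in> {k + 1, k + 2}. 3 \<le> v}"
  have "\<exists>P\<in>square_path (k + 3). P - {k + 3, k + 4} \<subseteq> Q"
  proof (cases "Q \<in> square_path k")
    case True
    hence "Q \<in> square_path (k + 3)" using square_path_mono[of k "k + 3"] by auto
    thus ?thesis by (intro bexI[of _ Q]) auto
  next
    case False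
    then obtain v where v: "Q = {v}" "v = k + 1 \<or> v = k + 2" "3 \<le> v" using Q by auto
    have "{v, k + 3} \<in> square_path (k + 3)" by (rule square_pathI) (use v(2,3) in linarith)+
    moreover have "{v, k + 3} - {k + 3, k + 4} \<subseteq> Q" unfolding v(1) by auto
    ultimately show ?thesis by (rule bexI[rotated])
  qed
  thus "\<exists>P\<in>(\<lambda>P. P - {k + 3, k + 4}) ` square_path (k + 3). P \<subseteq> Q" by blast
qed

lemma colon_gap:
  "pos_ideal f ((\<lambda>P. P - {k + 3, k + 5}) ` insert {k + 4, k + 5} (square_path (k + 4)))
       = pos_ideal f (square_path k \<union> (\<lambda>v. {v}) ` {v \<in> {k + 1, k + 2, k + 4}. 3 \<le> v})"
proof (rule pos_ideal_cong)
  fix P assume "P \<in> (\<lambda>P. P - {k + 3, k + 5}) ` insert {k + 4, k + 5} (square_path (k + 4))"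
  then consider "P = {k + 4, k + 5} - {k + 3, k + 5}"
    | P' where "P = P' - {k + 3, k + 5}" "P' \<in> square_path (k + 4)" by blast
  then consider "P = {k + 4, k + 5} - {k + 3, k + 5}"
    | i j where "P = {i, j} - {k + 3, k + 5}" "3 \<le> i" "i < j" "j \<le> i + 2" "j \<le> k + 4"
    by (metis square_pathE)
  thus "\<exists>Q\<in>square_path k \<union> (\<lambda>v. {v}) ` {v \<in> {k + 1, k + 2, k + 4}. 3 \<le> v}. Q \<subseteq> P"
  proof cases
    case 1
    have "{k + 4} \<subseteq> P" unfolding 1 by auto
    moreover have "{k + 4} \<in> square_path k \<union> (\<lambda>v. {v}) ` {v \<in> {k + 1, k + 2, k + 4}. 3 \<le> v}" by simp
    ultimately show ?thesis by (rule bexI)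
  next
    case (2 i j)
    note P = 2(1) and ij = 2(2-5)
    have "j \<le> k \<or> j = k + 1 \<or> j = k + 2 \<or> j = k + 4 \<or> (j = k + 3 \<and> (i = k + 1 \<or> i = k + 2))"
      using ij by linarith
    moreover have ?thesis if "j \<le> k"
    proof -
      have "{i, j} \<in> square_path k" "{i, j} \<subseteq> P" unfolding P using ij that by (auto intro: square_pathI)
      thus ?thesis by blast
    qed
    moreover have ?thesis if "v \<in> P" "v \<in> {v \<in> {k + 1, k + 2, k + 4}. 3 \<le> v}" for v
      using that by blast
    moreover have "j \<in> P \<and> j \<in> {v \<in> {k + 1, k + 2, k + 4}. 3 \<le> v}" if "j = k + 1 \<or> j = k + 2 \<or> j = k + 4"
      unfolding P using that ij by (elim disjE) simp_all
    moreover have "i \<in> P \<and> i \<in> {v \<in> {k + 1, k + 2, k + 4}. 3 \<le> v}" if "i = k + 1 \<or> i = k + 2"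
      unfolding P using that ij by (elim disjE) simp_all
    ultimately show ?thesis by blast
  qed
next
  fix Q assume Q: "Q \<in> square_path k \<union> (\<lambda>v. {v}) ` {v \<in> {k + 1, k + 2, k + 4}. 3 \<le> v}"
  have "\<exists>P\<in>insert {k + 4, k + 5} (square_path (k + 4)). P - {k + 3, k + 5} \<subseteq> Q"
  proof (cases "Q \<in> square_path k")
    case True
    hence "Q \<in> square_path (k + 4)" using square_path_mono[of k "k + 4"] by auto
    thus ?thesis by (intro bexI[of _ Q]) auto
  next
    case False
    then obtain v where v: "Q = {v}" "v = k + 1 \<or> v = k + 2 \<or> v = k + 4" "3 \<le> v" using Q by auto
    show ?thesis
    proof (cases "v = k + 4")
      case True
      hence "{k + 4, k + 5} - {k + 3, k + 5} \<subseteq> Q" unfolding v(1) by auto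
      thus ?thesis by (rule bexI) simp
    next
      case False
      have "{v, k + 3} \<in> square_path (k + 4)" by (rule square_pathI) (use v(2,3) False in linarith)+
      moreover have "{v, k + 3} - {k + 3, k + 5} \<subseteq> Q" unfolding v(1) by auto
      ultimately show ?thesis by (intro bexI[of _ "{v, k + 3}"]) simp_all
    qed
  qed
  thus "\<exists>P\<in>(\<lambda>P. P - {k + 3, k + 5}) ` insert {k + 4, k + 5} (square_path (k + 4)). P \<subseteq> Q" by blast
qed

lemma square_path_Suc: "square_path (k + 1) = square_path k \<union> {{i, k + 1} | i. 3 \<le> i \<and> (i = k \<or> i + 1 = k)}"
proof (intro equalityI subsetI)
  fix P assume "P \<in> square_path (k + 1)"
  then obtain i j where P: "P = {i, j}" and ij: "3 \<le> i" "i < j" "j \<le> i + 2" "j \<le> k + 1" by (rule square_pathE)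
  show "P \<in> square_path k \<union> {{i, k + 1} | i. 3 \<le> i \<and> (i = k \<or> i + 1 = k)}"
  proof (cases "j = k + 1")
    case True
    hence "i = k \<or> i + 1 = k" using ij by linarith
    thus ?thesis using P ij True by blast
  next
    case False
    hence "P \<in> square_path k" unfolding P using ij by (intro square_pathI) auto
    thus ?thesis by simp
  qed
next
  fix P assume "P \<in> square_path k \<union> {{i, k + 1} | i. 3 \<le> i \<and> (i = k \<or> i + 1 = k)}"
  thus "P \<in> square_path (k + 1)"
  proof
    assume "P \<in> square_path k"
    thus ?thesis using square_path_mono[of k "k + 1"] by auto
  next
    assume "P \<in> {{i, k + 1} | i. 3 \<le> i \<and> (i = k \<or> i + 1 = k)}"
    then obtain i where "P = {i, k + 1}" "3 \<le> i" "i = k \<or> i + 1 = k" by blast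
    thus ?thesis by (simp only:) (rule square_pathI, auto)
  qed
qed

lemma square_path_4: "square_path 4 = insert {3, 4} (square_path 3)"
proof -
  have "{{i, 3 + 1} | i. 3 \<le> i \<and> (i = 3 \<or> i + 1 = 3)} = {{3, 4 :: nat}}" by auto
  thus ?thesis using square_path_Suc[of 3] by simp
qed

lemma square_path_5: "square_path (k + 5) = insert {k + 3, k + 5} (insert {k + 4, k + 5} (square_path (k + 4)))"
proof -
  have "{{i, k + 4 + 1} | i. 3 \<le> i \<and> (i = k + 4 \<or> i + 1 = k + 4)} = {{k + 3, k + 5}, {k + 4, k + 5}}"
    by (auto simp: numeral_eq_Suc)
  moreover have "k + 4 + 1 = k + 5" by simp
  ultimately show ?thesis using square_path_Suc[of "k + 4"] by (simp only:) blast
qed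

text \<open>At most two edges end in \<open>m = k + 4\<close>, namely \<open>{k + 3, k + 4}\<close> and \<open>{k + 2, k + 4}\<close>. Adding the first one, the colon
ideal consists of the edges up to \<open>k\<close> and of variables; adding the second one, the edges up to \<open>k - 1\<close> remain. Each
cone adds one to the bound for the colon ideal, so the bound grows by one with every four positions.\<close>

theorem regularity_le_square_path:
  fixes f :: "nat \<Rightarrow> 'v::finite"
  assumes "inj_on f {1..m}"
  shows "regularity_le (pos_ideal f (square_path m) :: ('v, 'k::field) mpoly set) (m div 4)"
  using assms
proof (induction m rule: less_induct)
  case (less m)
  have IH: "regularity_le (pos_ideal f (square_path k) :: ('v, 'k) mpoly set) (k div 4)" if "k < m" for k
    by (rule less.IH[OF that inj_on_subset[OF less.prems]]) (use that in auto)
  have vars: "regularity_le (pos_ideal f (square_path k \<union> (\<lambda>v. {v}) ` V) :: ('v, 'k) mpoly set) (k div 4)"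
    if "k < m" "V \<subseteq> {k + 1..m}" for k V
  proof (rule regularity_le_pos_variables[OF _ _ _ IH[OF that(1)]])
    show "finite V" using that(2) by (rule finite_subset) simp
    show "V \<inter> \<Union>(square_path k) = {}" using that(2) square_path_Union[of k] by fastforce
    show "inj_on f (\<Union>(square_path k) \<union> V)"
      by (rule inj_on_subset[OF less.prems]) (use that square_path_Union[of k] in fastforce)
  qed
  have cone: "regularity_le (pos_ideal f (insert {k + 3, m} (square_path (m - 1) \<union> \<Q>)) :: ('v, 'k) mpoly set) (m div 4)"
    if "regularity_le (pos_ideal f (square_path (m - 1) \<union> \<Q>) :: ('v, 'k) mpoly set) (m div 4)"
      "regularity_le (pos_ideal f ((\<lambda>P. P - {k + 3, m}) ` (square_path (m - 1) \<union> \<Q>)) :: ('v, 'k) mpoly set) (k div 4)"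
      "k + 3 < m" "\<Union>\<Q> \<subseteq> {1..m}" for k \<Q>
  proof (rule regularity_le_pos_insert[OF _ that(1,2)])
    have "\<Union>(square_path (m - 1) \<union> \<Q>) \<union> {k + 3, m} \<subseteq> {1..m}"
      using that(3,4) square_path_Union[of "m - 1"] by fastforce
    thus "inj_on f (\<Union>(square_path (m - 1) \<union> \<Q>) \<union> {k + 3, m})" by (rule inj_on_subset[OF less.prems])
    have "card {k + 3, m} = 2" using that(3) by simp
    thus "k div 4 + card {k + 3, m} \<le> m div 4 + 1" using that(3) by simp
  qed simp
  have "m < 4 \<or> (\<exists>k. m = k + 4)" by presburger
  then consider "m < 4" | k where "m = k + 4" by blast
  thus ?case
  proof cases
    case 1
    hence "square_path m = {}" by (auto simp: square_path_def)
    thus ?thesis using regularity_le_mono[OF regularity_le_empty] by (simp add: pos_ideal_def)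
  next
    case (2 k)
    have J: "regularity_le (pos_ideal f (insert {k + 3, m} (square_path (k + 3))) :: ('v, 'k) mpoly set) (m div 4)"
    proof -
      have "regularity_le (pos_ideal f (square_path (k + 3)) :: ('v, 'k) mpoly set) (m div 4)"
        by (rule regularity_le_mono[OF IH]) (use 2 in auto)
      moreover have "regularity_le (pos_ideal f ((\<lambda>P. P - {k + 3, m}) ` square_path (k + 3)) :: ('v, 'k) mpoly set) (k div 4)"
        unfolding 2 colon_consecutive by (rule vars) (use 2 in auto)
      ultimately show ?thesis using cone[of "{}" k] 2 by (simp add: add.commute[of 3 k])
    qed
    \<comment> \<open>For \<open>m = 4\<close> there is no second edge, since it would have to start in position \<open>2\<close>.\<close>
    show ?thesis
    proof (cases k)
      case 0
      thus ?thesis using J 2 square_path_4 by simp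
    next
      case (Suc l)
      hence m: "m = l + 5" using 2 by simp
      have e: "insert {l + 4, l + 5} (square_path (l + 4)) = square_path (m - 1) \<union> {{l + 4, m}}"
        by (simp add: m add.commute[of 4 l])
      have "insert {k + 3, m} (square_path (k + 3)) = insert {l + 4, l + 5} (square_path (l + 4))"
        using Suc m by (simp add: add.commute)
      hence "regularity_le (pos_ideal f (square_path (m - 1) \<union> {{l + 4, m}}) :: ('v, 'k) mpoly set) (m div 4)"
        using J e by simp
      moreover have "regularity_le (pos_ideal f ((\<lambda>P. P - {l + 3, m}) ` (square_path (m - 1) \<union> {{l + 4, m}})) :: ('v, 'k) mpoly set) (l div 4)"
      proof -
        have "regularity_le (pos_ideal f (square_path l \<union> (\<lambda>v. {v}) ` {v \<in> {l + 1, l + 2, l + 4}. 3 \<le> v}) :: ('v, 'k) mpoly set) (l div 4)"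
          by (rule vars) (use m in auto)
        thus ?thesis unfolding colon_gap[symmetric] e[symmetric] using m by simp
      qed
      ultimately have "regularity_le (pos_ideal f (insert {l + 3, m} (square_path (m - 1) \<union> {{l + 4, m}})) :: ('v, 'k) mpoly set) (m div 4)"
        by (rule cone) (use m in auto)
      thus ?thesis unfolding e[symmetric] using square_path_5[of l] m by simp
    qed
  qed
qed

subsection \<open>Generators of the neighborhood ideal\<close>

lemma nbhd_ideal_eq_sqfree_ideal:
  fixes E :: "'v::finite graph"
  shows "(nbhd_ideal k E :: ('v, 'k::field) mpoly set)
       = sqfree_ideal {W. \<exists>i. W \<subseteq> closed_nbhd E i \<and> card W = k i}"
proof -
  let ?G = "\<lambda>i. {W. W \<subseteq> closed_nbhd E i \<and> card W = k i}"
  have "(\<Sum>i\<in>F. ideal.span (sqfree_monom ` ?G i)) = (ideal.span (sqfree_monom ` (\<Union>i\<in>F. ?G i)) :: ('v, 'k) mpoly set)"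
    if "finite F" for F
    using that
  proof (induction F rule: finite_induct)
    case empty thus ?case by (simp add: set_zero)
  next
    case (insert i F)
    thus ?case by (simp add: image_Un ideal.span_Un set_plus_def) blast
  qed
  from this[of UNIV] have "(\<Sum>i\<in>UNIV. ideal.span (sqfree_monom ` ?G i)) = (sqfree_ideal (\<Union>i. ?G i) :: ('v, 'k) mpoly set)"
    by (simp add: sqfree_ideal_eq_span)
  moreover have "{\<Prod>j\<in>W. var j |W. W \<subseteq> closed_nbhd E i \<and> card W = k i} = (sqfree_monom ` ?G i :: ('v, 'k) mpoly set)" for i
    by (auto simp: sqfree_monom_def)
  moreover have "(\<Union>i. ?G i) = {W. \<exists>i. W \<subseteq> closed_nbhd E i \<and> card W = k i}" by auto
  ultimately show ?thesis by (simp add: nbhd_ideal_def)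
qed

locale path_order =
  fixes f :: "nat \<Rightarrow> 'v::finite" and n :: nat and E :: "'v graph"
  assumes n2: "2 \<le> n" and bij: "bij_betw f {1..n} UNIV"
    and E: "E = {{f i, f (i + 1)} | i. 1 \<le> i \<and> i < n}"
begin

lemma inj: "inj_on f {1..n}" and surj: "f ` {1..n} = UNIV"
  using bij by (auto simp: bij_betw_def)

lemma f_eq: "i \<in> {1..n} \<Longrightarrow> j \<in> {1..n} \<Longrightarrow> f i = f j \<longleftrightarrow> i = j"
  by (rule inj_on_eq_iff[OF inj])

lemma edge_iff: "i \<in> {1..n} \<Longrightarrow> j \<in> {1..n} \<Longrightarrow> {f i, f j} \<in> E \<longleftrightarrow> i = j + 1 \<or> j = i + 1"
proof -
  assume ij: "i \<in> {1..n}" "j \<in> {1..n}"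
  have "{f i, f j} \<in> E \<longleftrightarrow> (\<exists>k. 1 \<le> k \<and> k < n \<and> {f i, f j} = {f k, f (k + 1)})"
    unfolding E by blast
  also have "\<dots> \<longleftrightarrow> (\<exists>k. 1 \<le> k \<and> k < n \<and> (i = k \<and> j = k + 1 \<or> i = k + 1 \<and> j = k))"
  proof (intro ex_cong1 conj_cong refl)
    fix k assume k: "1 \<le> k" "k < n"
    hence r: "k \<in> {1..n}" "k + 1 \<in> {1..n}" by auto
    show "{f i, f j} = {f k, f (k + 1)} \<longleftrightarrow> i = k \<and> j = k + 1 \<or> i = k + 1 \<and> j = k"
      unfolding doubleton_eq_iff f_eq[OF ij(1) r(1)] f_eq[OF ij(1) r(2)] f_eq[OF ij(2) r(1)] f_eq[OF ij(2) r(2)] ..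
  qed
  also have "\<dots> \<longleftrightarrow> i = j + 1 \<or> j = i + 1" using ij by auto
  finally show "{f i, f j} \<in> E \<longleftrightarrow> i = j + 1 \<or> j = i + 1" .
qed

lemma nbhd: "i \<in> {1..n} \<Longrightarrow> closed_nbhd E (f i) = f ` ({i - 1, i, i + 1} \<inter> {1..n})"
proof -
  assume i: "i \<in> {1..n}"
  have *: "f j \<in> closed_nbhd E (f i) \<longleftrightarrow> j \<in> {i - 1, i, i + 1} \<inter> {1..n}" if j: "j \<in> {1..n}" for j
  proof -
    have "f j \<in> closed_nbhd E (f i) \<longleftrightarrow> j = i \<or> i = j + 1 \<or> j = i + 1"
      unfolding closed_nbhd_def using edge_iff[OF i j] f_eq[OF j i] by simp
    also have "\<dots> \<longleftrightarrow> j \<in> {i - 1, i, i + 1} \<inter> {1..n}" using i j by auto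
    finally show ?thesis .
  qed
  show ?thesis
  proof (intro equalityI subsetI)
    fix v assume v: "v \<in> closed_nbhd E (f i)"
    obtain j where j: "j \<in> {1..n}" "v = f j" using surj by blast
    thus "v \<in> f ` ({i - 1, i, i + 1} \<inter> {1..n})" using * v by blast
  next
    fix v assume "v \<in> f ` ({i - 1, i, i + 1} \<inter> {1..n})"
    then obtain j where j: "j \<in> {i - 1, i, i + 1} \<inter> {1..n}" "v = f j" by blast
    hence "j \<in> {1..n}" by blast
    thus "v \<in> closed_nbhd E (f i)" using * j by blast
  qed
qed

lemma degree: "i \<in> {1..n} \<Longrightarrow> degree_vector E (f i) = card {k. 1 \<le> k \<and> k < n \<and> (k = i \<or> k + 1 = i)}"
proof -
  assume i: "i \<in> {1..n}"
  let ?e = "\<lambda>k. {f k, f (k + 1)}"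
  have m: "f i \<in> ?e k \<longleftrightarrow> k = i \<or> k + 1 = i" if k: "1 \<le> k" "k < n" for k
    using f_eq[OF i, of k] f_eq[OF i, of "k + 1"] k by auto
  have "{e \<in> E. f i \<in> e} = ?e ` {k. 1 \<le> k \<and> k < n \<and> f i \<in> ?e k}"
    unfolding E by blast
  also have "\<dots> = ?e ` {k. 1 \<le> k \<and> k < n \<and> (k = i \<or> k + 1 = i)}"
    using m by (intro arg_cong[of _ _ "(`) ?e"]) blast
  finally have "{e \<in> E. f i \<in> e} = ?e ` {k. 1 \<le> k \<and> k < n \<and> (k = i \<or> k + 1 = i)}" .
  moreover have "inj_on ?e {k. 1 \<le> k \<and> k < n \<and> (k = i \<or> k + 1 = i)}"
  proof (rule inj_onI)
    fix k l assume kl: "k \<in> {k. 1 \<le> k \<and> k < n \<and> (k = i \<or> k + 1 = i)}"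
      "l \<in> {k. 1 \<le> k \<and> k < n \<and> (k = i \<or> k + 1 = i)}" "?e k = ?e l"
    hence r: "k \<in> {1..n}" "k + 1 \<in> {1..n}" "l \<in> {1..n}" "l + 1 \<in> {1..n}" by auto
    have "k = l \<or> k = l + 1 \<and> k + 1 = l"
      using kl(3) f_eq[OF r(1,3)] f_eq[OF r(1,4)] f_eq[OF r(2,3)] unfolding doubleton_eq_iff by blast
    thus "k = l" by linarith
  qed
  ultimately show ?thesis unfolding degree_vector_def by (simp add: card_image)
qed

lemma degree_end: "degree_vector E (f 1) = 1" "degree_vector E (f n) = 1"
proof -
  have "{k. 1 \<le> k \<and> k < n \<and> (k = 1 \<or> k + 1 = 1)} = {1}" "{k. 1 \<le> k \<and> k < n \<and> (k = n \<or> k + 1 = n)} = {n - 1}"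
    using n2 by auto
  thus "degree_vector E (f 1) = 1" "degree_vector E (f n) = 1" using degree[of 1] degree[of n] n2 by simp_all
qed

lemma degree_mid: "1 < i \<Longrightarrow> i < n \<Longrightarrow> degree_vector E (f i) = 2"
proof -
  assume i: "1 < i" "i < n"
  hence "{k. 1 \<le> k \<and> k < n \<and> (k = i \<or> k + 1 = i)} = {i - 1, i}" by auto
  thus ?thesis using degree[of i] i by simp
qed

text \<open>The end vertices of the path have degree one, so all variables in their closed neighborhoods are generators. Any
other vertex contributes the pairs in three consecutive positions, of which those with a position outside
\<open>3, \<dots>, n - 2\<close> are multiples of these variables.\<close>

definition gens :: "nat set set" where
  "gens = square_path (n - 2) \<union> (\<lambda>v. {v}) ` {1, 2, n - 1, n}"

lemma gens_range: "P \<in> gens \<Longrightarrow> P \<subseteq> {1..n}"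
  using n2 square_path_Union[of "n - 2"] by (fastforce simp: gens_def)

lemma nbhd_gens: "nbhd_ideal (degree_vector E) E = (pos_ideal f gens :: ('v, 'k::field) mpoly set)"
  unfolding nbhd_ideal_eq_sqfree_ideal pos_ideal_def
proof (rule sqfree_ideal_cong)
  fix W assume "W \<in> {W. \<exists>i. W \<subseteq> closed_nbhd E i \<and> card W = degree_vector E i}"
  then obtain v where "W \<subseteq> closed_nbhd E v" "card W = degree_vector E v" by blast
  moreover obtain i where i: "i \<in> {1..n}" "v = f i" using surj by blast
  ultimately have W: "W \<subseteq> f ` ({i - 1, i, i + 1} \<inter> {1..n})" "card W = degree_vector E (f i)"
    using nbhd by auto
  then obtain P where P: "P \<subseteq> {i - 1, i, i + 1} \<inter> {1..n}" "W = f ` P" by (auto simp: subset_image_iff)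
  have cP: "card P = degree_vector E (f i)"
    using W(2) card_image[OF inj_on_subset[OF inj], of P] P by auto
  have "\<exists>Q\<in>gens. Q \<subseteq> P"
  proof (cases "1 < i \<and> i < n")
    case False
    hence ie: "i = 1 \<or> i = n" using i by auto
    hence "card P = 1" using cP degree_end by auto
    then obtain p where "P = {p}" by (auto simp: card_1_singleton_iff)
    moreover have "p \<in> {1, 2, n - 1, n}" using P(1) ie \<open>P = {p}\<close> by auto
    ultimately show ?thesis by (auto simp: gens_def)
  next
    case True
    hence "card P = 2" using cP degree_mid by simp
    then obtain a b where "P = {a, b}" "a \<noteq> b" by (auto simp: card_2_iff)
    hence "\<exists>a b. P = {a, b} \<and> a < b" by (metis insert_commute linorder_neqE_nat)
    then obtain a b where ab: "P = {a, b}" "a < b" by blast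
    have r: "1 \<le> a" "b \<le> a + 2" "b \<le> n" using P(1) ab by auto
    have "a = 1 \<or> a = 2 \<or> b = n - 1 \<or> b = n \<or> (3 \<le> a \<and> b \<le> n - 2)" using r ab(2) by linarith
    then consider "a \<in> {1, 2}" | "b \<in> {n - 1, n}" | "3 \<le> a" "b \<le> n - 2" by blast
    thus ?thesis
    proof cases
      case 1 thus ?thesis using ab by (intro bexI[of _ "{a}"]) (auto simp: gens_def)
    next
      case 2 thus ?thesis using ab by (intro bexI[of _ "{b}"]) (auto simp: gens_def)
    next
      case 3 thus ?thesis using ab r by (intro bexI[of _ "{a, b}"]) (auto simp: gens_def intro: square_pathI)
    qed
  qed
  thus "\<exists>W'\<in>(`) f ` gens. W' \<subseteq> W" using P(2) by blast
next
  fix W assume "W \<in> (`) f ` gens"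
  then obtain P where P: "W = f ` P" "P \<in> gens" by blast
  have cW: "card W = card P" unfolding P(1) by (rule card_image[OF inj_on_subset[OF inj gens_range[OF P(2)]]])
  have "\<exists>i\<in>{1..n}. P \<subseteq> {i - 1, i, i + 1} \<inter> {1..n} \<and> card P = degree_vector E (f i)"
  proof -
    consider p where "P = {p}" "p \<in> {1, 2}" | p where "P = {p}" "p \<in> {n - 1, n}"
      | a b where "P = {a, b}" "3 \<le> a" "a < b" "b \<le> a + 2" "b \<le> n - 2"
      using P(2) by (auto simp: gens_def elim: square_pathE)
    thus ?thesis
    proof cases
      case 1 thus ?thesis using n2 degree_end by (intro bexI[of _ 1]) auto
    next
      case 2 thus ?thesis using n2 degree_end by (intro bexI[of _ n]) auto
    next
      case 3 thus ?thesis using degree_mid[of "a + 1"] by (intro bexI[of _ "a + 1"]) auto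
    qed
  qed
  then obtain i where i: "i \<in> {1..n}" "P \<subseteq> {i - 1, i, i + 1} \<inter> {1..n}" "card P = degree_vector E (f i)" by blast
  have "W \<subseteq> closed_nbhd E (f i)" unfolding P(1) nbhd[OF i(1)] by (rule image_mono[OF i(2)])
  thus "\<exists>W'\<in>{W. \<exists>i. W \<subseteq> closed_nbhd E i \<and> card W = degree_vector E i}. W' \<subseteq> W"
    using i(3) cW by auto
qed

lemma regularity_le_nbhd: "regularity_le (nbhd_ideal (degree_vector E) E :: ('v, 'k::field) mpoly set) ((n - 2) div 4)"
  unfolding nbhd_gens gens_def
proof (rule regularity_le_pos_variables)
  show "regularity_le (pos_ideal f (square_path (n - 2)) :: ('v, 'k) mpoly set) ((n - 2) div 4)"
    by (rule regularity_le_square_path[OF inj_on_subset[OF inj]]) auto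
  show "{1, 2, n - 1, n} \<inter> \<Union>(square_path (n - 2)) = {}" using square_path_Union[of "n - 2"] n2 by fastforce
  show "inj_on f (\<Union>(square_path (n - 2)) \<union> {1, 2, n - 1, n})"
    by (rule inj_on_subset[OF inj]) (use square_path_Union[of "n - 2"] n2 in fastforce)
qed simp

text \<open>Consecutive edges of the matching are separated by two positions, so no edge of the square of the path joins them.\<close>

definition matching :: "nat set set" where
  "matching = (\<lambda>t. {4 * t - 1, 4 * t}) ` {1..(n - 2) div 4}"

lemma matchingE:
  assumes "P \<in> matching"
  obtains t where "P = {4 * t - 1, 4 * t}" "1 \<le> t" "4 * t \<le> n - 2"
proof -
  obtain t where t: "P = {4 * t - 1, 4 * t}" "1 \<le> t" "t \<le> (n - 2) div 4"
    using assms unfolding matching_def by auto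
  have "4 * t \<le> n - 2" using t(3) by linarith
  thus thesis using t that by blast
qed

lemma matching_gens: "matching \<subseteq> gens"
proof
  fix P assume "P \<in> matching"
  then obtain t where t: "P = {4 * t - 1, 4 * t}" "1 \<le> t" "4 * t \<le> n - 2" by (rule matchingE)
  have "P \<in> square_path (n - 2)" unfolding t(1) by (rule square_pathI) (use t(2,3) in linarith)+
  thus "P \<in> gens" by (simp add: gens_def)
qed

lemma matching_index: "{4 * s - 1, 4 * s} \<inter> {4 * t - 1, 4 * t} \<noteq> {} \<Longrightarrow> 1 \<le> s \<Longrightarrow> 1 \<le> t \<Longrightarrow> s = t"
  for s t :: nat
proof -
  assume st: "{4 * s - 1, 4 * s} \<inter> {4 * t - 1, 4 * t} \<noteq> {}" "1 \<le> s" "1 \<le> t"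
  have "4 * s - 1 = 4 * t - 1 \<or> 4 * s - 1 = 4 * t \<or> 4 * s = 4 * t - 1 \<or> 4 * s = 4 * t" using st(1) by blast
  thus "s = t" using st(2,3) by presburger
qed

lemma matching_card: "card matching = (n - 2) div 4" "P \<in> matching \<Longrightarrow> card P = 2"
proof -
  have "inj_on (\<lambda>t::nat. {4 * t - 1, 4 * t}) {1..(n - 2) div 4}"
  proof (rule inj_onI)
    fix s t assume "s \<in> {1..(n - 2) div 4}" "t \<in> {1..(n - 2) div 4}"
      "{4 * s - 1, 4 * s} = {4 * t - 1, 4 * t}"
    thus "s = t" by (intro matching_index) auto
  qed
  thus "card matching = (n - 2) div 4" unfolding matching_def by (simp add: card_image)
  show "card P = 2" if P: "P \<in> matching"
  proof -
    obtain t where t: "P = {4 * t - 1, 4 * t}" "1 \<le> t" using P by (rule matchingE)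
    have "4 * t - 1 \<noteq> 4 * t" using t(2) by linarith
    thus ?thesis unfolding t(1) by (simp only: card_2_iff) blast
  qed
qed

lemma matching_disjoint: "pairwise disjnt matching"
proof (rule pairwiseI)
  fix P Q assume PQ: "P \<in> matching" "Q \<in> matching" "P \<noteq> Q"
  obtain s where s: "P = {4 * s - 1, 4 * s}" "1 \<le> s" using PQ(1) by (rule matchingE)
  obtain t where t: "Q = {4 * t - 1, 4 * t}" "1 \<le> t" using PQ(2) by (rule matchingE)
  show "disjnt P Q" unfolding disjnt_def using matching_index[of s t] s t PQ(3) by blast
qed

lemma matching_induced: "P \<in> gens \<Longrightarrow> P \<subseteq> \<Union>matching \<Longrightarrow> P \<in> matching"
proof -
  assume P: "P \<in> gens" "P \<subseteq> \<Union>matching"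
  have in_range: "\<exists>t. (p = 4 * t - 1 \<or> p = 4 * t) \<and> {4 * t - 1, 4 * t} \<in> matching \<and> 1 \<le> t \<and> 4 * t \<le> n - 2"
    if p: "p \<in> P" for p
  proof -
    obtain Q where Q: "Q \<in> matching" "p \<in> Q" using P(2) p by blast
    from Q(1) obtain t where "Q = {4 * t - 1, 4 * t}" "1 \<le> t" "4 * t \<le> n - 2" by (rule matchingE)
    thus ?thesis using Q by blast
  qed
  have "P \<notin> (\<lambda>v. {v}) ` {1, 2, n - 1, n}"
  proof
    assume "P \<in> (\<lambda>v. {v}) ` {1, 2, n - 1, n}"
    then obtain p where p: "p \<in> P" "p = 1 \<or> p = 2 \<or> p = n - 1 \<or> p = n" by blast
    obtain t where "p = 4 * t - 1 \<or> p = 4 * t" "1 \<le> t" "4 * t \<le> n - 2" using in_range[OF p(1)] by blast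
    thus False using p(2) n2 by linarith
  qed
  hence "P \<in> square_path (n - 2)" using P(1) unfolding gens_def by blast
  then obtain a b where ab: "P = {a, b}" "3 \<le> a" "a < b" "b \<le> a + 2" "b \<le> n - 2" by (rule square_pathE)
  obtain t where t: "a = 4 * t - 1 \<or> a = 4 * t" "{4 * t - 1, 4 * t} \<in> matching" "1 \<le> t"
    using in_range[of a] ab(1) by blast
  obtain u where u: "b = 4 * u - 1 \<or> b = 4 * u" "1 \<le> u" using in_range[of b] ab(1) by blast
  have "a = 4 * t - 1 \<and> b = 4 * t"
  proof -
    define t' u' where "t' = t - 1" and "u' = u - 1"
    hence e: "t = t' + 1" "u = u' + 1" using t(3) u(2) by auto
    have a: "a = 4 * t' + 3 \<or> a = 4 * t' + 4" and b: "b = 4 * u' + 3 \<or> b = 4 * u' + 4"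
      using t(1) u(1) unfolding e by auto
    have "u' \<le> t'"
    proof (rule ccontr)
      assume "\<not> u' \<le> t'"
      hence "4 * t' + 4 \<le> 4 * u'" by simp
      thus False using a b ab(4) by linarith
    qed
    hence "b \<le> 4 * t' + 4" using b by linarith
    hence "a = 4 * t' + 3 \<and> b = 4 * t' + 4" using a ab(3) by linarith
    thus ?thesis unfolding e by simp
  qed
  thus "P \<in> matching" using t(2) ab(1) by simp
qed

theorem regularity: "regularity_quot (nbhd_ideal (degree_vector E) E :: ('v, 'k::field) mpoly set) = int ((n - 2) div 4)"
proof -
  have inj_im: "f ` P \<subseteq> f ` Q \<longleftrightarrow> P \<subseteq> Q" if "P \<subseteq> {1..n}" "Q \<subseteq> {1..n}" for P Q
    using that f_eq by (auto simp: subset_iff image_iff)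
  have mr: "P \<subseteq> {1..n}" if "P \<in> matching" for P using that matching_gens gens_range by blast
  have U: "\<Union>((`) f ` matching) = f ` \<Union>matching" by auto
  have Ur: "\<Union>matching \<subseteq> {1..n}" using mr by blast
  have inj2: "inj_on ((`) f) matching"
    using inj_on_subset[OF inj_on_image_Pow[OF inj]] mr by blast
  have r: "regularity_le (sqfree_ideal ((`) f ` gens) :: ('v, 'k) mpoly set) ((n - 2) div 4)"
    using regularity_le_nbhd unfolding nbhd_gens pos_ideal_def .
  show ?thesis unfolding nbhd_gens pos_ideal_def
  proof (rule regularity_eqI[OF r, where \<M> = "(`) f ` matching"])
    show "{} \<notin> (`) f ` gens" by (auto simp: gens_def square_path_def)
    show "(`) f ` matching \<subseteq> (`) f ` gens" using matching_gens by blast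
    show "pairwise disjnt ((`) f ` matching)"
    proof (rule pairwiseI)
      fix V W assume "V \<in> (`) f ` matching" "W \<in> (`) f ` matching" "V \<noteq> W"
      then obtain P Q where PQ: "P \<in> matching" "Q \<in> matching" "P \<noteq> Q" "V = f ` P" "W = f ` Q" by blast
      hence "P \<inter> Q = {}" using matching_disjoint by (auto simp: pairwise_def disjnt_def)
      thus "disjnt V W" using inj_on_image_Int[OF inj mr[OF PQ(1)] mr[OF PQ(2)]] PQ by (simp add: disjnt_def)
    qed
    show "\<exists>V\<in>(`) f ` matching. V \<subseteq> W" if "W \<in> (`) f ` gens" "W \<subseteq> \<Union>((`) f ` matching)" for W
    proof -
      obtain P where P: "P \<in> gens" "W = f ` P" using \<open>W \<in> _\<close> by blast
      have "P \<subseteq> \<Union>matching" using that(2) inj_im[OF gens_range[OF P(1)] Ur] unfolding U P(2) by blast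
      thus ?thesis using matching_induced[OF P(1)] P(2) by blast
    qed
    have "(\<Sum>W\<in>(`) f ` matching. card W) = (\<Sum>P\<in>matching. card (f ` P))"
      by (simp add: sum.reindex[OF inj2])
    also have "\<dots> = (\<Sum>P\<in>matching. 2)"
      by (rule sum.cong[OF refl]) (use matching_card(2) card_image[OF inj_on_subset[OF inj mr]] in auto)
    also have "\<dots> = card ((`) f ` matching) + (n - 2) div 4"
      by (simp add: matching_card(1) card_image[OF inj2])
    finally show "(\<Sum>W\<in>(`) f ` matching. card W) = card ((`) f ` matching) + (n - 2) div 4" .
  qed
qed

text \<open>The edges \<open>{1, 2}\<close>, \<open>{3, 4}\<close>, and so on of the path are disjoint, and a vertex cover contains an end of each.\<close>

lemma vertex_cover_ge: "n div 2 \<le> vertex_cover_number E"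
proof -
  have "n div 2 \<le> card C" if C: "vertex_cover E C" for C
  proof -
    have "\<exists>x. x \<in> C \<and> x \<in> {f (2 * t - 1), f (2 * t)}" if "t \<in> {1..n div 2}" for t
    proof -
      have "{f (2 * t - 1), f (2 * t - 1 + 1)} \<in> E" unfolding E using that by fastforce
      thus ?thesis using C that by (fastforce simp: vertex_cover_def)
    qed
    then obtain g where g: "\<And>t. t \<in> {1..n div 2} \<Longrightarrow> g t \<in> C \<and> g t \<in> {f (2 * t - 1), f (2 * t)}" by metis
    have "inj_on g {1..n div 2}"
    proof (rule inj_onI)
      fix s t assume st: "s \<in> {1..n div 2}" "t \<in> {1..n div 2}" "g s = g t"
      obtain a where a: "a = 2 * s - 1 \<or> a = 2 * s" "g s = f a" using g[OF st(1)] by auto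
      obtain b where b: "b = 2 * t - 1 \<or> b = 2 * t" "g t = f b" using g[OF st(2)] by auto
      have r: "1 \<le> s" "2 * s \<le> n" "1 \<le> t" "2 * t \<le> n" using st(1,2) by auto
      have "a \<in> {1..n}" "b \<in> {1..n}" using a(1) b(1) r by auto
      hence "a = b" using f_eq a(2) b(2) st(3) by metis
      moreover have "s = (a + 1) div 2" "t = (b + 1) div 2" using a(1) b(1) r by auto
      ultimately show "s = t" by simp
    qed
    hence "card {1..n div 2} \<le> card C" by (rule card_inj_on_le) (use g in auto)
    thus ?thesis by simp
  qed
  moreover have "vertex_cover E UNIV" unfolding vertex_cover_def E by auto
  ultimately show ?thesis unfolding vertex_cover_number_def
    by (subst Min_ge_iff) auto
qed

end

theorem lemma3p4:
  fixes E :: "'v::finite graph" and n :: nat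
  assumes "n = CARD('v)" and "n \<ge> 2" and "path_graph E"
  shows "regularity_quot (nbhd_ideal (degree_vector E) E :: ('v, 'k::field) mpoly set)
           = \<lfloor>(real n - 2) / 4\<rfloor>
       \<and> regularity_quot (nbhd_ideal (degree_vector E) E :: ('v, 'k::field) mpoly set)
           \<le> int (vertex_cover_number E) - 1"
proof -
  obtain f :: "nat \<Rightarrow> 'v" where "bij_betw f {1..n} UNIV" "E = {{f i, f (i + 1)} | i. 1 \<le> i \<and> i < n}"
    using assms unfolding path_graph_def by blast
  then interpret path_order f n E by unfold_locales (use assms(2) in auto)
  have "\<lfloor>(real n - 2) / 4\<rfloor> = \<lfloor>real (n - 2) / real 4\<rfloor>" using assms(2) by (simp add: of_nat_diff)
  also have "\<dots> = int ((n - 2) div 4)" by (rule floor_divide_of_nat_eq)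
  finally have "\<lfloor>(real n - 2) / 4\<rfloor> = int ((n - 2) div 4)" .
  moreover have "int ((n - 2) div 4) \<le> int (vertex_cover_number E) - 1"
    using vertex_cover_ge assms(2) by linarith
  ultimately show ?thesis unfolding regularity by simp
qed

end
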